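(* Let $m\ge0$, let $\Gamma^m=\bigcup_{i=1}^{I_S}\Gamma^m_i$ be a polyhedral surface cluster in $\mathbb{R}^d$, $d\in\{2,3\}$, and let $S^m$, $V^h(\Gamma^m)$, $\underline V^h(\Gamma^m)$ be the finite element spaces described in the context. Fix one of the two variants of the scheme (the superscript $\cdot^{(h)}$ means throughout mass lumping, or throughout exact integration). Let $(W^{m+1},\vec X^{m+1},\kappa_\varsigma^{m+1})\in S^m\times\underline V^h(\Gamma^m)\times V^h(\Gamma^m)$ be a solution of the following nonlinear system, in which $\vec\omega^{m+\frac12}$ is the time-averaged vertex normal (depending on $\Gamma^m$ and $\Gamma^{m+1}=\vec X^{m+1}(\Gamma^m)$) defined in the context: (a) for all $\varphi\in S^m$, $$\langle\nabla W^{m+1},\nabla\varphi\rangle_\Omega+\sum_{i=1}^{I_S}(\beta_{b_i^+}-\beta_{b_i^-})\Big\langle\pi^h_i\Big[\tfrac{\vec X^{m+1}_i-\vec{\rm id}}{\tau_m}\cdot\vec\omega^{m+\frac12}_i\Big],\varphi\Big\rangle^{(h)}_{\Gamma^m_i}=0;$$ (b) for all $\xi\in V^h(\Gamma^m)$, $$\langle\kappa_\varsigma^{m+1},\xi\rangle^h_{\Gamma^m}+\sum_{i=1}^{I_S}(\beta_{b_i^+}-\beta_{b_i^-})\langle W^{m+1},\xi_i\rangle^{(h)}_{\Gamma^m_i}=0;$$ (c) for all $\vec\eta\in\underline V^h(\Gamma^m)$, $$\langle\kappa_\varsigma^{m+1}\vec\omega^{m+\frac12},\vec\eta\rangle^h_{\Gamma^m}+\sum_{i=1}^{I_S}\varsigma_i\int_{\Gamma^m_i}\nabla_\Gamma\vec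 X^{m+1}_i\cdot\nabla_\Gamma\vec\eta_i\,{\rm d}\mathscr H^{d-1}=0.$$ Then $$E(\Gamma^{m+1})+\tau_m\|\nabla W^{m+1}\|_{L^2(\Omega)}^2\le E(\Gamma^m).$$ Moreover, $v^{m+1}=v^m$, where $v^n=\sum_{\ell=1}^{I_R}\beta_\ell\,\mathscr L^d(\mathcal R_\ell[\Gamma^n])$ is the discrete total energy content.
   Context: Data. $\Omega\subset\mathbb{R}^d$, $d\in\{2,3\}$, is a bounded domain whose closure is triangulated by a finite family $\mathscr T^m$ of simplices. $I_R\ge2$ is the number of phases, $I_S\ge1$ the number of surfaces, $I_T\ge0$ the number of triple junctions. $\varsigma_i>0$ ($1\le i\le I_S$) are surface tensions. $\beta_\ell\in\mathbb R$ ($1\le \ell\le I_R$) are pairwise distinct constants, normalized by $\sum_\ell\beta_\ell=0$. For each $i$, $(b_i^+,b_i^-)\in\{1,\dots,I_R\}^2$ with $b_i^+\ne b_i^-$ is the pair of phases separated by the $i$-th surface; if $\{b_i^+,b_i^-\}=\{b_j^+,b_j^-\}$ then $(b_i^+,b_i^-)=(b_j^+,b_j^-)$. $0=t_0<t_1<\dots<t_M=T$ and $\tau_m=t_{m+1}-t_m>0$. Polyhedral cluster. Each $\Gamma^m_i\subset\Omega$ is a polyhedral hypersurface (a polygonal curve if $d=2$), with or without boundary, $\Gamma^m_i=\bigcup_{j=1}^{J_i}\overline{\sigma^m_{i,j}}$, where $\sigma^m_{i,j}$ are mutually disjoint open nondegenerate $(d-1)$-simplices, and with vertices $\vec q^m_{i,k}$,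 $k=1,\dots,K_i$. The boundary $\partial\Gamma^m_i$ is split into patches, each belonging to a triple junction. For each $k\in\{1,\dots,I_T\}$ there are indices $1\le s^k_1<s^k_2<s^k_3\le I_S$ such that one boundary patch of each of $\Gamma^m_{s^k_1},\Gamma^m_{s^k_2},\Gamma^m_{s^k_3}$ coincides (with matching vertices) with the discrete triple junction $\mathcal T^m_k$. (The cluster is the image of fixed polyhedral reference surfaces under a continuous piecewise affine map satisfying these matching conditions.) Regions. The cluster $\Gamma^m$ splits $\Omega$ into pairwise disjoint open regions, $\Omega=\Gamma^m\cup\bigcup_{\ell=1}^{I_R}\mathcal R_\ell[\Gamma^m]$ (the regions need not be connected), such that the unit normal $\vec\nu^m_i$ on $\Gamma^m_i$ points from $\mathcal R_{b_i^-}[\Gamma^m]$ into $\mathcal R_{b_i^+}[\Gamma^m]$. The new cluster $\Gamma^{m+1}=\bigcup_i\Gamma^{m+1}_i\subset\Omega$, $\Gamma^{m+1}_i=\vec X^{m+1}_i(\Gamma^m_i)$, is understood to be again such a cluster, with the same combinatorial data, splitting $\Omega$ into the corresponding regions $\mathcal R_\ell[\Gamma^{m+1}]$ (normals again pointing from phase $b_i^-$ into phase $b_i^+$, and the phases adjacent to $\partial\Omega$ unchanged). Energy. $E(\Gamma^n)=\sum_{i=1}^{I_S}\varsigma_i|\Gamma^n_i|$, where $|\Gamma^n_i|$ is the sum of the $\mathscr H^{d-1}$-measures of the simplices making up $\Gamma^n_i$ (for $n=m+1$ these are $\vec X^{m+1}_i(\sigma^m_{i,j})$). Finite element spaces. $S^m=\{v\in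 C(\overline\Omega): v|_o \text{ is affine for all } o\in\mathscr T^m\}$. $V^h(\Gamma^m_i)=\{v\in C(\Gamma^m_i): v|_{\sigma^m_{i,j}}\text{ is affine for all }j\}$, $\underline V^h(\Gamma^m_i)=[V^h(\Gamma^m_i)]^d$. $V^h(\Gamma^m)=\prod_{i=1}^{I_S}V^h(\Gamma^m_i)$. $\underline V^h(\Gamma^m)=\{(\vec X_1,\dots,\vec X_{I_S})\in\prod_{i}\underline V^h(\Gamma^m_i):\vec X_{s^k_1}=\vec X_{s^k_2}=\vec X_{s^k_3}\text{ on }\mathcal T^m_k,\ 1\le k\le I_T\}$. $\pi^h_i:C(\Gamma^m_i)\to V^h(\Gamma^m_i)$ is the standard nodal interpolation operator. $\vec{\rm id}$ is the identity map. Inner products. $\langle u,v\rangle_\Omega=\int_\Omega u\cdot v\,{\rm d}\mathscr L^d$; $\langle u,v\rangle_{\Gamma^m_i}=\int_{\Gamma^m_i}u\,v\,{\rm d}\mathscr H^{d-1}$. The mass lumped product of piecewise continuous $u,v$ is $$\langle u,v\rangle^h_{\Gamma^m_i}=\frac1d\sum_{j=1}^{J_i}|\sigma^m_{i,j}|\sum_{k=1}^d\lim_{\sigma^m_{i,j}\ni\vec q\to\vec q^m_{i,j,k}}(uv)(\vec q),$$ where $\vec q^m_{i,j,1},\dots,\vec q^m_{i,j,d}$ are the vertices of $\sigma^m_{i,j}$ and $|\sigma^m_{i,j}|=\mathscr H^{d-1}(\sigma^m_{i,j})$; $\langle u,v\rangle^{h}_{\Gamma^m}=\sum_i\langle u_i,v_i\rangle^{h}_{\Gamma^m_i}$.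 Products of vector- or matrix-valued functions use the Euclidean/Frobenius product. The notation $\langle\cdot,\cdot\rangle^{(h)}$ stands either everywhere for $\langle\cdot,\cdot\rangle^h$ or everywhere for the exact product $\langle\cdot,\cdot\rangle$, giving two schemes. $\nabla_\Gamma$ is the (piecewise) surface gradient. Normals. For a $(d-1)$-simplex $\sigma$ with ordered vertices $\vec q_1,\dots,\vec q_d$ put $\vec A\{\sigma\}=(\vec q_2-\vec q_1)^\perp$ if $d=2$, with $(v_1,v_2)^\perp=(-v_2,v_1)$, and $\vec A\{\sigma\}=(\vec q_2-\vec q_1)\times(\vec q_3-\vec q_1)$ if $d=3$. The vertices of all $\sigma^m_{i,j}$, $1\le j\le J_i$, are ordered with the same orientation, and $\vec\nu^m_i=\vec A\{\sigma^m_{i,j}\}/|\vec A\{\sigma^m_{i,j}\}|$ on $\sigma^m_{i,j}$. For $t\in[t_m,t_{m+1}]$ let $\sigma^h_{i,j}(t)$ be the simplex whose (correspondingly ordered) vertices are obtained from those of $\sigma^m_{i,j}$ by the linear interpolation $\vec q^h_{i,k}(t)=\frac{t_{m+1}-t}{\tau_m}\vec q^m_{i,k}+\frac{t-t_m}{\tau_m}\vec q^{m+1}_{i,k}$, with $\vec q^{m+1}_{i,k}=\vec X^{m+1}_i(\vec q^m_{i,k})$. Define the piecewise constant vector field $$\vec\nu^{m+\frac12}_i|_{\sigma^m_{i,j}}=\frac{1}{\tau_m|\vec A\{\sigma^m_{i,j}\}|}\int_{t_m}^{t_{m+1}}\vec A\{\sigma^h_{i,j}(t)\}\,{\rm d}t,$$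 and $\vec\omega^{m+\frac12}_i\in\underline V^h(\Gamma^m_i)$ by $\langle\vec\omega^{m+\frac12}_i,\vec\xi\rangle^h_{\Gamma^m_i}=\langle\vec\nu^{m+\frac12}_i,\vec\xi\rangle_{\Gamma^m_i}$ for all $\vec\xi\in\underline V^h(\Gamma^m_i)$; $\vec\omega^{m+\frac12}=(\vec\omega^{m+\frac12}_1,\dots,\vec\omega^{m+\frac12}_{I_S})$. *)

theory Defs
  imports "HOL-Analysis.Analysis"
begin

text \<open>
  The ambient space is \<open>real^'d\<close> with \<open>CARD('d) = 2\<close> or \<open>CARD('d) = 3\<close>. The sort
  \<open>{finite, comm_ring_1}\<close> of \<open>'d\<close> only serves to make the coordinate names \<open>1, 2, 3 :: 'd\<close>
  available uniformly for both dimensions, as the library does for \<open>real^2\<close> and \<open>real^3\<close>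
  (for \<open>CARD('d) = 2\<close> the coordinates are \<open>1\<close> and \<open>2 = 0\<close>, for \<open>CARD('d) = 3\<close> they are
  \<open>1\<close>, \<open>2\<close> and \<open>3 = 0\<close>).

  A \<open>(d-1)\<close>-simplex with ordered vertices is a function \<open>q :: nat \<Rightarrow> real^'d\<close>, of which only the
  values \<open>q 1, \<dots>, q d\<close> matter. The simplices of the \<open>i\<close>-th surface are \<open>q i j\<close> for
  \<open>j \<in> {1..J i}\<close>. Functions on a set are total functions of which only the values on that
  set are used.
\<close>

type_synonym 'd point = "(real, 'd) vec"

section \<open>Simplices\<close>

definition perp :: "'d::{finite,comm_ring_1} point \<Rightarrow> 'd point" where
  "perp v = (\<chi> k. if k = 1 then - (v$2) else v$1)"

definition cross :: "'d::{finite,comm_ring_1} point \<Rightarrow> 'd point \<Rightarrow> 'd point" where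
  "cross v w = (\<chi> k. if k = 1 then v$2 * w$3 - v$3 * w$2
                 else if k = 2 then v$3 * w$1 - v$1 * w$3
                 else v$1 * w$2 - v$2 * w$1)"

lemma perp_real2: "perp (v :: real^2) = vector [- (v$2), v$1]"
  by (simp add: perp_def vec_eq_iff forall_2)

lemma cross_real3: "cross (v :: real^3) w = cross3 v w"
  by (simp add: cross_def cross3_def vec_eq_iff forall_3)

definition area_vec :: "(nat \<Rightarrow> 'd::{finite,comm_ring_1} point) \<Rightarrow> 'd point" where
  "area_vec q = (if CARD('d) = 2 then perp (q 2 - q 1) else cross (q 2 - q 1) (q 3 - q 1))"

definition unit_normal :: "(nat \<Rightarrow> 'd::{finite,comm_ring_1} point) \<Rightarrow> 'd point" where
  "unit_normal q = area_vec q /\<^sub>R norm (area_vec q)"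

definition verts :: "(nat \<Rightarrow> 'd::finite point) \<Rightarrow> 'd point set" where
  "verts q = q ` {1..CARD('d)}"

definition closed_simplex :: "(nat \<Rightarrow> 'd::finite point) \<Rightarrow> 'd point set" where
  "closed_simplex q = convex hull (verts q)"

definition open_simplex :: "(nat \<Rightarrow> 'd::finite point) \<Rightarrow> 'd point set" where
  "open_simplex q = rel_interior (closed_simplex q)"

text \<open>
  The integral of \<open>f\<close> over a flat simplex with respect to the \<open>(d-1)\<close>-dimensional Hausdorff
  measure, written with the affine parametrization over the standard simplex in
  \<open>{1..<d} \<rightarrow> \<real>\<close>; its Jacobian is the constant \<open>norm (area_vec q)\<close>.
\<close>

definition std_simplex :: "nat \<Rightarrow> (nat \<Rightarrow> real) set" where
  "std_simplex n = {s \<in> {1..<n} \<rightarrow>\<^sub>E UNIV. (\<forall>k\<in>{1..<n}. 0 \<le> s k) \<and> (\<Sum>k\<in>{1..<n}. s k) \<le> 1}"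

definition simplex_integral :: "(nat \<Rightarrow> 'd::{finite,comm_ring_1} point) \<Rightarrow> ('d point \<Rightarrow> real) \<Rightarrow> real" where
  "simplex_integral q f = norm (area_vec q) *
     (LINT s:std_simplex CARD('d)|(\<Pi>\<^sub>M k\<in>{1..<CARD('d)}. lborel).
        f (q 1 + (\<Sum>k\<in>{1..<CARD('d)}. s k *\<^sub>R (q (Suc k) - q 1))))"

definition simplex_area :: "(nat \<Rightarrow> 'd::{finite,comm_ring_1} point) \<Rightarrow> real" where
  "simplex_area q = simplex_integral q (\<lambda>_. 1)"

text \<open>This is indeed the length of a segment and the area of a triangle.\<close>

lemma simplex_area_eq:
  "simplex_area (q :: nat \<Rightarrow> 'd::{finite,comm_ring_1} point) = norm (area_vec q) / fact (CARD('d) - 1)"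
proof -
  let ?I = "{1..<CARD('d)}"
  let ?M = "\<Pi>\<^sub>M k\<in>?I. (lborel :: real measure)"
  have eq: "std_simplex CARD('d) = {x. (\<forall>i\<in>?I. 0 \<le> x i) \<and> sum x ?I \<le> 1} \<inter> space ?M"
    by (auto simp: std_simplex_def space_PiM)
  have "emeasure ?M (std_simplex CARD('d)) = ennreal (1 / fact (CARD('d) - 1))"
    unfolding eq using emeasure_std_simplex_aux[of ?I 1] by simp
  then have *: "measure ?M (std_simplex CARD('d)) = 1 / fact (CARD('d) - 1)"
    by (simp add: measure_def)
  have "std_simplex CARD('d) \<inter> space ?M = std_simplex CARD('d)"
    by (auto simp: eq)
  with * show ?thesis
    by (simp add: simplex_area_def simplex_integral_def set_lebesgue_integral_def)
qed

section \<open>Polyhedral surfaces and clusters\<close>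

definition surface :: "nat \<Rightarrow> (nat \<Rightarrow> nat \<Rightarrow> 'd::finite point) \<Rightarrow> 'd point set" where
  "surface J q = (\<Union>j\<in>{1..J}. closed_simplex (q j))"

definition hypersurface_with_boundary :: "'d::{finite,comm_ring_1} point set \<Rightarrow> bool" where
  "hypersurface_with_boundary S \<longleftrightarrow>
     (\<forall>p\<in>S. \<exists>U V. p \<in> U \<and> openin (top_of_set S) U \<and>
        openin (top_of_set {x :: 'd point. x$1 = 0 \<and> 0 \<le> x$2}) V \<and> U homeomorphic V)"

text \<open>
  Two simplices \<open>p\<close>, \<open>q\<close> which share all vertices but one: replacing the extra vertex of \<open>q\<close> by
  that of \<open>p\<close> gives a reordering of the vertices of \<open>p\<close>. The orderings of \<open>p\<close> and \<open>q\<close> induce the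
  same orientation (opposite orientations on the common facet) iff this reordering is odd.
\<close>

definition same_orientation :: "(nat \<Rightarrow> 'd::finite point) \<Rightarrow> (nat \<Rightarrow> 'd point) \<Rightarrow> bool" where
  "same_orientation p q \<longleftrightarrow>
     (\<forall>l\<in>{1..CARD('d)}. \<forall>\<pi>. \<pi> permutes {1..CARD('d)} \<longrightarrow>
        (\<forall>k\<in>{1..CARD('d)} - {l}. q k = p (\<pi> k)) \<longrightarrow> sign \<pi> = - 1)"

text \<open>
  The \<open>(d-2)\<close>-simplices in the boundary of a surface, as vertex sets. A triple junction is
  given by a set of such vertex sets.
\<close>

definition boundary_faces :: "nat \<Rightarrow> (nat \<Rightarrow> nat \<Rightarrow> 'd::finite point) \<Rightarrow> 'd point set set" where
  "boundary_faces J q =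
     {F. card F = CARD('d) - 1 \<and> card {j \<in> {1..J}. F \<subseteq> verts (q j)} = 1}"

definition junction_set :: "'d::finite point set set \<Rightarrow> 'd point set" where
  "junction_set \<F> = (\<Union>F\<in>\<F>. convex hull F)"

text \<open>
  \<open>s k 1 < s k 2 < s k 3\<close> are the surfaces meeting at the \<open>k\<close>-th triple junction \<open>\<T> k\<close>.
\<close>

locale polyhedral_cluster =
  fixes \<Omega> :: "'d::{finite,comm_ring_1} point set"
    and IS IT :: nat
    and J :: "nat \<Rightarrow> nat"
    and s :: "nat \<Rightarrow> nat \<Rightarrow> nat"
    and q :: "nat \<Rightarrow> nat \<Rightarrow> nat \<Rightarrow> 'd point"
    and \<T> :: "nat \<Rightarrow> 'd point set set"
  assumes surface_nonempty: "i \<in> {1..IS} \<Longrightarrow> 1 \<le> J i"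
    and nondegenerate: "\<lbrakk>i \<in> {1..IS}; j \<in> {1..J i}\<rbrakk> \<Longrightarrow>
          inj_on (q i j) {1..CARD('d)} \<and> \<not> affine_dependent (verts (q i j))"
    and disjoint_simplices: "\<lbrakk>i \<in> {1..IS}; j \<in> {1..J i}; i' \<in> {1..IS}; j' \<in> {1..J i'};
          (i, j) \<noteq> (i', j')\<rbrakk> \<Longrightarrow> open_simplex (q i j) \<inter> open_simplex (q i' j') = {}"
    and conforming: "triangulation (\<Union>i\<in>{1..IS}. \<Union>j\<in>{1..J i}. {closed_simplex (q i j)})"
    and hypersurface: "i \<in> {1..IS} \<Longrightarrow> hypersurface_with_boundary (surface (J i) (q i))"
    and oriented: "\<lbrakk>i \<in> {1..IS}; j \<in> {1..J i}; j' \<in> {1..J i}; j \<noteq> j'\<rbrakk> \<Longrightarrow>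
          same_orientation (q i j) (q i j')"
    and inside: "i \<in> {1..IS} \<Longrightarrow> surface (J i) (q i) \<subseteq> \<Omega>"
    and junction_indices: "k \<in> {1..IT} \<Longrightarrow>
          1 \<le> s k 1 \<and> s k 1 < s k 2 \<and> s k 2 < s k 3 \<and> s k 3 \<le> IS"
    and junction_nonempty: "k \<in> {1..IT} \<Longrightarrow> \<T> k \<noteq> {}"
    and junction_disjoint: "\<lbrakk>k \<in> {1..IT}; k' \<in> {1..IT}; k \<noteq> k'\<rbrakk> \<Longrightarrow> \<T> k \<inter> \<T> k' = {}"
    and boundary_patches: "i \<in> {1..IS} \<Longrightarrow>
          boundary_faces (J i) (q i) = (\<Union>k\<in>{k\<in>{1..IT}. i \<in> s k ` {1..3}}. \<T> k)"
    and meet_at_junctions: "\<lbrakk>i \<in> {1..IS}; i' \<in> {1..IS}; i \<noteq> i'\<rbrakk> \<Longrightarrow>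
          surface (J i) (q i) \<inter> surface (J i') (q i')
            \<subseteq> (\<Union>k\<in>{k\<in>{1..IT}. i \<in> s k ` {1..3}}. junction_set (\<T> k))"

text \<open>
  \<open>R l\<close>, \<open>l \<in> {1..IR}\<close>, are the regions into which the cluster splits \<open>\<Omega>\<close>; the normal of the
  \<open>i\<close>-th surface points from \<open>R (bm i)\<close> into \<open>R (bp i)\<close>.
\<close>

definition cluster_regions ::
  "'d::{finite,comm_ring_1} point set \<Rightarrow> nat \<Rightarrow> nat \<Rightarrow> (nat \<Rightarrow> nat) \<Rightarrow>
    (nat \<Rightarrow> nat \<Rightarrow> nat \<Rightarrow> 'd point) \<Rightarrow> (nat \<Rightarrow> nat) \<Rightarrow> (nat \<Rightarrow> nat) \<Rightarrow> (nat \<Rightarrow> 'd point set) \<Rightarrow> bool" where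
  "cluster_regions \<Omega> IR IS J q bp bm R \<longleftrightarrow>
     (\<forall>l\<in>{1..IR}. open (R l)) \<and>
     disjoint_family_on R {1..IR} \<and>
     \<Omega> = (\<Union>i\<in>{1..IS}. surface (J i) (q i)) \<union> (\<Union>l\<in>{1..IR}. R l) \<and>
     (\<Union>i\<in>{1..IS}. surface (J i) (q i)) \<inter> (\<Union>l\<in>{1..IR}. R l) = {} \<and>
     (\<forall>i\<in>{1..IS}. \<forall>j\<in>{1..J i}. \<forall>x\<in>open_simplex (q i j). \<forall>\<^sub>F \<epsilon> in at_right 0.
        x + \<epsilon> *\<^sub>R unit_normal (q i j) \<in> R (bp i) \<and> x - \<epsilon> *\<^sub>R unit_normal (q i j) \<in> R (bm i))"

definition energy ::
  "(nat \<Rightarrow> real) \<Rightarrow> nat \<Rightarrow> (nat \<Rightarrow> nat) \<Rightarrow> (nat \<Rightarrow> nat \<Rightarrow> nat \<Rightarrow> 'd::{finite,comm_ring_1} point) \<Rightarrow> real" where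
  "energy \<sigma> IS J q = (\<Sum>i=1..IS. \<sigma> i * (\<Sum>j=1..J i. simplex_area (q i j)))"

definition energy_content :: "(nat \<Rightarrow> real) \<Rightarrow> nat \<Rightarrow> (nat \<Rightarrow> 'd::finite point set) \<Rightarrow> real" where
  "energy_content \<beta> IR R = (\<Sum>l=1..IR. \<beta> l * measure lebesgue (R l))"

section \<open>Finite element spaces\<close>

definition affine_on :: "'a::real_vector set \<Rightarrow> ('a \<Rightarrow> 'b::real_vector) \<Rightarrow> bool" where
  "affine_on S v \<longleftrightarrow> (\<exists>L c. linear L \<and> (\<forall>x\<in>S. v x = L x + c))"

definition bulk_mesh :: "'d::finite point set set \<Rightarrow> 'd point set \<Rightarrow> bool" where
  "bulk_mesh Th \<Omega> \<longleftrightarrow>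
     triangulation Th \<and> (\<forall>K\<in>Th. int CARD('d) simplex K) \<and> \<Union>Th = closure \<Omega>"

definition bulk_space :: "'d::finite point set set \<Rightarrow> 'd point set \<Rightarrow> ('d point \<Rightarrow> real) set" where
  "bulk_space Th \<Omega> = {v. continuous_on (closure \<Omega>) v \<and> (\<forall>K\<in>Th. affine_on K v)}"

definition surf_space ::
  "nat \<Rightarrow> (nat \<Rightarrow> nat \<Rightarrow> 'd::finite point) \<Rightarrow> ('d point \<Rightarrow> 'b::real_normed_vector) set" where
  "surf_space J q =
     {v. continuous_on (surface J q) v \<and> (\<forall>j\<in>{1..J}. affine_on (closed_simplex (q j)) v)}"

definition cluster_space ::
  "nat \<Rightarrow> (nat \<Rightarrow> nat) \<Rightarrow> (nat \<Rightarrow> nat \<Rightarrow> nat \<Rightarrow> 'd::finite point) \<Rightarrow> (nat \<Rightarrow> 'd point \<Rightarrow> real) set" where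
  "cluster_space IS J q = {v. \<forall>i\<in>{1..IS}. v i \<in> surf_space (J i) (q i)}"

definition vec_cluster_space ::
  "nat \<Rightarrow> nat \<Rightarrow> (nat \<Rightarrow> nat) \<Rightarrow> (nat \<Rightarrow> nat \<Rightarrow> nat) \<Rightarrow> (nat \<Rightarrow> nat \<Rightarrow> nat \<Rightarrow> 'd::finite point) \<Rightarrow>
    (nat \<Rightarrow> 'd point set set) \<Rightarrow> (nat \<Rightarrow> 'd point \<Rightarrow> 'd point) set" where
  "vec_cluster_space IS IT J s q \<T> =
     {X. (\<forall>i\<in>{1..IS}. X i \<in> surf_space (J i) (q i)) \<and>
         (\<forall>k\<in>{1..IT}. \<forall>x\<in>junction_set (\<T> k).
            X (s k 1) x = X (s k 2) x \<and> X (s k 2) x = X (s k 3) x)}"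

definition nodal_interpolation ::
  "nat \<Rightarrow> (nat \<Rightarrow> nat \<Rightarrow> 'd::finite point) \<Rightarrow> ('d point \<Rightarrow> real) \<Rightarrow> ('d point \<Rightarrow> real)" where
  "nodal_interpolation J q f =
     (SOME v. v \<in> surf_space J q \<and> (\<forall>j\<in>{1..J}. \<forall>p\<in>verts (q j). v p = f p))"

section \<open>Inner products and gradients\<close>

definition exact_ip ::
  "nat \<Rightarrow> (nat \<Rightarrow> nat \<Rightarrow> 'd::{finite,comm_ring_1} point) \<Rightarrow> ('d point \<Rightarrow> 'b::real_inner) \<Rightarrow> ('d point \<Rightarrow> 'b) \<Rightarrow> real" where
  "exact_ip J q u v = (\<Sum>j=1..J. simplex_integral (q j) (\<lambda>x. u x \<bullet> v x))"

definition lumped_ip ::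
  "nat \<Rightarrow> (nat \<Rightarrow> nat \<Rightarrow> 'd::{finite,comm_ring_1} point) \<Rightarrow> ('d point \<Rightarrow> 'b::real_inner) \<Rightarrow> ('d point \<Rightarrow> 'b) \<Rightarrow> real" where
  "lumped_ip J q u v =
     1 / real CARD('d) * (\<Sum>j=1..J. simplex_area (q j) *
       (\<Sum>k=1..CARD('d). Lim (at (q j k) within open_simplex (q j)) (\<lambda>x. u x \<bullet> v x)))"

text \<open>The product \<open>\<langle>u, v\<rangle>\<^sup>(\<^sup>h\<^sup>)\<close>; the Boolean selects one of the two variants of the scheme.\<close>

definition variant_ip ::
  "bool \<Rightarrow> nat \<Rightarrow> (nat \<Rightarrow> nat \<Rightarrow> 'd::{finite,comm_ring_1} point) \<Rightarrow> ('d point \<Rightarrow> 'b::real_inner) \<Rightarrow> ('d point \<Rightarrow> 'b) \<Rightarrow> real" where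
  "variant_ip lumped = (if lumped then lumped_ip else exact_ip)"

definition grad :: "('d::finite point \<Rightarrow> real) \<Rightarrow> 'd point \<Rightarrow> 'd point" where
  "grad f x = (\<chi> k. frechet_derivative f (at x) (axis k 1))"

text \<open>The surface gradient on the flat piece \<open>S\<close>, a vector tangential to \<open>S\<close>.\<close>

definition surf_grad :: "'d::finite point set \<Rightarrow> ('d point \<Rightarrow> real) \<Rightarrow> 'd point \<Rightarrow> 'd point" where
  "surf_grad S f x = (THE g. g \<in> span {y - z | y z. y \<in> S \<and> z \<in> S} \<and>
     (f has_derivative (\<lambda>h. g \<bullet> h)) (at x within S))"

definition surf_stiffness ::
  "nat \<Rightarrow> (nat \<Rightarrow> nat \<Rightarrow> 'd::{finite,comm_ring_1} point) \<Rightarrow> ('d point \<Rightarrow> 'd point) \<Rightarrow> ('d point \<Rightarrow> 'd point) \<Rightarrow> real" where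
  "surf_stiffness J q X Y =
     (\<Sum>j=1..J. simplex_integral (q j) (\<lambda>x. \<Sum>k\<in>UNIV.
        surf_grad (closed_simplex (q j)) (\<lambda>y. X y $ k) x \<bullet>
        surf_grad (closed_simplex (q j)) (\<lambda>y. Y y $ k) x))"

section \<open>Time-averaged normals\<close>

definition interp_simplex ::
  "real \<Rightarrow> real \<Rightarrow> (nat \<Rightarrow> 'd::finite point) \<Rightarrow> (nat \<Rightarrow> 'd point) \<Rightarrow> real \<Rightarrow> nat \<Rightarrow> 'd point" where
  "interp_simplex t0 t1 p p' t k =
     ((t1 - t) / (t1 - t0)) *\<^sub>R p k + ((t - t0) / (t1 - t0)) *\<^sub>R p' k"

definition averaged_normal ::
  "real \<Rightarrow> real \<Rightarrow> (nat \<Rightarrow> 'd::{finite,comm_ring_1} point) \<Rightarrow> (nat \<Rightarrow> 'd point) \<Rightarrow> 'd point" where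
  "averaged_normal t0 t1 p p' =
     (1 / ((t1 - t0) * norm (area_vec p))) *\<^sub>R
       integral {t0..t1} (\<lambda>t. area_vec (interp_simplex t0 t1 p p' t))"

definition averaged_vertex_normal ::
  "real \<Rightarrow> real \<Rightarrow> nat \<Rightarrow> (nat \<Rightarrow> nat \<Rightarrow> 'd::{finite,comm_ring_1} point) \<Rightarrow> (nat \<Rightarrow> nat \<Rightarrow> 'd point) \<Rightarrow>
    ('d point \<Rightarrow> 'd point) \<Rightarrow> bool" where
  "averaged_vertex_normal t0 t1 J q q' \<omega> \<longleftrightarrow>
     \<omega> \<in> surf_space J q \<and>
     (\<forall>\<xi>\<in>surf_space J q. lumped_ip J q \<omega> \<xi> =
        (\<Sum>j=1..J. simplex_integral (q j) (\<lambda>x. averaged_normal t0 t1 (q j) (q' j) \<bullet> \<xi> x)))"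

end

theory Submission
  imports Defs
begin

text \<open>
  Energy: testing (a) with \<open>W\<close>, (b) with the interpolant of \<open>(X - id) / \<tau> \<bullet> \<omega>\<close> and (c) with
  \<open>(X - id) / \<tau>\<close> reduces the estimate to the fact that on every simplex the area grows by at most
  \<open>\<integral> \<nabla>X \<bullet> \<nabla>(X - id)\<close>.

  Volume: testing (a) with \<open>1\<close> shows that the volumes swept by the simplices, weighted with the
  jumps of \<open>\<beta>\<close>, add up to \<open>0\<close>. Counting the jumps of the piecewise constant phase along rays from
  almost every point to infinity expresses the change of the energy content by the volumes of
  the cones over the simplices with apex \<open>0\<close>. The swept volume of a simplex differs from the
  change of its cone volume by fluxes through its \<open>(d-2)\<close>-dimensional faces, and these cancel:
  following the phase along two parallel lines on both sides of a face shows that the oriented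
  jumps of the simplices around the face add up to \<open>0\<close>.
\<close>

section \<open>Coordinates in dimension two and three\<close>

text \<open>Only the two clusters at the ends of the time step are known to be embedded. The
  linearly interpolated simplices in between may intersect each other, so the enclosed volumes
  cannot be followed through time. The ends are therefore compared algebraically: cone volumes and
  swept volumes are polynomials in the old and new vertices, and for each simplex their mismatch
  splits into terms that depend only on a face and its motion. A phase may reach the boundary of
  \<open>\<Omega>\<close>, which is an arbitrary bounded open set, and its indicator jumps there in
  an uncontrolled way. This is why the difference of the old and the new phase function is followed
  along rays: it vanishes near the boundary. The simplices around a face are not sorted cyclically.
  Two lines on opposite sides of the face suffice, because corresponding end points lie in the same
  region, so both lines must see the same total jump. The area estimate rests on one inequality for
  the stretch factors \<open>r\<close>, \<open>s\<close> of a simplex: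
  \<open>r * s \<le> 1 + (r\<^sup>2 - r) + (s\<^sup>2 - s)\<close>.\<close>

lemma of_nat_CARD_eq_0: "of_nat CARD('d::{finite,comm_ring_1}) = (0::'d)"
proof -
  \<comment> \<open>The shift by 1 permutes the ring, so comparing the sums of all elements shows
    that \<open>CARD('d)\<close> many ones add up to 0. This makes the numeral 2, respectively 3, a
    name of the coordinate 0.\<close>
  have "(\<Sum>x\<in>(UNIV::'d set). x) = (\<Sum>x\<in>(UNIV::'d set). x + 1)"
    by (rule sum.reindex_bij_witness[of _ "\<lambda>x. x + 1" "\<lambda>x. x - 1"]) auto
  then show ?thesis
    by (simp add: sum.distrib)
qed

lemma UNIV_dim2:
  assumes "CARD('d::{finite,comm_ring_1}) = 2"
  shows "(UNIV :: 'd set) = {1, 2}" "(1::'d) \<noteq> 2" "(2::'d) = 0"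
proof -
  show 2: "(2::'d) = 0"
    using of_nat_CARD_eq_0[where 'd='d] by (simp add: assms)
  then show 12: "(1::'d) \<noteq> 2"
    by simp
  have "card {1::'d, 2} = CARD('d)"
    using 12 by (simp add: assms)
  then show "(UNIV :: 'd set) = {1, 2}"
    by (metis card_subset_eq finite_code subset_UNIV)
qed

lemma UNIV_dim3:
  assumes "CARD('d::{finite,comm_ring_1}) = 3"
  shows "(UNIV :: 'd set) = {1, 2, 3}" "(1::'d) \<noteq> 2" "(1::'d) \<noteq> 3" "(2::'d) \<noteq> 3" "(3::'d) = 0"
proof -
  show 3: "(3::'d) = 0"
    using of_nat_CARD_eq_0[where 'd='d] by (simp add: assms)
  have "(2::'d) \<noteq> 0"
  proof
    assume "(2::'d) = 0"
    moreover have "(3::'d) = 2 + 1" by simp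
    ultimately show False using 3 by (metis add_0 zero_neq_one)
  qed
  then show 23: "(2::'d) \<noteq> 3"
    using 3 by simp
  show 13: "(1::'d) \<noteq> 3"
    using 3 by simp
  show 12: "(1::'d) \<noteq> 2"
    by (metis add_cancel_right_right one_add_one zero_neq_one)
  have "card {1::'d, 2, 3} = CARD('d)"
    using 12 13 23 by (simp add: assms)
  then show "(UNIV :: 'd set) = {1, 2, 3}"
    by (metis card_subset_eq finite_code subset_UNIV)
qed

lemma sum_dim2:
  assumes "CARD('d::{finite,comm_ring_1}) = 2"
  shows "(\<Sum>k\<in>(UNIV::'d set). f k) = f 1 + f 2"
  using UNIV_dim2(2)[OF assms] by (simp add: UNIV_dim2(1)[OF assms])

lemma sum_dim3:
  assumes "CARD('d::{finite,comm_ring_1}) = 3"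
  shows "(\<Sum>k\<in>(UNIV::'d set). f k) = f 1 + f 2 + f 3"
  using UNIV_dim3(2-4)[OF assms] by (simp add: UNIV_dim3(1)[OF assms] add.assoc)

lemma inner_dim2:
  assumes "CARD('d::{finite,comm_ring_1}) = 2"
  shows "(x :: 'd point) \<bullet> y = x$1 * y$1 + x$2 * y$2"
  by (simp add: inner_vec_def sum_dim2[OF assms])

lemma inner_dim3:
  assumes "CARD('d::{finite,comm_ring_1}) = 3"
  shows "(x :: 'd point) \<bullet> y = x$1 * y$1 + x$2 * y$2 + x$3 * y$3"
  by (simp add: inner_vec_def sum_dim3[OF assms])

lemma vec_eq_dim2:
  assumes "CARD('d::{finite,comm_ring_1}) = 2"
  shows "(x :: 'd point) = y \<longleftrightarrow> x$1 = y$1 \<and> x$2 = y$2"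
proof -
  have "(x = y) = (\<forall>i\<in>UNIV. x $ i = y $ i)" by (simp add: vec_eq_iff)
  then show ?thesis unfolding UNIV_dim2(1)[OF assms] by simp
qed

lemma vec_eq_dim3:
  assumes "CARD('d::{finite,comm_ring_1}) = 3"
  shows "(x :: 'd point) = y \<longleftrightarrow> x$1 = y$1 \<and> x$2 = y$2 \<and> x$3 = y$3"
proof -
  have "(x = y) = (\<forall>i\<in>UNIV. x $ i = y $ i)" by (simp add: vec_eq_iff)
  then show ?thesis unfolding UNIV_dim3(1)[OF assms] by simp
qed

lemma perp_nth:
  assumes "CARD('d::{finite,comm_ring_1}) = 2"
  shows "perp (v :: 'd point) $ 1 = - (v$2)" "perp v $ 2 = v$1"
  using UNIV_dim2[OF assms] by (simp_all add: perp_def)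

lemma cross_nth:
  assumes "CARD('d::{finite,comm_ring_1}) = 3"
  shows "cross (v :: 'd point) w $ 1 = v$2 * w$3 - v$3 * w$2"
    "cross v w $ 2 = v$3 * w$1 - v$1 * w$3"
    "cross v w $ 3 = v$1 * w$2 - v$2 * w$1"
  using UNIV_dim3[OF assms] by (simp_all add: cross_def)

lemmas dim2_simps = inner_dim2 vec_eq_dim2 perp_nth
lemmas dim3_simps = inner_dim3 vec_eq_dim3 cross_nth

lemma verts_dim2: "CARD('d::finite) = 2 \<Longrightarrow> verts (q :: nat \<Rightarrow> 'd point) = {q 1, q 2}"
  by (auto simp: verts_def numeral_2_eq_2 atLeastAtMostSuc_conv)

lemma verts_dim3: "CARD('d::finite) = 3 \<Longrightarrow> verts (q :: nat \<Rightarrow> 'd point) = {q 1, q 2, q 3}"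
  by (auto simp: verts_def numeral_3_eq_3 numeral_2_eq_2 atLeastAtMostSuc_conv)

lemma area_vec_dim2: "CARD('d::{finite,comm_ring_1}) = 2 \<Longrightarrow> area_vec (q :: nat \<Rightarrow> 'd point) = perp (q 2 - q 1)"
  by (simp add: area_vec_def)

lemma area_vec_dim3:
  "CARD('d::{finite,comm_ring_1}) = 3 \<Longrightarrow> area_vec (q :: nat \<Rightarrow> 'd point) = cross (q 2 - q 1) (q 3 - q 1)"
  by (simp add: area_vec_def)

lemma inner_area_vec_vertex:
  fixes q :: "nat \<Rightarrow> 'd::{finite,comm_ring_1} point"
  assumes "CARD('d) = 2 \<or> CARD('d) = 3" "p \<in> verts q"
  shows "area_vec q \<bullet> p = area_vec q \<bullet> q 1"
  using assms(1)
proof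
  assume d: "CARD('d) = 2"
  then have "p = q 1 \<or> p = q 2" using assms by (simp add: verts_dim2)
  then show ?thesis
    by (elim disjE) (simp_all add: area_vec_dim2 d dim2_simps, simp add: algebra_simps)
next
  assume d: "CARD('d) = 3"
  then have "p = q 1 \<or> p = q 2 \<or> p = q 3" using assms by (simp add: verts_dim3)
  then show ?thesis
    by (elim disjE) (simp_all add: area_vec_dim3 d dim3_simps, simp_all add: algebra_simps)
qed

text \<open>For triangles this is the triple product expansion: if \<open>cross a b\<close>
  vanishes, then \<open>b\<close> is a multiple of \<open>a\<close>, which puts the third vertex on
  the line through the other two.\<close>

lemma area_vec_nonzero:
  fixes q :: "nat \<Rightarrow> 'd::{finite,comm_ring_1} point"
  assumes "CARD('d) = 2 \<or> CARD('d) = 3"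
    and inj: "inj_on q {1..CARD('d)}" and indep: "\<not> affine_dependent (verts q)"
  shows "area_vec q \<noteq> 0"
  using assms(1)
proof
  assume d: "CARD('d) = 2"
  have "q 2 \<noteq> q 1"
    using inj by (simp add: d inj_on_def) (metis One_nat_def atLeastAtMost_iff le_numeral_extra(4) nat_1_add_1 one_le_numeral order_refl plus_1_eq_Suc n_not_Suc_n)
  then show ?thesis
    by (auto simp add: area_vec_dim2 d dim2_simps)
next
  assume d: "CARD('d) = 3"
  define a b where "a = q 2 - q 1" and "b = q 3 - q 1"
  have ne: "q 1 \<noteq> q 2" "q 1 \<noteq> q 3" "q 2 \<noteq> q 3"
    using inj_onD[OF inj, of 1 2] inj_onD[OF inj, of 1 3] inj_onD[OF inj, of 2 3] by (auto simp: d)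
  show ?thesis
  proof
    assume "area_vec q = 0"
    then have c: "cross a b = 0" by (simp add: a_def b_def area_vec_dim3 d)
    have "(a \<bullet> a) *\<^sub>R b - (a \<bullet> b) *\<^sub>R a = cross a (cross b a)"
      by (simp add: d dim3_simps) (simp add: algebra_simps)
    also have "cross b a = - cross a b"
      by (simp add: d dim3_simps)
    finally have "(a \<bullet> a) *\<^sub>R b - (a \<bullet> b) *\<^sub>R a = 0"
      by (simp add: c) (simp add: d dim3_simps)
    then have "(a \<bullet> a) *\<^sub>R b = (a \<bullet> b) *\<^sub>R a"
      by simp
    moreover have "a \<bullet> a \<noteq> 0" using ne by (simp add: a_def)
    ultimately have "b = ((a \<bullet> b) / (a \<bullet> a)) *\<^sub>R a"
      by (metis (no_types, lifting) divideR_right divide_inverse_commute scaleR_scaleR)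
    then have "q 3 = q 1 + ((a \<bullet> b) / (a \<bullet> a)) *\<^sub>R (q 2 - q 1)"
      by (simp add: a_def b_def algebra_simps)
    then have "q 3 \<in> affine hull {q 1, q 2}"
      unfolding affine_hull_2_alt by auto
    moreover have "{q 1, q 2} \<subseteq> verts q - {q 3}" "q 3 \<in> verts q"
      using ne by (auto simp: verts_dim3 d)
    ultimately show False
      using indep hull_mono unfolding affine_dependent_def by blast
  qed
qed

section \<open>Piecewise constant functions along lines and simplices\<close>

text \<open>Subtracting from the right-hand limits of \<open>g\<close> the jumps collected so far
  leaves a locally constant function on the connected interval \<open>{a..b}\<close>. The values of
  \<open>g\<close> on \<open>C\<close> are left free, since a phase function has no meaningful value
  on the cluster itself.\<close>

lemma sum_jumps:
  fixes g Jmp :: "real \<Rightarrow> real"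
  assumes "a \<le> b" and "finite C" and ends: "a \<notin> C" "b \<notin> C"
    and jump: "\<And>s. a \<le> s \<Longrightarrow> s \<le> b \<Longrightarrow>
        \<exists>p n. (\<forall>\<^sub>F e in at_right 0. g (s + e) = p \<and> g (s - e) = n) \<and> p - n = Jmp s"
    and regular: "\<And>s. a \<le> s \<Longrightarrow> s \<le> b \<Longrightarrow> s \<notin> C \<Longrightarrow>
        Jmp s = 0 \<and> (\<forall>\<^sub>F e in at_right 0. g (s + e) = g s)"
  shows "g b - g a = (\<Sum>s\<in>C \<inter> {a..b}. Jmp s)"
proof -
  have ex: "\<forall>s\<in>{a..b}. \<exists>w. (\<forall>\<^sub>F e in at_right 0. g (s + e) = fst w \<and> g (s - e) = snd w) \<and>
      fst w - snd w = Jmp s"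
  proof
    fix s assume s: "s \<in> {a..b}"
    obtain p n where "\<forall>\<^sub>F e in at_right 0. g (s + e) = p \<and> g (s - e) = n" "p - n = Jmp s"
      using jump[of s] s by auto
    then show "\<exists>w. (\<forall>\<^sub>F e in at_right 0. g (s + e) = fst w \<and> g (s - e) = snd w) \<and> fst w - snd w = Jmp s"
      by (intro exI[of _ "(p, n)"]) simp
  qed
  obtain w where w: "\<forall>s\<in>{a..b}. (\<forall>\<^sub>F e in at_right 0. g (s + e) = fst (w s) \<and> g (s - e) = snd (w s)) \<and>
      fst (w s) - snd (w s) = Jmp s"
    using bchoice[OF ex] by (elim exE)
  define p n where "p = fst \<circ> w" and "n = snd \<circ> w"
  have pn: "\<forall>\<^sub>F e in at_right 0. g (s + e) = p s \<and> g (s - e) = n s"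
    and J: "p s - n s = Jmp s" if "a \<le> s" "s \<le> b" for s
    using w that by (auto simp: p_def n_def)
  have p_reg: "p s = g s" if s: "a \<le> s" "s \<le> b" "s \<notin> C" for s
  proof -
    have "\<forall>\<^sub>F e in at_right 0. (g (s + e) = p s \<and> g (s - e) = n s) \<and> g (s + e) = g s"
      using pn[OF s(1,2)] conjunct2[OF regular[OF s]] by (rule eventually_conj)
    then show ?thesis
      using eventually_happens'[OF trivial_limit_at_right_real] by fastforce
  qed
  define S where "S s = (\<Sum>c\<in>{c \<in> C \<inter> {a..b}. c \<le> s}. Jmp c)" for s
  define v where "v s = p s - S s" for s
  have "v a = v b"
  proof (rule connected_local_const[where A="{a..b}" and f=v])
    show "\<forall>s\<in>{a..b}. \<forall>\<^sub>F t in at s within {a..b}. v s = v t"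
    proof
      fix s assume s: "s \<in> {a..b}"
      obtain d1 where d1: "d1 > 0" "\<And>e. 0 < e \<Longrightarrow> e < d1 \<Longrightarrow> g (s + e) = p s \<and> g (s - e) = n s"
        using pn[of s] s unfolding eventually_at_right_field by auto
      obtain d2 where d2: "d2 > 0" "\<And>c. c \<in> C \<Longrightarrow> c \<noteq> s \<Longrightarrow> d2 \<le> dist s c"
        using finite_set_avoid[OF \<open>finite C\<close>, of s] by auto
      have "v s = v t" if t: "t \<in> {a..b}" "t \<noteq> s" "dist t s < min d1 d2" for t
      proof -
        have tC: "t \<notin> C" using d2(2)[of t] t by (auto simp: dist_commute)
        then have pt: "p t = g t" using p_reg t by simp
        show ?thesis
        proof (cases "t > s")
          case True
          then have "g t = p s" using d1(2)[of "t - s"] t by (simp add: dist_real_def)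
          moreover have "{c \<in> C \<inter> {a..b}. c \<le> t} = {c \<in> C \<inter> {a..b}. c \<le> s}"
            using d2(2) t True by (force simp: dist_real_def)
          ultimately show ?thesis by (simp add: v_def S_def pt)
        next
          case False
          then have ts: "t < s" using t by simp
          then have gt: "g t = n s" using d1(2)[of "s - t"] t by (simp add: dist_real_def)
          \<comment> \<open>\<open>p\<close> is the limit from the right, so \<open>S\<close> counts
            the jump at \<open>s\<close> itself. To the left of \<open>s\<close> this jump is
            missing, and there \<open>p t\<close> is the left limit \<open>n s\<close>.\<close>
          have "S s = S t + Jmp s"
          proof (cases "s \<in> C")
            case True
            have "{c \<in> C \<inter> {a..b}. c \<le> s} = insert s {c \<in> C \<inter> {a..b}. c \<le> t}"
              using d2(2) t ts True s by (force simp: dist_real_def)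
            moreover have "s \<notin> {c \<in> C \<inter> {a..b}. c \<le> t}" using ts by simp
            ultimately show ?thesis using \<open>finite C\<close> by (simp add: S_def)
          next
            case False
            have "{c \<in> C \<inter> {a..b}. c \<le> s} = {c \<in> C \<inter> {a..b}. c \<le> t}"
              using d2(2) t ts False s by (force simp: dist_real_def)
            then show ?thesis using regular[of s] False s by (simp add: S_def)
          qed
          then show ?thesis using J[of s] s by (simp add: v_def pt gt)
        qed
      qed
      then show "\<forall>\<^sub>F t in at s within {a..b}. v s = v t"
        unfolding eventually_at by (intro exI[of _ "min d1 d2"]) (use d1 d2 in auto)
    qed
  qed (use \<open>a \<le> b\<close> in auto)
  moreover have "S a = 0"
  proof -
    have "{c \<in> C \<inter> {a..b}. c \<le> a} = {}"
      using ends(1) by (auto dest: antisym)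
    then show ?thesis by (simp only: S_def sum.empty)
  qed
  moreover have "S b = (\<Sum>s\<in>C \<inter> {a..b}. Jmp s)"
    unfolding S_def by (intro sum.cong) auto
  ultimately show ?thesis
    using p_reg[of a] p_reg[of b] ends \<open>a \<le> b\<close> by (simp add: v_def)
qed

lemma eventually_line:
  fixes x v :: "'b::real_normed_vector"
  assumes "\<forall>\<^sub>F y in nhds x. P y"
  shows "\<forall>\<^sub>F e in at_right 0. P (x + e *\<^sub>R v) \<and> P (x - e *\<^sub>R v)"
proof (rule eventually_conj)
  have "((\<lambda>e. x + e *\<^sub>R v) \<longlongrightarrow> x + 0 *\<^sub>R v) (at_right 0)"
    by (intro tendsto_intros)
  then show "\<forall>\<^sub>F e in at_right 0. P (x + e *\<^sub>R v)"
    using eventually_compose_filterlim[OF assms] by simp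
  have "((\<lambda>e. x - e *\<^sub>R v) \<longlongrightarrow> x - 0 *\<^sub>R v) (at_right 0)"
    by (intro tendsto_intros)
  then show "\<forall>\<^sub>F e in at_right 0. P (x - e *\<^sub>R v)"
    using eventually_compose_filterlim[OF assms] by simp
qed

section \<open>Closed and open simplices and their hyperplanes\<close>

lemma finite_verts [simp]: "finite (verts q)"
  by (simp add: verts_def)

lemma card_verts: "inj_on q {1..CARD('d)} \<Longrightarrow> card (verts (q :: nat \<Rightarrow> 'd::finite point)) = CARD('d)"
  by (simp add: verts_def card_image)

lemma open_simplex_subset: "open_simplex q \<subseteq> closed_simplex q"
  by (simp add: open_simplex_def rel_interior_subset)

lemma verts_subset_closed_simplex: "verts q \<subseteq> closed_simplex q"
  by (simp add: closed_simplex_def hull_subset)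

lemma compact_closed_simplex: "compact (closed_simplex q)"
  by (simp add: closed_simplex_def finite_imp_compact_convex_hull)

text \<open>An inclusion of affine sets of equal dimension \<open>CARD('d) - 1\<close> is an
  equality; the right-hand side has this dimension because the area vector is nonzero.\<close>

lemma affine_hull_verts:
  fixes q :: "nat \<Rightarrow> 'd::{finite,comm_ring_1} point"
  assumes dim: "CARD('d) = 2 \<or> CARD('d) = 3"
    and nd: "inj_on q {1..CARD('d)}" "\<not> affine_dependent (verts q)"
  shows "affine hull (verts q) = {y. area_vec q \<bullet> y = area_vec q \<bullet> q 1}"
proof (rule affine_dim_equal)
  have A: "area_vec q \<noteq> 0" by (rule area_vec_nonzero[OF assms])
  show "affine hull (verts q) \<subseteq> {y. area_vec q \<bullet> y = area_vec q \<bullet> q 1}"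
    by (rule hull_minimal) (auto simp: inner_area_vec_vertex[OF dim] affine_hyperplane)
  have "aff_dim (verts q) = int CARD('d) - 1"
    using aff_dim_affine_independent[OF nd(2)] card_verts[OF nd(1)] by simp
  then show "aff_dim (affine hull (verts q)) = aff_dim {y. area_vec q \<bullet> y = area_vec q \<bullet> q 1}"
    using A by simp
  have "q 1 \<in> verts q" using dim by (auto simp: verts_def)
  then show "affine hull (verts q) \<noteq> {}"
    by auto
qed (simp_all add: affine_hyperplane)

lemma inner_area_vec_closed_simplex:
  fixes q :: "nat \<Rightarrow> 'd::{finite,comm_ring_1} point"
  assumes dim: "CARD('d) = 2 \<or> CARD('d) = 3" and y: "y \<in> closed_simplex q"
  shows "area_vec q \<bullet> y = area_vec q \<bullet> q 1"
proof -
  have "closed_simplex q \<subseteq> {y. area_vec q \<bullet> y = area_vec q \<bullet> q 1}"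
    unfolding closed_simplex_def
    by (rule hull_minimal) (auto simp: inner_area_vec_vertex[OF dim] convex_hyperplane)
  then show ?thesis using y by auto
qed

section \<open>The phase function of a cluster and its jumps\<close>

locale phase_cluster = polyhedral_cluster \<Omega> IS IT J s q \<T>
  for \<Omega> :: "'d::{finite,comm_ring_1} point set" and IS IT J s q \<T> +
  fixes IR :: nat and bp bm :: "nat \<Rightarrow> nat" and R :: "nat \<Rightarrow> 'd point set" and \<beta> :: "nat \<Rightarrow> real"
  assumes dim: "CARD('d) = 2 \<or> CARD('d) = 3"
    and open_domain: "open \<Omega>"
    and phase_range: "i \<in> {1..IS} \<Longrightarrow> bp i \<in> {1..IR} \<and> bm i \<in> {1..IR}"
    and regions: "cluster_regions \<Omega> IR IS J q bp bm R"
begin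

definition faces :: "(nat \<times> nat) set" where
  "faces = Sigma {1..IS} (\<lambda>i. {1..J i})"

definition sx :: "nat \<times> nat \<Rightarrow> nat \<Rightarrow> 'd point" where
  "sx = (\<lambda>(i, j). q i j)"

definition jump :: "nat \<times> nat \<Rightarrow> real" where
  "jump = (\<lambda>(i, j). \<beta> (bp i) - \<beta> (bm i))"

definition \<Gamma> :: "'d point set" where
  "\<Gamma> = (\<Union>f\<in>faces. closed_simplex (sx f))"

text \<open>All indicators vanish on \<open>\<Gamma>\<close> and outside \<open>\<Omega>\<close>, so
  the value there is 0. On \<open>\<Gamma>\<close> it is a dummy value; what matters is the limits
  from both sides.\<close>

definition phase :: "'d point \<Rightarrow> real" where
  "phase x = (\<Sum>l=1..IR. \<beta> l * indicator (R l) x)"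

definition transversal :: "'d point \<Rightarrow> 'd point \<Rightarrow> bool" where
  "transversal x v \<longleftrightarrow>
     (\<forall>f\<in>faces. x \<in> closed_simplex (sx f) \<longrightarrow> x \<in> open_simplex (sx f) \<and> area_vec (sx f) \<bullet> v \<noteq> 0)"

text \<open>Open simplices are disjoint, so at most one term is nonzero at a given \<open>x\<close>.
  The sign is positive when \<open>v\<close> leads from the side of \<open>bm\<close> to the side of
  \<open>bp\<close>.\<close>

definition crossing :: "'d point \<Rightarrow> 'd point \<Rightarrow> real" where
  "crossing x v = (\<Sum>f\<in>faces. jump f * sgn (area_vec (sx f) \<bullet> v) * indicator (open_simplex (sx f)) x)"

lemma finite_faces [simp]: "finite faces"
  by (simp add: faces_def)

lemma facesI: "i \<in> {1..IS} \<Longrightarrow> j \<in> {1..J i} \<Longrightarrow> (i, j) \<in> faces"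
  by (simp add: faces_def)

lemma Gamma_eq: "\<Gamma> = (\<Union>i\<in>{1..IS}. surface (J i) (q i))"
  by (auto simp: \<Gamma>_def faces_def sx_def surface_def)

lemma Gamma_subset: "\<Gamma> \<subseteq> \<Omega>"
  unfolding Gamma_eq using inside by blast

lemma sx_nondegenerate:
  assumes "f \<in> faces"
  shows "inj_on (sx f) {1..CARD('d)}" "\<not> affine_dependent (verts (sx f))"
  using assms nondegenerate by (auto simp: faces_def sx_def)

lemma area_vec_sx: "f \<in> faces \<Longrightarrow> area_vec (sx f) \<noteq> 0"
  using area_vec_nonzero[OF dim] sx_nondegenerate by blast

lemma sx_inter_face_of:
  assumes "f \<in> faces" "f' \<in> faces"
  shows "closed_simplex (sx f) \<inter> closed_simplex (sx f') face_of closed_simplex (sx f)"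
proof -
  let ?\<F> = "\<Union>i\<in>{1..IS}. \<Union>j\<in>{1..J i}. {closed_simplex (q i j)}"
  have "closed_simplex (sx f) \<in> ?\<F>" "closed_simplex (sx f') \<in> ?\<F>"
    using assms by (auto simp: faces_def sx_def)
  moreover have "\<forall>T T'. T \<in> ?\<F> \<and> T' \<in> ?\<F> \<longrightarrow> (T \<inter> T') face_of T"
    using conforming unfolding triangulation_def by (elim conjE)
  ultimately show ?thesis by simp
qed

text \<open>By conformity the two closed simplices intersect in a common face. It meets the relative
  interior of \<open>convex hull F\<close> and therefore contains all of it; the points of
  \<open>F\<close> are extreme in this face, hence extreme in the second simplex, hence vertices of
  it.\<close>

lemma face_subset_verts:
  assumes f: "f \<in> faces" "f' \<in> faces" and F: "F \<subseteq> verts (sx f)"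
    and x: "x \<in> rel_interior (convex hull F)" "x \<in> closed_simplex (sx f')"
  shows "F \<subseteq> verts (sx f')"
proof
  fix p assume p: "p \<in> F"
  let ?T = "closed_simplex (sx f)" and ?T' = "closed_simplex (sx f')"
  have sub: "convex hull F \<subseteq> ?T" unfolding closed_simplex_def by (rule hull_mono[OF F])
  have "convex hull F \<subseteq> ?T \<inter> ?T'"
  proof (rule subset_of_face_of[OF sx_inter_face_of[OF f] sub])
    have "x \<in> ?T" using x(1) rel_interior_subset sub by blast
    then show "?T \<inter> ?T' \<inter> rel_interior (convex hull F) \<noteq> {}" using x by blast
  qed
  then have pT: "p \<in> ?T \<inter> ?T'" using p by (meson hull_inc subsetD)
  have "p extreme_point_of ?T"
    using F p sx_nondegenerate(2)[OF f(1)]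
    by (auto simp: closed_simplex_def extreme_point_of_convex_hull_affine_independent)
  then have "p extreme_point_of (?T' \<inter> ?T)"
    using extreme_point_of_face[OF sx_inter_face_of[OF f]] pT by (simp add: Int_commute)
  then have "p extreme_point_of ?T'"
    using extreme_point_of_face[OF sx_inter_face_of[OF f(2,1)]] by blast
  then show "p \<in> verts (sx f')"
    unfolding closed_simplex_def by (rule extreme_point_of_convex_hull)
qed

text \<open>\<open>disjoint_simplices\<close> separates open simplices only from each other. A
  common point with the other closed simplex would force both vertex sets to coincide, and with them
  the two open simplices.\<close>

lemma open_simplex_disjoint:
  assumes f: "f \<in> faces" "f' \<in> faces" "f \<noteq> f'" and x: "x \<in> open_simplex (sx f)"
  shows "x \<notin> closed_simplex (sx f')"
proof
  assume "x \<in> closed_simplex (sx f')"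
  then have "verts (sx f) \<subseteq> verts (sx f')"
    using face_subset_verts[OF f(1,2) subset_refl] x by (simp add: open_simplex_def closed_simplex_def)
  moreover have "card (verts (sx f)) = card (verts (sx f'))"
    using card_verts sx_nondegenerate(1) f by metis
  ultimately have "verts (sx f) = verts (sx f')"
    by (simp add: card_subset_eq)
  then have "x \<in> open_simplex (sx f')"
    using x by (simp add: open_simplex_def closed_simplex_def)
  moreover have "open_simplex (sx f) \<inter> open_simplex (sx f') = {}"
    using disjoint_simplices[of "fst f" "snd f" "fst f'" "snd f'"] f
    by (auto simp: faces_def sx_def prod_eq_iff)
  ultimately show False using x by blast
qed

lemma disjoint_regions: "disjoint_family_on R {1..IR}"
  using regions unfolding cluster_regions_def by (elim conjE)

lemma phase_region:
  assumes "l \<in> {1..IR}" "x \<in> R l"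
  shows "phase x = \<beta> l"
proof -
  have "indicator (R k) x = (if k = l then 1 else (0::real))" if "k \<in> {1..IR}" for k
  proof -
    have "R k \<inter> R l = {}" if "k \<noteq> l"
      using disjoint_family_onD[OF disjoint_regions \<open>k \<in> {1..IR}\<close> assms(1) that] .
    then show ?thesis using assms(2) by (auto simp: indicator_def)
  qed
  then have "phase x = (\<Sum>k=1..IR. if k = l then \<beta> k else 0)"
    unfolding phase_def by (intro sum.cong) auto
  then show ?thesis using assms by simp
qed

lemma domain_eq: "\<Omega> = \<Gamma> \<union> (\<Union>l\<in>{1..IR}. R l)"
  using regions unfolding cluster_regions_def Gamma_eq by (elim conjE)

lemma regions_cover: "x \<in> \<Omega> \<Longrightarrow> x \<notin> \<Gamma> \<Longrightarrow> \<exists>l\<in>{1..IR}. x \<in> R l"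
  using domain_eq by blast

lemma phase_outside: "x \<notin> \<Omega> \<Longrightarrow> phase x = 0"
  using domain_eq unfolding phase_def by (intro sum.neutral) (auto simp: indicator_def)

lemma open_region: "l \<in> {1..IR} \<Longrightarrow> open (R l)"
  using regions unfolding cluster_regions_def by (elim conjE) (rule bspec)

lemma phase_locally_constant:
  assumes "x \<in> \<Omega>" "x \<notin> \<Gamma>"
  shows "\<forall>\<^sub>F y in nhds x. phase y = phase x"
proof -
  obtain l where l: "l \<in> {1..IR}" "x \<in> R l" using regions_cover[OF assms] by blast
  then have "\<forall>\<^sub>F y in nhds x. y \<in> R l"
    using open_region by (simp add: eventually_nhds_in_open)
  then show ?thesis
    by eventually_elim (use l in \<open>auto simp: phase_region\<close>)
qed

lemma connected_in_region:
  assumes "connected S" "S \<subseteq> \<Omega> - \<Gamma>" "x \<in> S" "l \<in> {1..IR}" "x \<in> R l"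
  shows "S \<subseteq> R l"
proof -
  let ?V = "\<Union>k\<in>{1..IR} - {l}. R k"
  have "R l \<inter> S = {} \<or> ?V \<inter> S = {}"
  proof (rule connectedD[OF assms(1)])
    show "open (R l)" "open ?V" using open_region assms(4) by auto
    show "R l \<inter> ?V \<inter> S = {}"
      using disjoint_family_onD[OF disjoint_regions] assms(4) by fastforce
    show S: "S \<subseteq> R l \<union> ?V"
    proof
      fix y assume "y \<in> S"
      then obtain k where "k \<in> {1..IR}" "y \<in> R k" using regions_cover[of y] assms(2) by blast
      then show "y \<in> R l \<union> ?V" by (cases "k = l") auto
    qed
  qed
  then have "?V \<inter> S = {}" using assms(3,5) by blast
  moreover have "S \<subseteq> (\<Union>k\<in>{1..IR}. R k)"
    using regions_cover assms(2) by fast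
  ultimately show ?thesis by blast
qed

text \<open>\<open>cluster_regions\<close> describes the sides of a simplex only along its normal.
  In a ball that meets no other simplex each open half ball is connected and avoids
  \<open>\<Gamma>\<close>, so a single point on the normal decides in which region all of it
  lies.\<close>

lemma half_balls:
  assumes ij: "(i, j) \<in> faces" and x: "x \<in> open_simplex (q i j)"
  obtains r where "r > 0"
    "\<And>y. y \<in> ball x r \<Longrightarrow> 0 < area_vec (q i j) \<bullet> (y - x) \<Longrightarrow> y \<in> R (bp i)"
    "\<And>y. y \<in> ball x r \<Longrightarrow> area_vec (q i j) \<bullet> (y - x) < 0 \<Longrightarrow> y \<in> R (bm i)"
proof -
  define A where "A = area_vec (q i j)"
  define N where "N = unit_normal (q i j)"
  have A0: "A \<noteq> 0" using area_vec_sx[OF ij] by (simp add: A_def sx_def)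
  have AN: "A \<bullet> N > 0"
    using A0 by (simp add: N_def unit_normal_def A_def[symmetric])
  define U where "U = \<Omega> - (\<Union>f\<in>faces - {(i,j)}. closed_simplex (sx f))"
  have "open U" unfolding U_def
    by (intro open_Diff open_domain closed_UN) (auto intro: compact_imp_closed compact_closed_simplex)
  moreover have "x \<in> U"
  proof -
    have "x \<in> \<Omega>" using x ij open_simplex_subset Gamma_subset by (fastforce simp: \<Gamma>_def sx_def)
    then show ?thesis using open_simplex_disjoint[OF ij] x by (auto simp: U_def sx_def)
  qed
  ultimately obtain r where r: "r > 0" "ball x r \<subseteq> U" by (auto simp: open_contains_ball)
  have plane: "A \<bullet> (y - x) = 0" if "y \<in> closed_simplex (q i j)" for y
    using inner_area_vec_closed_simplex[OF dim that]
      inner_area_vec_closed_simplex[OF dim subsetD[OF open_simplex_subset x]]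
    by (simp add: A_def inner_diff_right)
  have avoid: "y \<in> \<Omega> - \<Gamma>" if "y \<in> ball x r" "A \<bullet> (y - x) \<noteq> 0" for y
    using that r plane by (fastforce simp: U_def \<Gamma>_def sx_def)
  have side: "\<forall>\<^sub>F \<epsilon> in at_right 0. x + \<epsilon> *\<^sub>R N \<in> R (bp i) \<and> x - \<epsilon> *\<^sub>R N \<in> R (bm i)"
    using regions ij x unfolding cluster_regions_def N_def by (auto simp: faces_def)
  moreover have "\<forall>\<^sub>F \<epsilon> in at_right 0. x + \<epsilon> *\<^sub>R N \<in> ball x r \<and> x - \<epsilon> *\<^sub>R N \<in> ball x r"
    by (rule eventually_line, rule eventually_nhds_in_open) (use r in auto)
  moreover have "\<forall>\<^sub>F \<epsilon>::real in at_right 0. \<epsilon> > 0" by (simp add: eventually_at_right_less)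
  ultimately have "\<forall>\<^sub>F \<epsilon> in at_right 0. x + \<epsilon> *\<^sub>R N \<in> R (bp i) \<and> x - \<epsilon> *\<^sub>R N \<in> R (bm i) \<and>
      x + \<epsilon> *\<^sub>R N \<in> ball x r \<and> x - \<epsilon> *\<^sub>R N \<in> ball x r \<and> \<epsilon> > 0"
    by eventually_elim simp
  then obtain e where e: "x + e *\<^sub>R N \<in> R (bp i)" "x - e *\<^sub>R N \<in> R (bm i)"
      "x + e *\<^sub>R N \<in> ball x r" "x - e *\<^sub>R N \<in> ball x r" "e > 0"
    using eventually_happens'[OF trivial_limit_at_right_real] by blast
  have bpm: "bp i \<in> {1..IR}" "bm i \<in> {1..IR}" using phase_range ij by (auto simp: faces_def)
  have "ball x r \<inter> {y. A \<bullet> y > A \<bullet> x} \<subseteq> R (bp i)"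
  proof (rule connected_in_region)
    show "connected (ball x r \<inter> {y. A \<bullet> y > A \<bullet> x})"
      by (intro convex_connected convex_Int convex_ball convex_halfspace_gt)
    show "ball x r \<inter> {y. A \<bullet> y > A \<bullet> x} \<subseteq> \<Omega> - \<Gamma>" using avoid by (auto simp: inner_diff_right)
    show "x + e *\<^sub>R N \<in> ball x r \<inter> {y. A \<bullet> y > A \<bullet> x}" using e AN by (simp add: inner_add_right)
  qed (use bpm e in auto)
  moreover have "ball x r \<inter> {y. A \<bullet> y < A \<bullet> x} \<subseteq> R (bm i)"
  proof (rule connected_in_region)
    show "connected (ball x r \<inter> {y. A \<bullet> y < A \<bullet> x})"
      by (intro convex_connected convex_Int convex_ball convex_halfspace_lt)
    show "ball x r \<inter> {y. A \<bullet> y < A \<bullet> x} \<subseteq> \<Omega> - \<Gamma>" using avoid by (auto simp: inner_diff_right)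
    show "x - e *\<^sub>R N \<in> ball x r \<inter> {y. A \<bullet> y < A \<bullet> x}" using e AN by (simp add: inner_diff_right)
  qed (use bpm e in auto)
  ultimately show ?thesis
    using r(1) that[of r] by (force simp: A_def inner_diff_right)
qed

lemma crossing_off_Gamma: "x \<notin> \<Gamma> \<Longrightarrow> crossing x v = 0"
  unfolding crossing_def \<Gamma>_def using open_simplex_subset
  by (intro sum.neutral) (fastforce simp: indicator_def)

lemma phase_jump:
  assumes x: "x \<in> \<Omega>" and t: "transversal x v"
  shows "\<exists>p n. (\<forall>\<^sub>F e in at_right 0. phase (x + e *\<^sub>R v) = p \<and> phase (x - e *\<^sub>R v) = n) \<and> p - n = crossing x v"
proof (cases "x \<in> \<Gamma>")
  case False
  then show ?thesis
    using eventually_line[OF phase_locally_constant[OF x False], of v]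
    by (intro exI[of _ "phase x"]) (simp add: crossing_off_Gamma)
next
  case True
  then obtain i j where ij: "(i, j) \<in> faces" "x \<in> closed_simplex (q i j)"
    by (auto simp: \<Gamma>_def sx_def)
  then have xo: "x \<in> open_simplex (q i j)" and Av: "area_vec (q i j) \<bullet> v \<noteq> 0"
    using t by (auto simp: transversal_def sx_def)
  have "crossing x v = (\<Sum>f\<in>faces. if f = (i, j) then jump f * sgn (area_vec (sx f) \<bullet> v) else 0)"
    unfolding crossing_def
  proof (intro sum.cong refl)
    fix f assume "f \<in> faces"
    then show "jump f * sgn (area_vec (sx f) \<bullet> v) * indicator (open_simplex (sx f)) x =
        (if f = (i, j) then jump f * sgn (area_vec (sx f) \<bullet> v) else 0)"
      using open_simplex_disjoint[OF ij(1), of f x] xo open_simplex_subset[of "sx f"]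
      by (auto simp: sx_def indicator_def)
  qed
  then have cr: "crossing x v = (\<beta> (bp i) - \<beta> (bm i)) * sgn (area_vec (q i j) \<bullet> v)"
    using ij(1) by (simp add: jump_def sx_def)
  obtain r where r: "r > 0"
    "\<And>y. y \<in> ball x r \<Longrightarrow> 0 < area_vec (q i j) \<bullet> (y - x) \<Longrightarrow> y \<in> R (bp i)"
    "\<And>y. y \<in> ball x r \<Longrightarrow> area_vec (q i j) \<bullet> (y - x) < 0 \<Longrightarrow> y \<in> R (bm i)"
    using half_balls[OF ij(1) xo] by metis
  have pr: "bp i \<in> {1..IR}" "bm i \<in> {1..IR}" using phase_range ij by (auto simp: faces_def)
  have near: "\<forall>\<^sub>F y in nhds x. y \<in> ball x r"
    by (rule eventually_nhds_in_open) (use r in auto)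
  have pos: "\<forall>\<^sub>F e::real in at_right 0. e > 0" by (simp add: eventually_at_right_less)
  show ?thesis
  proof (cases "area_vec (q i j) \<bullet> v > 0")
    case True
    have "\<forall>\<^sub>F e in at_right 0. phase (x + e *\<^sub>R v) = \<beta> (bp i) \<and> phase (x - e *\<^sub>R v) = \<beta> (bm i)"
      using eventually_line[OF near, of v] pos
      by eventually_elim (use r pr True in \<open>auto simp: phase_region\<close>)
    then show ?thesis using cr True by auto
  next
    case False
    then have neg: "area_vec (q i j) \<bullet> v < 0" using Av by simp
    have "\<forall>\<^sub>F e in at_right 0. phase (x + e *\<^sub>R v) = \<beta> (bm i) \<and> phase (x - e *\<^sub>R v) = \<beta> (bp i)"
      using eventually_line[OF near, of v] pos
      by eventually_elim (use r pr neg in \<open>auto simp: phase_region mult_pos_neg\<close>)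
    then show ?thesis using cr neg by auto
  qed
qed

end

section \<open>The volume of a simplex with a vertex at the origin\<close>

text \<open>Boxes pull back to boxes with permuted side lengths, and boxes determine Lebesgue
  measure. The relabelling moves volume computations from \<open>'d\<close> to the types 2 and 3,
  which carry the well-order demanded by \<open>measure_std_simplex_image\<close>.\<close>

lemma distr_lborel_relabel:
  fixes h :: "'n::finite \<Rightarrow> 'd::finite"
  assumes "bij h"
  shows "distr lborel borel (\<lambda>x::real^'d. \<chi> i. x $ h i) = lborel"
proof -
  let ?f = "\<lambda>x::real^'d. \<chi> i. x $ h i"
  have f: "?f \<in> borel_measurable borel"
    by (intro borel_measurable_continuous_onI continuous_intros)
  have basis: "(\<Prod>b\<in>Basis. v \<bullet> b) = (\<Prod>i\<in>UNIV. v $ i)" for v :: "real^'k"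
  proof -
    have B: "(Basis :: (real^'k) set) = range (\<lambda>i. axis i 1)"
      by (auto simp: Basis_vec_def)
    moreover have "inj (\<lambda>i::'k. axis i (1::real))"
      by (auto simp: inj_on_def axis_eq_axis)
    ultimately show ?thesis
      unfolding B by (subst prod.reindex) (simp_all add: inner_axis)
  qed
  show ?thesis
  proof (rule lborel_eqI[symmetric])
    fix l u :: "real^'n"
    assume le: "\<And>b. b \<in> Basis \<Longrightarrow> l \<bullet> b \<le> u \<bullet> b"
    let ?g = "\<lambda>x::real^'n. \<chi> j. x $ inv h j"
    have h1: "h (inv h j) = j" "inv h (h i) = i" for i j
      using assms by (simp_all add: bij_is_surj surj_f_inv_f bij_is_inj)
    have vim: "?f -` box l u = box (?g l) (?g u)"
      unfolding set_eq_iff mem_box_cart vimage_eq vec_lambda_beta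
    proof (intro allI iffI)
      fix x i assume "\<forall>i. l $ i < x $ h i \<and> x $ h i < u $ i"
      then show "l $ inv h i < x $ i \<and> x $ i < u $ inv h i"
        by (metis h1(1))
    next
      fix x i assume "\<forall>i. l $ inv h i < x $ i \<and> x $ i < u $ inv h i"
      then show "l $ i < x $ h i \<and> x $ h i < u $ i"
        by (metis h1(2))
    qed
    have l: "l $ i \<le> u $ i" for i
      using le[of "axis i 1"] by (simp add: inner_axis axis_in_Basis_iff)
    have le': "?g l \<bullet> b \<le> ?g u \<bullet> b" if "b \<in> Basis" for b
      using that l by (auto simp: Basis_vec_def inner_axis)
    have "emeasure (distr lborel borel ?f) (box l u) = emeasure lborel (box (?g l) (?g u))"
      using f by (simp add: emeasure_distr vim)
    also have "\<dots> = (\<Prod>b\<in>Basis. (?g u - ?g l) \<bullet> b)"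
      using le' by (rule emeasure_lborel_box)
    also have "(\<Prod>b\<in>Basis. (?g u - ?g l) \<bullet> b) = (\<Prod>b\<in>Basis. (u - l) \<bullet> b)"
      unfolding basis
      by (rule prod.reindex_bij_witness[of _ h "inv h"]) (simp_all add: h1)
    finally show "emeasure (distr lborel borel ?f) (box l u) = (\<Prod>b\<in>Basis. (u - l) \<bullet> b)" .
  qed simp
qed

lemma measure_relabel:
  fixes h :: "'n::finite \<Rightarrow> 'd::finite" and S :: "(real^'d) set"
  assumes "bij h" "compact S"
  shows "measure lebesgue ((\<lambda>x. \<chi> i. x $ h i) ` S) = measure lebesgue S"
proof -
  let ?f = "\<lambda>x::real^'d. (\<chi> i. x $ h i) :: real^'n"
  have cont: "continuous_on UNIV ?f"
    by (intro continuous_intros)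
  have inj: "inj ?f"
    using assms(1) by (auto simp: inj_on_def vec_eq_iff bij_is_surj) (metis bij_is_surj surj_f_inv_f)
  have "compact (?f ` S)"
    using assms(2) by (intro compact_continuous_image continuous_on_subset[OF cont]) auto
  then have borel: "?f ` S \<in> sets borel" "S \<in> sets borel"
    using assms(2) by (auto intro: borel_compact)
  have "measure lebesgue (?f ` S) = measure lborel (?f ` S)"
    using borel by simp
  also have "\<dots> = measure (distr lborel borel ?f) (?f ` S)"
    by (simp add: distr_lborel_relabel[OF assms(1)])
  also have "\<dots> = measure lborel (?f -` ?f ` S)"
    using borel cont by (subst measure_distr) (auto intro: borel_measurable_continuous_onI)
  also have "?f -` ?f ` S = S"
    using inj by (rule inj_vimage_image_eq)
  finally show ?thesis
    using borel by simp
qed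

lemma measure_std_simplex_image:
  fixes g :: "real^'n::{finite,wellorder} \<Rightarrow> real^'n::{finite,wellorder}"
  assumes "linear g"
  shows "measure lebesgue (convex hull (insert 0 (g ` Basis))) = \<bar>det (matrix g)\<bar> / fact CARD('n)"
proof -
  let ?S = "convex hull (insert 0 Basis :: (real^'n::{finite,wellorder}) set)"
  have S: "compact ?S" by (intro finite_imp_compact_convex_hull) simp
  have "convex hull (insert 0 (g ` Basis)) = convex hull (g ` insert 0 Basis)"
    by (simp add: linear_0[OF assms])
  also have "\<dots> = g ` ?S"
    by (rule convex_hull_linear_image[OF assms, symmetric])
  finally have "measure lebesgue (convex hull (insert 0 (g ` Basis))) = \<bar>det (matrix g)\<bar> * measure lebesgue ?S"
    using S assms by (simp add: measure_lebesgue_linear_transformation compact_imp_bounded compact_imp_closed lmeasurable_compact fmeasurableD)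
  moreover have "measure lebesgue ?S = 1 / fact CARD('n)"
    using S content_std_simplex[where 'a="real^'n::{finite,wellorder}"] by (simp add: borel_compact)
  ultimately show ?thesis by simp
qed

lemma linear_vec_lambda_nth: "linear (\<lambda>x::real^'d::finite. (\<chi> i. x $ h i) :: real^'n::finite)"
  by (rule linearI) (simp_all add: vec_eq_iff)

text \<open>The linear map that sends the basis vectors to the vertices has determinant
  \<open>area_vec q \<bullet> q 1\<close> for \<open>d = 3\<close> and its negative for
  \<open>d = 2\<close>, where \<open>perp\<close> rotates counterclockwise. The sign disappears in
  the absolute value.\<close>

lemma measure_simplex_origin:
  fixes q :: "nat \<Rightarrow> 'd::{finite,comm_ring_1} point"
  assumes dim: "CARD('d) = 2 \<or> CARD('d) = 3"
  shows "measure lebesgue (convex hull (insert 0 (verts q))) = \<bar>area_vec q \<bullet> q 1\<bar> / fact CARD('d)"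
proof -
  have S: "compact (convex hull (insert 0 (verts q)))"
    by (intro finite_imp_compact_convex_hull) (simp add: verts_def)
  from dim show ?thesis
  proof
    assume d: "CARD('d) = 2"
    note D = UNIV_dim2[OF d]
    define h :: "2 \<Rightarrow> 'd" where "h i = (if i = 1 then 1 else 2)" for i
    have "bij h"
      unfolding bij_def inj_def surj_def forall_2
    proof (intro conjI allI)
      show "\<exists>x. y = h x" for y
      proof -
        have "y \<in> {1,2}" using D(1) by blast
        then show ?thesis
          by (auto simp: h_def intro: exI[of _ 1] exI[of _ 2])
      qed
    qed (use D in \<open>auto simp: h_def\<close>)
    define f where "f x = ((\<chi> i. x $ h i) :: real^2)" for x :: "'d point"
    have f: "linear f" unfolding f_def by (rule linear_vec_lambda_nth)
    define g where "g x = x$1 *\<^sub>R f (q 1) + x$2 *\<^sub>R f (q 2)" for x :: "real^2"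
    have g: "linear g" unfolding g_def by (rule linearI) (simp_all add: algebra_simps)
    have B: "Basis = {axis 1 1, axis 2 (1::real) :: real^2}"
      by (auto simp: Basis_vec_def UNIV_2)
    then have gB: "g ` Basis = f ` verts q"
      unfolding B by (simp add: g_def verts_dim2 d axis_def)
    have "f ` (convex hull (insert 0 (verts q))) = convex hull (insert 0 (g ` Basis))"
      by (simp add: convex_hull_linear_image[OF f] linear_0[OF f] gB)
    then have "measure lebesgue (convex hull (insert 0 (verts q))) = \<bar>det (matrix g)\<bar> / fact 2"
      using measure_relabel[OF \<open>bij h\<close> S] measure_std_simplex_image[OF g] by (simp add: f_def[abs_def])
    also have "det (matrix g) = - (area_vec q \<bullet> q 1)"
      by (simp add: det_2 matrix_def g_def f_def h_def axis_def area_vec_dim2 d dim2_simps)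
         (simp add: algebra_simps)
    finally show ?thesis by (simp add: d)
  next
    assume d: "CARD('d) = 3"
    note D = UNIV_dim3[OF d]
    define h :: "3 \<Rightarrow> 'd" where "h i = (if i = 1 then 1 else if i = 2 then 2 else 3)" for i
    have "bij h"
      unfolding bij_def inj_def surj_def forall_3
    proof (intro conjI allI)
      show "\<exists>x. y = h x" for y
      proof -
        have "y \<in> {1,2,3}" using D(1) by blast
        then show ?thesis
          by (auto simp: h_def intro: exI[of _ 1] exI[of _ 2] exI[of _ 3])
      qed
    qed (use D in \<open>auto simp: h_def\<close>)
    define f where "f x = ((\<chi> i. x $ h i) :: real^3)" for x :: "'d point"
    have f: "linear f" unfolding f_def by (rule linear_vec_lambda_nth)
    define g where "g x = x$1 *\<^sub>R f (q 1) + x$2 *\<^sub>R f (q 2) + x$3 *\<^sub>R f (q 3)" for x :: "real^3"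
    have g: "linear g" unfolding g_def by (rule linearI) (simp_all add: algebra_simps)
    have B: "Basis = {axis 1 1, axis 2 1, axis 3 (1::real) :: real^3}"
      by (auto simp: Basis_vec_def UNIV_3)
    then have gB: "g ` Basis = f ` verts q"
      unfolding B by (simp add: g_def verts_dim3 d axis_def)
    have "f ` (convex hull (insert 0 (verts q))) = convex hull (insert 0 (g ` Basis))"
      by (simp add: convex_hull_linear_image[OF f] linear_0[OF f] gB)
    then have "measure lebesgue (convex hull (insert 0 (verts q))) = \<bar>det (matrix g)\<bar> / fact 3"
      using measure_relabel[OF \<open>bij h\<close> S] measure_std_simplex_image[OF g] by (simp add: f_def[abs_def])
    also have "det (matrix g) = area_vec q \<bullet> q 1"
      by (simp add: det_3 matrix_def g_def f_def h_def axis_def area_vec_dim3 d dim3_simps)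
         (simp add: algebra_simps)
    finally show ?thesis by (simp add: d)
  qed
qed

section \<open>The volume enclosed by a cluster\<close>

context phase_cluster
begin

text \<open>Outside this null set the ray from \<open>x\<close> away from the origin has a
  direction, starts off the cluster, is parallel to no simplex and misses all lower-dimensional
  faces, since the cones over these lie in the listed spans.\<close>

definition degenerate_directions :: "'d point set" where
  "degenerate_directions = {0} \<union> \<Gamma> \<union> (\<Union>f\<in>faces. {x. area_vec (sx f) \<bullet> x = 0}) \<union>
     (\<Union>f\<in>faces. \<Union>p\<in>verts (sx f). span (verts (sx f) - {p}))"

text \<open>The sign tells on which side of a simplex the origin lies, that is, whether rays from
  the origin cross it from \<open>bm\<close> to \<open>bp\<close>. On integration it cancels the
  absolute value in the volume of the cone.\<close>

definition cone_sum :: "'d point \<Rightarrow> real" where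
  "cone_sum x = (\<Sum>f\<in>faces. jump f * sgn (area_vec (sx f) \<bullet> sx f 1) *
     indicator (convex hull (insert 0 (verts (sx f)))) x)"

lemma closed_simplex_plane: "x \<in> closed_simplex (sx f) \<Longrightarrow> area_vec (sx f) \<bullet> x = area_vec (sx f) \<bullet> sx f 1"
  by (rule inner_area_vec_closed_simplex[OF dim])

lemma negligible_degenerate_directions: "negligible degenerate_directions"
proof -
  have "negligible (closed_simplex (sx f))" if "f \<in> faces" for f
  proof (rule negligible_subset)
    show "negligible {x. area_vec (sx f) \<bullet> x = area_vec (sx f) \<bullet> sx f 1}"
      using area_vec_sx[OF that] by (intro negligible_hyperplane) simp
  qed (auto simp: closed_simplex_plane)
  then have "negligible \<Gamma>"
    unfolding \<Gamma>_def by (intro negligible_Union) auto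
  moreover have "negligible {x. area_vec (sx f) \<bullet> x = 0}" if "f \<in> faces" for f
    using area_vec_sx[OF that] by (intro negligible_hyperplane) simp
  moreover have "negligible (span (verts (sx f) - {p}))" if "f \<in> faces" "p \<in> verts (sx f)" for f p
  proof (rule negligible_lowdim)
    have "dim (verts (sx f) - {p}) \<le> card (verts (sx f) - {p})"
      by (rule dim_le_card') simp
    also have "\<dots> < CARD('d)"
      using card_verts[OF sx_nondegenerate(1)[OF that(1)]] that(2) dim by auto
    finally show "dim (span (verts (sx f) - {p})) < DIM('d point)" by simp
  qed
  ultimately show ?thesis
    unfolding degenerate_directions_def
    by (intro negligible_Un negligible_Union) auto
qed

text \<open>A point on the relative boundary of a simplex is a convex combination of all vertices
  but one. The span of these contains \<open>x\<close> along with \<open>r *\<^sub>R x\<close>,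
  which the choice of \<open>x\<close> excludes.\<close>

lemma ray_transversal:
  assumes x: "x \<notin> degenerate_directions" and "r > 0"
  shows "transversal (r *\<^sub>R x) x"
  unfolding transversal_def
proof (intro ballI impI conjI)
  fix f assume f: "f \<in> faces" and c: "r *\<^sub>R x \<in> closed_simplex (sx f)"
  show "area_vec (sx f) \<bullet> x \<noteq> 0"
    using x f by (auto simp: degenerate_directions_def)
  show "r *\<^sub>R x \<in> open_simplex (sx f)"
  proof (rule ccontr)
    assume "r *\<^sub>R x \<notin> open_simplex (sx f)"
    then have "r *\<^sub>R x \<in> rel_frontier (convex hull (verts (sx f)))"
      using c compact_imp_closed[OF compact_closed_simplex[of "sx f"]]
      by (simp add: rel_frontier_def open_simplex_def closed_simplex_def)
    then obtain p where p: "p \<in> verts (sx f)" "r *\<^sub>R x \<in> convex hull (verts (sx f) - {p})"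
      unfolding rel_frontier_convex_hull_cases[OF sx_nondegenerate(2)[OF f]] by blast
    then have "r *\<^sub>R x \<in> span (verts (sx f) - {p})"
      using convex_hull_subset_span by blast
    then have "x \<in> span (verts (sx f) - {p})"
      using \<open>r > 0\<close> span_scale[of "r *\<^sub>R x" _ "1 / r"] by simp
    then show False
      using x f p by (auto simp: degenerate_directions_def)
  qed
qed

lemma finite_ray_crossings:
  assumes x: "x \<notin> degenerate_directions"
  shows "finite {s. s *\<^sub>R x \<in> \<Gamma>}"
proof -
  have "finite {s. s *\<^sub>R x \<in> closed_simplex (sx f)}" if "f \<in> faces" for f
  proof (rule finite_subset)
    have "area_vec (sx f) \<bullet> x \<noteq> 0" using x that by (auto simp: degenerate_directions_def)
    then show "{s. s *\<^sub>R x \<in> closed_simplex (sx f)} \<subseteq> {(area_vec (sx f) \<bullet> sx f 1) / (area_vec (sx f) \<bullet> x)}"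
      by (auto dest!: closed_simplex_plane simp: field_simps)
  qed simp
  moreover have "{s. s *\<^sub>R x \<in> \<Gamma>} = (\<Union>f\<in>faces. {s. s *\<^sub>R x \<in> closed_simplex (sx f)})"
    by (auto simp: \<Gamma>_def)
  ultimately show ?thesis by simp
qed

text \<open>A nonzero point of the cone is \<open>v *\<^sub>R y\<close> with \<open>y\<close> in the
  simplex and \<open>0 < v \<le> 1\<close>, so the ray hits the simplex at \<open>s = 1 / v\<close>;
  the norm bound keeps this parameter below \<open>b\<close>.\<close>

lemma in_cone_iff:
  assumes "x \<noteq> 0" and "\<And>y. y \<in> closed_simplex p \<Longrightarrow> norm y \<le> b * norm x"
  shows "x \<in> convex hull (insert 0 (verts p)) \<longleftrightarrow> (\<exists>s\<in>{1..b}. s *\<^sub>R x \<in> closed_simplex p)"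
proof -
  have ne: "verts p \<noteq> {}" by (simp add: verts_def)
  have hull: "convex hull (insert 0 (verts p)) = {v *\<^sub>R y |v y. 0 \<le> v \<and> v \<le> 1 \<and> y \<in> closed_simplex p}"
  proof -
    have "convex hull (insert 0 (verts p)) =
        {x. \<exists>u\<ge>0. \<exists>v\<ge>0. \<exists>y. u + v = 1 \<and> y \<in> closed_simplex p \<and> x = v *\<^sub>R y}"
      by (simp add: convex_hull_insert[OF ne] closed_simplex_def)
    also have "\<dots> = {v *\<^sub>R y |v y. 0 \<le> v \<and> v \<le> 1 \<and> y \<in> closed_simplex p}"
    proof (intro subset_antisym subsetI)
      fix z assume "z \<in> {v *\<^sub>R y |v y. 0 \<le> v \<and> v \<le> 1 \<and> y \<in> closed_simplex p}"
      then obtain v y where "0 \<le> v" "v \<le> 1" "y \<in> closed_simplex p" "z = v *\<^sub>R y" by blast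
      then show "z \<in> {x. \<exists>u\<ge>0. \<exists>v\<ge>0. \<exists>y. u + v = 1 \<and> y \<in> closed_simplex p \<and> x = v *\<^sub>R y}"
        by (intro CollectI exI[of _ "1 - v"] conjI exI[of _ v] exI[of _ y]) auto
    qed force
    finally show ?thesis .
  qed
  show ?thesis
  proof
    assume "x \<in> convex hull (insert 0 (verts p))"
    then obtain v y where v: "0 \<le> v" "v \<le> 1" "y \<in> closed_simplex p" "x = v *\<^sub>R y"
      unfolding hull by blast
    then have "v > 0" using assms(1) by (cases "v = 0") auto
    then have "(1 / v) *\<^sub>R x = y" "1 \<le> 1 / v" using v by auto
    moreover have "norm y \<le> b * norm x" using assms(2) v by blast
    then have "1 / v \<le> b"
      using \<open>v > 0\<close> v(4) assms(1) by (auto simp: field_simps)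
    ultimately show "\<exists>s\<in>{1..b}. s *\<^sub>R x \<in> closed_simplex p"
      using v(3) by (intro bexI[of _ "1 / v"]) auto
  next
    assume "\<exists>s\<in>{1..b}. s *\<^sub>R x \<in> closed_simplex p"
    then obtain s where "1 \<le> s" "s *\<^sub>R x \<in> closed_simplex p" by auto
    then show "x \<in> convex hull (insert 0 (verts p))"
      unfolding hull by (intro CollectI exI[of _ "1 / s"] exI[of _ "s *\<^sub>R x"]) auto
  qed
qed

text \<open>After exchanging the sums, each simplex is hit at most once, because the ray is
  transversal to its plane, and it is hit exactly when \<open>x\<close> lies in its cone.
  \<open>C\<close> may exceed the set of hits, so that one \<open>C\<close> can serve two
  clusters.\<close>

lemma sum_ray_crossings:
  assumes x: "x \<notin> degenerate_directions" and far: "\<And>y. y \<in> \<Omega> \<Longrightarrow> norm y \<le> b * norm x"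
    and C: "finite C" "{s. s *\<^sub>R x \<in> \<Gamma>} \<subseteq> C"
  shows "(\<Sum>s\<in>C \<inter> {1..b}. crossing (s *\<^sub>R x) x) = cone_sum x"
proof -
  have "(\<Sum>s\<in>C \<inter> {1..b}. crossing (s *\<^sub>R x) x) =
    (\<Sum>f\<in>faces. \<Sum>s\<in>C \<inter> {1..b}. jump f * sgn (area_vec (sx f) \<bullet> x) * indicator (open_simplex (sx f)) (s *\<^sub>R x))"
    unfolding crossing_def by (rule sum.swap)
  also have "\<dots> = cone_sum x"
    unfolding cone_sum_def
  proof (intro sum.cong refl)
    fix f assume f: "f \<in> faces"
    let ?A = "area_vec (sx f)"
    have Ax: "?A \<bullet> x \<noteq> 0" and x0: "x \<noteq> 0" using x f by (auto simp: degenerate_directions_def)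
    have sub: "closed_simplex (sx f) \<subseteq> \<Gamma>" using f by (auto simp: \<Gamma>_def)
    have iff: "x \<in> convex hull (insert 0 (verts (sx f))) \<longleftrightarrow> (\<exists>s\<in>{1..b}. s *\<^sub>R x \<in> closed_simplex (sx f))"
      using sub Gamma_subset far by (intro in_cone_iff[OF x0]) blast
    have opn: "s *\<^sub>R x \<in> open_simplex (sx f)" if "s *\<^sub>R x \<in> closed_simplex (sx f)" "s \<ge> 1" for s
      using ray_transversal[OF x, of s] that f by (auto simp: transversal_def)
    show "(\<Sum>s\<in>C \<inter> {1..b}. jump f * sgn (?A \<bullet> x) * indicator (open_simplex (sx f)) (s *\<^sub>R x)) =
        jump f * sgn (?A \<bullet> sx f 1) * indicator (convex hull (insert 0 (verts (sx f)))) x"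
    proof (cases "\<exists>s\<in>{1..b}. s *\<^sub>R x \<in> closed_simplex (sx f)")
      case True
      then obtain s where s: "s \<in> {1..b}" "s *\<^sub>R x \<in> closed_simplex (sx f)" by blast
      have uniq: "t *\<^sub>R x \<in> open_simplex (sx f) \<longleftrightarrow> t = s" if "t \<ge> 1" for t
      proof
        assume "t *\<^sub>R x \<in> open_simplex (sx f)"
        then have "?A \<bullet> (t *\<^sub>R x) = ?A \<bullet> (s *\<^sub>R x)"
          using closed_simplex_plane s(2) open_simplex_subset by (metis subsetD)
        then show "t = s" using Ax by simp
      qed (use s opn in auto)
      have "s \<in> C" using C(2) sub s(2) by blast
      have "(\<Sum>t\<in>C \<inter> {1..b}. jump f * sgn (?A \<bullet> x) * indicator (open_simplex (sx f)) (t *\<^sub>R x)) =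
        (\<Sum>t\<in>C \<inter> {1..b}. if t = s then jump f * sgn (?A \<bullet> x) else 0)"
        using uniq by (intro sum.cong) (auto simp: indicator_def)
      also have "\<dots> = jump f * sgn (?A \<bullet> x)"
        using C(1) s \<open>s \<in> C\<close> by (subst sum.delta) auto
      finally have eq: "(\<Sum>t\<in>C \<inter> {1..b}. jump f * sgn (?A \<bullet> x) * indicator (open_simplex (sx f)) (t *\<^sub>R x)) =
        jump f * sgn (?A \<bullet> x)" .
      have "sgn (?A \<bullet> sx f 1) = sgn (s * (?A \<bullet> x))"
        using closed_simplex_plane[OF s(2)] by simp
      also have "\<dots> = sgn (?A \<bullet> x)"
        using s(1) by (simp add: sgn_mult)
      finally show ?thesis using eq True iff by simp
    next
      case False
      then have "s *\<^sub>R x \<notin> open_simplex (sx f)" if "s \<in> {1..b}" for s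
        using that open_simplex_subset by blast
      then show ?thesis using False iff by (simp add: indicator_def)
    qed
  qed
  finally show ?thesis .
qed

lemma integral_cone_sum:
  shows "integrable lebesgue cone_sum"
    "(LINT x|lebesgue. cone_sum x) = (\<Sum>f\<in>faces. jump f * (area_vec (sx f) \<bullet> sx f 1)) / fact CARD('d)"
proof -
  have S: "convex hull (insert 0 (verts (sx f))) \<in> lmeasurable" for f
    by (intro lmeasurable_compact finite_imp_compact_convex_hull) simp
  then have int: "integrable lebesgue (\<lambda>x. indicator (convex hull (insert 0 (verts (sx f)))) x :: real)" for f
    using S[of f] unfolding fmeasurable_def by (intro integrable_real_indicator) auto
  show "integrable lebesgue cone_sum"
    unfolding cone_sum_def[abs_def] by (intro Bochner_Integration.integrable_sum integrable_mult_right int)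
  have "(LINT x|lebesgue. cone_sum x) =
     (\<Sum>f\<in>faces. jump f * sgn (area_vec (sx f) \<bullet> sx f 1) * measure lebesgue (convex hull (insert 0 (verts (sx f)))))"
    unfolding cone_sum_def
    by (subst Bochner_Integration.integral_sum) (auto intro!: integrable_mult_right int sum.cong)
  also have "\<dots> = (\<Sum>f\<in>faces. jump f * (area_vec (sx f) \<bullet> sx f 1)) / fact CARD('d)"
    unfolding measure_simplex_origin[OF dim] sum_divide_distrib
    by (intro sum.cong) (auto simp: sgn_if)
  finally show "(LINT x|lebesgue. cone_sum x) = (\<Sum>f\<in>faces. jump f * (area_vec (sx f) \<bullet> sx f 1)) / fact CARD('d)" .
qed

lemma integral_phase:
  assumes "bounded \<Omega>"
  shows "integrable lebesgue phase" "(LINT x|lebesgue. phase x) = energy_content \<beta> IR R"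
proof -
  have "R l \<in> lmeasurable" if "l \<in> {1..IR}" for l
  proof (rule lmeasurable_open)
    show "bounded (R l)" using assms domain_eq that by (blast intro: bounded_subset)
  qed (rule open_region[OF that])
  then have int: "integrable lebesgue (\<lambda>x. indicator (R l) x :: real)" if "l \<in> {1..IR}" for l
    using that unfolding fmeasurable_def by (intro integrable_real_indicator) blast+
  show "integrable lebesgue phase"
    unfolding phase_def[abs_def] by (intro Bochner_Integration.integrable_sum integrable_mult_right int)
  show "(LINT x|lebesgue. phase x) = energy_content \<beta> IR R"
    unfolding phase_def energy_content_def
    by (subst Bochner_Integration.integral_sum) (auto intro!: integrable_mult_right int sum.cong)
qed

end

text \<open>
  Along the ray from \<open>x\<close> to infinity the difference of the two phase functions changes only at the
  two clusters and vanishes eventually. Its value at \<open>x\<close> is therefore a signed count of the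
  simplices hit by the ray, that is, of the cones with apex \<open>0\<close> over the simplices containing \<open>x\<close>.
\<close>

lemma energy_content_diff:
  fixes \<Omega> :: "'d::{finite,comm_ring_1} point set"
  assumes "phase_cluster \<Omega> IS IT J s q \<T> IR bp bm R" "phase_cluster \<Omega> IS IT J s q' \<T>' IR bp bm R'"
    and bounded: "bounded \<Omega>"
    and boundary: "\<forall>x\<in>frontier \<Omega>. \<forall>\<^sub>F y in at x within \<Omega>. \<forall>l\<in>{1..IR}. y \<in> R l \<longleftrightarrow> y \<in> R' l"
  shows "fact CARD('d) * (energy_content \<beta> IR R - energy_content \<beta> IR R') =
    (\<Sum>i=1..IS. (\<beta> (bp i) - \<beta> (bm i)) *
      (\<Sum>j=1..J i. area_vec (q' i j) \<bullet> q' i j 1 - area_vec (q i j) \<bullet> q i j 1))"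
proof -
  interpret A: phase_cluster \<Omega> IS IT J s q \<T> IR bp bm R \<beta> by fact
  interpret B: phase_cluster \<Omega> IS IT J s q' \<T>' IR bp bm R' \<beta> by fact
  \<comment> \<open>Either phase function alone may jump at the boundary of \<open>\<Omega>\<close>.
    The difference does not, since near the boundary both clusters have the same phases.\<close>
  define w where "w x = B.phase x - A.phase x" for x
  have w_out: "w x = 0" if "x \<notin> \<Omega>" for x
    using that by (simp add: w_def A.phase_outside B.phase_outside)
  have w_near: "\<forall>\<^sub>F y in nhds x. w y = 0" if x: "x \<notin> \<Omega>" for x
  proof (cases "x \<in> closure \<Omega>")
    case True
    then have "x \<in> frontier \<Omega>" using x A.open_domain by (simp add: frontier_def interior_open)
    then have "\<forall>\<^sub>F y in nhds x. y \<noteq> x \<longrightarrow> y \<in> \<Omega> \<longrightarrow> (\<forall>l\<in>{1..IR}. y \<in> R l \<longleftrightarrow> y \<in> R' l)"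
      using boundary by (simp add: eventually_at_filter)
    then show ?thesis
    proof eventually_elim
      case (elim y)
      show ?case
      proof (cases "y \<in> \<Omega>")
        case True
        then have "\<forall>l\<in>{1..IR}. y \<in> R l \<longleftrightarrow> y \<in> R' l" using elim x by blast
        then show ?thesis
          unfolding w_def A.phase_def B.phase_def by (auto simp: indicator_def intro!: sum.cong)
      qed (rule w_out)
    qed
  next
    case False
    then have "\<forall>\<^sub>F y in nhds x. y \<in> - closure \<Omega>"
      by (intro eventually_nhds_in_open) auto
    then show ?thesis
      by eventually_elim (use closure_subset w_out in blast)
  qed
  have key: "w x = A.cone_sum x - B.cone_sum x"
    if x: "x \<notin> A.degenerate_directions" "x \<notin> B.degenerate_directions" for x
  proof -
    have x0: "x \<noteq> 0" using x by (auto simp: A.degenerate_directions_def)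
    obtain K where K: "\<And>y. y \<in> \<Omega> \<Longrightarrow> norm y \<le> K" using bounded by (auto simp: bounded_iff)
    \<comment> \<open>Norms in \<open>\<Omega>\<close> are at most \<open>K\<close>, so the extra 1
      puts \<open>b *\<^sub>R x\<close> strictly outside. The maximum with 1 makes
      \<open>{1..b}\<close> an interval starting at the point \<open>x\<close> itself.\<close>
    define b where "b = max 1 ((K + 1) / norm x)"
    have "K + 1 \<le> b * norm x" using x0 by (auto simp: b_def max_def field_simps)
    then have far: "norm y \<le> b * norm x" if "y \<in> \<Omega>" for y using K[OF that] by linarith
    have b_out: "b *\<^sub>R x \<notin> \<Omega>"
      using K[of "b *\<^sub>R x"] \<open>K + 1 \<le> b * norm x\<close> by (auto simp: b_def)
    define C where "C = {s. s *\<^sub>R x \<in> A.\<Gamma>} \<union> {s. s *\<^sub>R x \<in> B.\<Gamma>}"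
    have C: "finite C" using A.finite_ray_crossings B.finite_ray_crossings x by (simp add: C_def)
    have "w (b *\<^sub>R x) - w (1 *\<^sub>R x) =
      (\<Sum>s\<in>C \<inter> {1..b}. B.crossing (s *\<^sub>R x) x - A.crossing (s *\<^sub>R x) x)"
    proof (rule sum_jumps)
      show "1 \<le> b" by (simp add: b_def)
      show "1 \<notin> C" using x by (simp add: C_def A.degenerate_directions_def B.degenerate_directions_def)
      show "b \<notin> C" using b_out A.Gamma_subset B.Gamma_subset by (auto simp: C_def)
    next
      fix s :: real assume s: "1 \<le> s"
      show "\<exists>p n. (\<forall>\<^sub>F e in at_right 0. w ((s + e) *\<^sub>R x) = p \<and> w ((s - e) *\<^sub>R x) = n) \<and>
          p - n = B.crossing (s *\<^sub>R x) x - A.crossing (s *\<^sub>R x) x"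
      proof (cases "s *\<^sub>R x \<in> \<Omega>")
        case True
        obtain p n where pn: "\<forall>\<^sub>F e in at_right 0. A.phase (s *\<^sub>R x + e *\<^sub>R x) = p \<and> A.phase (s *\<^sub>R x - e *\<^sub>R x) = n"
            "p - n = A.crossing (s *\<^sub>R x) x"
          using A.phase_jump[OF True A.ray_transversal[OF x(1)]] s by auto
        obtain p' n' where pn': "\<forall>\<^sub>F e in at_right 0. B.phase (s *\<^sub>R x + e *\<^sub>R x) = p' \<and> B.phase (s *\<^sub>R x - e *\<^sub>R x) = n'"
            "p' - n' = B.crossing (s *\<^sub>R x) x"
          using B.phase_jump[OF True B.ray_transversal[OF x(2)]] s by auto
        have "\<forall>\<^sub>F e in at_right 0. w ((s + e) *\<^sub>R x) = p' - p \<and> w ((s - e) *\<^sub>R x) = n' - n"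
          using pn(1) pn'(1) by eventually_elim (simp add: w_def scaleR_left_distrib scaleR_left_diff_distrib)
        then show ?thesis using pn(2) pn'(2) by (intro exI[of _ "p' - p"] exI[of _ "n' - n"]) simp
      next
        case False
        have "\<forall>\<^sub>F e in at_right 0. w ((s + e) *\<^sub>R x) = 0 \<and> w ((s - e) *\<^sub>R x) = 0"
          using eventually_line[OF w_near[OF False], of x]
          by (simp add: scaleR_left_distrib scaleR_left_diff_distrib)
        moreover have "s *\<^sub>R x \<notin> A.\<Gamma>" "s *\<^sub>R x \<notin> B.\<Gamma>"
          using False A.Gamma_subset B.Gamma_subset by auto
        ultimately show ?thesis
          by (intro exI[of _ 0]) (simp add: A.crossing_off_Gamma B.crossing_off_Gamma)
      qed
      assume "s \<notin> C"
      then have off: "s *\<^sub>R x \<notin> A.\<Gamma>" "s *\<^sub>R x \<notin> B.\<Gamma>" by (auto simp: C_def)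
      have "\<forall>\<^sub>F y in nhds (s *\<^sub>R x). w y = w (s *\<^sub>R x)"
      proof (cases "s *\<^sub>R x \<in> \<Omega>")
        case True
        show ?thesis
          using A.phase_locally_constant[OF True off(1)] B.phase_locally_constant[OF True off(2)]
          by eventually_elim (simp add: w_def)
      next
        case False
        then show ?thesis using w_near[OF False] by (simp add: w_out)
      qed
      from eventually_line[OF this, of x]
      have "\<forall>\<^sub>F e in at_right 0. w ((s + e) *\<^sub>R x) = w (s *\<^sub>R x)"
        by eventually_elim (simp add: scaleR_left_distrib)
      then show "B.crossing (s *\<^sub>R x) x - A.crossing (s *\<^sub>R x) x = 0 \<and>
          (\<forall>\<^sub>F e in at_right 0. w ((s + e) *\<^sub>R x) = w (s *\<^sub>R x))"
        using off by (simp add: A.crossing_off_Gamma B.crossing_off_Gamma)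
    qed (rule C)
    also have "\<dots> = B.cone_sum x - A.cone_sum x"
      unfolding sum_subtractf
      using A.sum_ray_crossings[OF x(1) far C] B.sum_ray_crossings[OF x(2) far C]
      by (simp add: C_def)
    finally show ?thesis using w_out[OF b_out] by simp
  qed
  have "AE x in lebesgue. w x = A.cone_sum x - B.cone_sum x"
  proof (rule AE_I')
    show "A.degenerate_directions \<union> B.degenerate_directions \<in> null_sets lebesgue"
      using A.negligible_degenerate_directions B.negligible_degenerate_directions
      by (simp add: negligible_iff_null_sets null_sets.Un)
  qed (use key in auto)
  then have "(LINT x|lebesgue. w x) = (LINT x|lebesgue. A.cone_sum x - B.cone_sum x)"
    using A.integral_cone_sum(1) B.integral_cone_sum(1) A.integral_phase(1)[OF bounded] B.integral_phase(1)[OF bounded]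
    unfolding w_def[abs_def]
    by (intro integral_cong_AE borel_measurable_diff) (auto dest: borel_measurable_integrable)
  moreover have "(LINT x|lebesgue. w x) = energy_content \<beta> IR R' - energy_content \<beta> IR R"
    unfolding w_def using A.integral_phase[OF bounded] B.integral_phase[OF bounded]
    by (simp add: Bochner_Integration.integral_diff)
  moreover have "(LINT x|lebesgue. A.cone_sum x - B.cone_sum x) =
    ((\<Sum>f\<in>A.faces. A.jump f * (area_vec (A.sx f) \<bullet> A.sx f 1)) -
     (\<Sum>f\<in>A.faces. A.jump f * (area_vec (B.sx f) \<bullet> B.sx f 1))) / fact CARD('d)"
    using A.integral_cone_sum B.integral_cone_sum by (simp add: Bochner_Integration.integral_diff diff_divide_distrib)
  ultimately have "fact CARD('d) * (energy_content \<beta> IR R - energy_content \<beta> IR R') =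
    (\<Sum>f\<in>A.faces. A.jump f * (area_vec (B.sx f) \<bullet> B.sx f 1 - area_vec (A.sx f) \<bullet> A.sx f 1))"
    by (simp add: field_simps sum_subtractf)
  also have "\<dots> = (\<Sum>i=1..IS. (\<beta> (bp i) - \<beta> (bm i)) *
      (\<Sum>j=1..J i. area_vec (q' i j) \<bullet> q' i j 1 - area_vec (q i j) \<bullet> q i j 1))"
    unfolding A.faces_def sum_distrib_left
    by (subst sum.Sigma) (auto simp: A.jump_def A.sx_def B.sx_def intro!: sum.cong)
  finally show ?thesis .
qed

section \<open>The jumps around a face of codimension two cancel\<close>

context phase_cluster
begin

definition star :: "'d point set \<Rightarrow> (nat \<times> nat) set" where
  "star F = {f \<in> faces. F \<subseteq> verts (sx f)}"

text \<open>In barycentric coordinates: at \<open>x0\<close> the coordinates belonging to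
  \<open>F\<close> are positive and stay so for small \<open>\<eta>\<close>, while the coordinate of
  \<open>p\<close> starts at 0 and grows linearly with slope \<open>\<rho> p > 0\<close>.\<close>

lemma eventually_open_simplex:
  assumes f: "f \<in> faces" and V: "verts (sx f) = insert p F" "p \<notin> F"
    and x0: "x0 \<in> rel_interior (convex hull F)"
    and nF: "\<And>y. y \<in> F \<Longrightarrow> n \<bullet> (y - x0) = 0" and np: "n \<bullet> (p - x0) > 0"
    and v: "area_vec (sx f) \<bullet> v = 0" "n \<bullet> v > 0"
  shows "\<forall>\<^sub>F \<eta> in at_right 0. x0 + \<eta> *\<^sub>R v \<in> open_simplex (sx f)"
proof -
  note nd = sx_nondegenerate(2)[OF f]
  have fin: "finite F" using V(1) finite_verts[of "sx f"] by simp
  have "\<not> affine_dependent F"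
    using nd V affine_dependent_subset by (metis subset_insertI)
  then obtain l where l: "\<And>y. y \<in> F \<Longrightarrow> 0 < l y" "sum l F = 1" "(\<Sum>y\<in>F. l y *\<^sub>R y) = x0"
    using x0 by (auto simp: rel_interior_convex_hull_explicit)
  have "x0 \<in> closed_simplex (sx f)"
    using x0 rel_interior_subset[of "convex hull F"] hull_mono[of F "verts (sx f)" convex] V
    unfolding closed_simplex_def by blast
  then have "x0 + v \<in> affine hull (verts (sx f))"
    using v inner_area_vec_closed_simplex[OF dim] sx_nondegenerate[OF f]
    by (simp add: affine_hull_verts[OF dim] inner_add_right)
  then obtain \<rho> where \<rho>: "sum \<rho> (insert p F) = 1" "(\<Sum>y\<in>insert p F. \<rho> y *\<^sub>R y) = x0 + v"
    unfolding V(1) using fin by (auto simp: affine_hull_finite)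
  \<comment> \<open>Measuring heights above \<open>x0\<close> with \<open>n\<close> isolates the
    coordinate of \<open>p\<close>, since every point of \<open>F\<close> has height 0.\<close>
  have "n \<bullet> v = n \<bullet> ((\<Sum>y\<in>insert p F. \<rho> y *\<^sub>R y) - sum \<rho> (insert p F) *\<^sub>R x0)"
    by (simp only: \<rho> scaleR_one) simp
  also have "\<dots> = (\<Sum>y\<in>insert p F. \<rho> y * (n \<bullet> (y - x0)))"
    by (simp only: scaleR_left.sum sum_subtractf[symmetric] scaleR_right_diff_distrib[symmetric]
        inner_sum_right inner_scaleR_right)
  also have "\<dots> = \<rho> p * (n \<bullet> (p - x0))"
    using fin V(2) nF by simp
  finally have \<rho>p: "\<rho> p > 0"
    using v(2) np by (metis zero_less_mult_pos2)
  define \<mu> where "\<mu> \<eta> y = (if y = p then 0 else (1 - \<eta>) * l y) + \<eta> * \<rho> y" for \<eta> y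
  have "\<forall>\<^sub>F \<eta> in at_right 0. \<forall>y\<in>insert p F. 0 < \<mu> \<eta> y"
  proof (rule eventually_ball_finite, use fin in simp, rule ballI)
    fix y assume y: "y \<in> insert p F"
    show "\<forall>\<^sub>F \<eta> in at_right 0. 0 < \<mu> \<eta> y"
    proof (cases "y = p")
      case True
      then show ?thesis
        using \<rho>p eventually_at_right_less[of "0::real"] by (simp add: \<mu>_def) (auto elim: eventually_mono)
    next
      case False
      have "((\<lambda>\<eta>. \<mu> \<eta> y) \<longlongrightarrow> (1 - 0) * l y + 0 * \<rho> y) (at_right 0)"
        using False unfolding \<mu>_def by (simp only: if_False) (intro tendsto_intros)
      moreover have "0 < (1 - 0) * l y + 0 * \<rho> y" using l(1) False y by simp
      ultimately show ?thesis by (rule order_tendstoD)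
    qed
  qed
  then show ?thesis
  proof eventually_elim
    case (elim \<eta>)
    have ne: "y \<noteq> p" if "y \<in> F" for y using that V(2) by blast
    have "sum (\<mu> \<eta>) (insert p F) = (1 - \<eta>) * sum l F + \<eta> * sum \<rho> (insert p F)"
      using fin V(2) ne by (simp add: \<mu>_def sum.distrib sum_distrib_left algebra_simps)
    then have 1: "sum (\<mu> \<eta>) (insert p F) = 1"
      by (simp only: l \<rho>) simp
    have "(\<Sum>y\<in>insert p F. \<mu> \<eta> y *\<^sub>R y) =
        (1 - \<eta>) *\<^sub>R (\<Sum>y\<in>F. l y *\<^sub>R y) + \<eta> *\<^sub>R (\<Sum>y\<in>insert p F. \<rho> y *\<^sub>R y)"
      using fin V(2) ne
      by (simp add: \<mu>_def sum.distrib scaleR_sum_right scaleR_left_distrib algebra_simps)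
    also have "\<dots> = x0 + \<eta> *\<^sub>R v"
      by (simp only: l \<rho>) (simp add: algebra_simps)
    finally show ?case
      using elim 1 rel_interior_convex_hull_explicit[OF nd]
      unfolding open_simplex_def closed_simplex_def V(1) by blast
  qed
qed

text \<open>
  Close to \<open>x0\<close> the line in direction \<open>e\<close> through \<open>x0 + \<eta> *\<^sub>R n\<close> meets exactly those simplices around
  the face which lie on the side of \<open>n\<close>.
\<close>

lemma phase_difference_beside_face:
  assumes x0: "x0 \<in> rel_interior (convex hull F)"
    and V: "\<And>f. f \<in> star F \<Longrightarrow> verts (sx f) = insert (p f) F \<and> p f \<notin> F"
    and nF: "\<And>y. y \<in> F \<Longrightarrow> n \<bullet> (y - x0) = 0" and ne: "n \<bullet> e = 0" "n \<noteq> 0"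
    and np: "\<And>f. f \<in> star F \<Longrightarrow> n \<bullet> (p f - x0) \<noteq> 0"
    and Ae: "\<And>f. f \<in> star F \<Longrightarrow> area_vec (sx f) \<bullet> e \<noteq> 0"
    and r: "\<And>f. f \<in> faces \<Longrightarrow> f \<notin> star F \<Longrightarrow> closed_simplex (sx f) \<inter> ball x0 r = {}" "ball x0 r \<subseteq> \<Omega>"
    and c: "c > 0" "c * norm e < r"
  shows "\<forall>\<^sub>F \<eta> in at_right 0. phase (x0 + \<eta> *\<^sub>R n + c *\<^sub>R e) - phase (x0 + \<eta> *\<^sub>R n - c *\<^sub>R e) =
     (\<Sum>f\<in>star F. if n \<bullet> (p f - x0) > 0 then jump f * sgn (area_vec (sx f) \<bullet> e) else 0)"
proof -
  define S where "S = {f \<in> star F. n \<bullet> (p f - x0) > 0}"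
  have S: "finite S" "S \<subseteq> faces" "S \<subseteq> star F" by (auto simp: S_def star_def)
  \<comment> \<open>The line through \<open>x0 + \<eta> *\<^sub>R n\<close> with direction
    \<open>e\<close> meets the plane of the simplex at parameter \<open>\<eta> * h f\<close>, which
    tends to 0 with \<open>\<eta>\<close>.\<close>
  define h where "h f = - ((area_vec (sx f) \<bullet> n) / (area_vec (sx f) \<bullet> e))" for f
  have x0_in: "x0 \<in> closed_simplex (sx f)" if "f \<in> star F" for f
    using x0 rel_interior_subset[of "convex hull F"] hull_mono[of F "verts (sx f)" convex] that
    unfolding closed_simplex_def star_def by blast
  have plane: "s = \<eta> * h f"
    if "f \<in> star F" "x0 + \<eta> *\<^sub>R n + s *\<^sub>R e \<in> closed_simplex (sx f)" for f \<eta> s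
  proof -
    have "area_vec (sx f) \<bullet> (x0 + \<eta> *\<^sub>R n + s *\<^sub>R e) = area_vec (sx f) \<bullet> x0"
      using inner_area_vec_closed_simplex[OF dim that(2)] inner_area_vec_closed_simplex[OF dim x0_in[OF that(1)]]
      by simp
    then show ?thesis
      using Ae[OF that(1)] by (simp add: inner_add_right h_def field_simps)
  qed
  \<comment> \<open>If the remaining vertex lay on the other side, the whole simplex would satisfy
    \<open>n \<bullet> y \<le> n \<bullet> x0\<close>. The line stays in
    \<open>n \<bullet> y > n \<bullet> x0\<close>, because \<open>e\<close> is orthogonal to
    \<open>n\<close>.\<close>
  have side: "f \<in> S" if "f \<in> star F" "x0 + \<eta> *\<^sub>R n + s *\<^sub>R e \<in> closed_simplex (sx f)" "\<eta> > 0" for f \<eta> s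
  proof -
    have "n \<bullet> (p f - x0) > 0"
    proof (rule ccontr)
      assume "\<not> n \<bullet> (p f - x0) > 0"
      then have "verts (sx f) \<subseteq> {y. n \<bullet> y \<le> n \<bullet> x0}"
        using V[OF that(1)] nF by (auto simp: inner_diff_right)
      then have "closed_simplex (sx f) \<subseteq> {y. n \<bullet> y \<le> n \<bullet> x0}"
        unfolding closed_simplex_def by (rule hull_minimal) (rule convex_halfspace_le)
      then have "n \<bullet> (x0 + \<eta> *\<^sub>R n + s *\<^sub>R e) \<le> n \<bullet> x0" using that(2) by blast
      then show False
        using that(3) ne by (auto simp: inner_add_right mult_le_0_iff not_le inner_gt_zero_iff dest: antisym[OF _ inner_ge_zero])
    qed
    then show ?thesis using that(1) by (simp add: S_def)
  qed
  have "\<forall>\<^sub>F \<eta> in at_right 0. \<forall>f\<in>S. x0 + \<eta> *\<^sub>R n + (\<eta> * h f) *\<^sub>R e \<in> open_simplex (sx f)"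
  proof (rule eventually_ball_finite[OF S(1)], rule ballI)
    fix f assume f: "f \<in> S"
    then have fs: "f \<in> star F" and ff: "f \<in> faces" and pos: "n \<bullet> (p f - x0) > 0" using S by (auto simp: S_def)
    have "\<forall>\<^sub>F \<eta> in at_right 0. x0 + \<eta> *\<^sub>R (n + h f *\<^sub>R e) \<in> open_simplex (sx f)"
      by (rule eventually_open_simplex[OF ff _ _ x0 nF pos, of "n + h f *\<^sub>R e"])
        (use V[OF fs] Ae[OF fs] ne in \<open>auto simp: inner_add_right inner_diff_right h_def\<close>)
    then show "\<forall>\<^sub>F \<eta> in at_right 0. x0 + \<eta> *\<^sub>R n + (\<eta> * h f) *\<^sub>R e \<in> open_simplex (sx f)"
      by (simp add: algebra_simps)
  qed
  moreover have "\<forall>\<^sub>F \<eta> in at_right 0. \<forall>f\<in>S. \<bar>\<eta> * h f\<bar> < c"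
  proof (rule eventually_ball_finite[OF S(1)], rule ballI)
    fix f
    have "((\<lambda>\<eta>. \<bar>\<eta> * h f\<bar>) \<longlongrightarrow> \<bar>0 * h f\<bar>) (at_right 0)" by (intro tendsto_intros)
    then show "\<forall>\<^sub>F \<eta> in at_right 0. \<bar>\<eta> * h f\<bar> < c" by (rule order_tendstoD) (use c in simp)
  qed
  moreover have "\<forall>\<^sub>F \<eta> in at_right 0. norm (\<eta> *\<^sub>R n) + c * norm e < r"
  proof -
    have "((\<lambda>\<eta>. norm (\<eta> *\<^sub>R n) + c * norm e) \<longlongrightarrow> norm (0 *\<^sub>R n) + c * norm e) (at_right 0)"
      by (intro tendsto_intros)
    then show ?thesis by (rule order_tendstoD) (use c in simp)
  qed
  moreover have "\<forall>\<^sub>F \<eta>::real in at_right 0. \<eta> > 0" by (simp add: eventually_at_right_less)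
  ultimately show ?thesis
  proof eventually_elim
    case (elim \<eta>)
    define y where "y t = x0 + \<eta> *\<^sub>R n + t *\<^sub>R e" for t
    define C where "C = (\<lambda>f. \<eta> * h f) ` S"
    have y_ball: "y t \<in> ball x0 r" if "- c \<le> t" "t \<le> c" for t
    proof -
      have "norm (\<eta> *\<^sub>R n + t *\<^sub>R e) \<le> norm (\<eta> *\<^sub>R n) + \<bar>t\<bar> * norm e"
        using norm_triangle_ineq[of "\<eta> *\<^sub>R n" "t *\<^sub>R e"] by simp
      also have "\<bar>t\<bar> * norm e \<le> c * norm e" using that by (intro mult_right_mono) auto
      finally have "norm (\<eta> *\<^sub>R n + t *\<^sub>R e) < r" using elim(3) by simp
      then show ?thesis by (simp add: y_def dist_norm add.assoc norm_minus_commute add.commute[of "t *\<^sub>R e"])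
    qed
    have hit: "f \<in> S \<and> t = \<eta> * h f" if t: "- c \<le> t" "t \<le> c" and f: "f \<in> faces" "y t \<in> closed_simplex (sx f)" for t f
    proof -
      have "f \<in> star F" using r(1)[OF f(1)] y_ball[OF t] f(2) by blast
      then show ?thesis using side plane elim(4) f(2) by (auto simp: y_def)
    qed
    have opn: "y (\<eta> * h f) \<in> open_simplex (sx f)" if "f \<in> S" for f
      using elim(1) that by (simp add: y_def)
    have C: "finite C" "C \<subseteq> {-c..c}" "- c \<notin> C" "c \<notin> C"
      using S(1) elim(2) by (force simp: C_def)+
    have "phase (y c) - phase (y (- c)) = (\<Sum>t\<in>C \<inter> {-c..c}. crossing (y t) e)"
    proof (rule sum_jumps)
      fix t assume t: "- c \<le> t" "t \<le> c"
      have y_in: "y t \<in> \<Omega>" using y_ball[OF t] r(2) by blast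
      have tr: "transversal (y t) e"
        unfolding transversal_def using hit[OF t] opn Ae S by blast
      have y_line: "y (t + d) = y t + d *\<^sub>R e" "y (t - d) = y t - d *\<^sub>R e" for d
        by (simp_all add: y_def algebra_simps)
      show "\<exists>p n. (\<forall>\<^sub>F d in at_right 0. phase (y (t + d)) = p \<and> phase (y (t - d)) = n) \<and> p - n = crossing (y t) e"
        unfolding y_line by (rule phase_jump[OF y_in tr])
      assume "t \<notin> C"
      then have off: "y t \<notin> \<Gamma>" using hit[OF t] by (auto simp: \<Gamma>_def C_def)
      have "\<forall>\<^sub>F d in at_right 0. phase (y (t + d)) = phase (y t)"
        using eventually_line[OF phase_locally_constant[OF y_in off], of e]
        by eventually_elim (simp add: y_line)
      then show "crossing (y t) e = 0 \<and> (\<forall>\<^sub>F d in at_right 0. phase (y (t + d)) = phase (y t))"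
        using off by (simp add: crossing_off_Gamma)
    qed (use c C in auto)
    also have "C \<inter> {-c..c} = C" using C by blast
    also have "(\<Sum>t\<in>C. crossing (y t) e) =
      (\<Sum>f\<in>faces. \<Sum>t\<in>C. jump f * sgn (area_vec (sx f) \<bullet> e) * indicator (open_simplex (sx f)) (y t))"
      unfolding crossing_def by (rule sum.swap)
    also have "\<dots> = (\<Sum>f\<in>faces. if f \<in> S then jump f * sgn (area_vec (sx f) \<bullet> e) else 0)"
    proof (intro sum.cong refl)
      fix f assume f: "f \<in> faces"
      have "y t \<in> open_simplex (sx f) \<longleftrightarrow> f \<in> S \<and> t = \<eta> * h f" if "t \<in> C" for t
      proof -
        have "- c \<le> t" "t \<le> c" using C(2) that by auto
        then show ?thesis using hit[of t f] opn[of f] f open_simplex_subset[of "sx f"] by auto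
      qed
      then have "(\<Sum>t\<in>C. jump f * sgn (area_vec (sx f) \<bullet> e) * indicator (open_simplex (sx f)) (y t)) =
        (\<Sum>t\<in>C. if t = \<eta> * h f then (if f \<in> S then jump f * sgn (area_vec (sx f) \<bullet> e) else 0) else 0)"
        by (intro sum.cong) (auto simp: indicator_def)
      also have "\<dots> = (if f \<in> S then jump f * sgn (area_vec (sx f) \<bullet> e) else 0)"
        using C(1) by (auto simp: sum.delta C_def)
      finally show "(\<Sum>t\<in>C. jump f * sgn (area_vec (sx f) \<bullet> e) * indicator (open_simplex (sx f)) (y t)) =
        (if f \<in> S then jump f * sgn (area_vec (sx f) \<bullet> e) else 0)" .
    qed
    also have "\<dots> = (\<Sum>f\<in>star F. if f \<in> S then jump f * sgn (area_vec (sx f) \<bullet> e) else 0)"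
      by (rule sum.mono_neutral_right) (auto simp: star_def S_def)
    also have "\<dots> = (\<Sum>f\<in>star F. if n \<bullet> (p f - x0) > 0 then jump f * sgn (area_vec (sx f) \<bullet> e) else 0)"
      by (intro sum.cong) (auto simp: S_def)
    finally show ?case by (simp add: y_def)
  qed
qed

text \<open>The lines through \<open>x0 + \<eta> *\<^sub>R n\<close> and
  \<open>x0 - \<eta> *\<^sub>R n\<close> have the same phases at their ends, because these approach
  \<open>x0 + c *\<^sub>R e\<close> and \<open>x0 - c *\<^sub>R e\<close>, which lie off the
  cluster. Hence the crossings on both sides have equal sums. By the hypothesis on \<open>os\<close>
  the sign of a crossing is \<open>os f\<close> on the side of \<open>n\<close> and
  \<open>- os f\<close> on the other, so the difference of the two sums is the claimed one.\<close>

lemma sum_jump_star: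
  assumes x0: "x0 \<in> rel_interior (convex hull F)"
    and V: "\<And>f. f \<in> star F \<Longrightarrow> verts (sx f) = insert (p f) F \<and> p f \<notin> F"
    and nF: "\<And>y. y \<in> F \<Longrightarrow> n \<bullet> (y - x0) = 0" and ne: "n \<bullet> e = 0"
    and o: "\<And>f. f \<in> star F \<Longrightarrow> os f \<in> {1, -1}"
      "\<And>f. f \<in> star F \<Longrightarrow> n \<bullet> (p f - x0) = os f * (area_vec (sx f) \<bullet> e)"
    and Ae: "\<And>f. f \<in> star F \<Longrightarrow> area_vec (sx f) \<bullet> e \<noteq> 0"
  shows "(\<Sum>f\<in>star F. jump f * os f) = 0"
proof (cases "star F = {}")
  case False
  then obtain f0 where f0: "f0 \<in> star F" by blast
  have np: "n \<bullet> (p f - x0) \<noteq> 0" if "f \<in> star F" for f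
    using o[OF that] Ae[OF that] by auto
  have n0: "n \<noteq> 0" using np[OF f0] by auto
  have x0_in: "x0 \<in> closed_simplex (sx f)" if "f \<in> star F" for f
    using x0 rel_interior_subset[of "convex hull F"] hull_mono[of F "verts (sx f)" convex] that
    unfolding closed_simplex_def star_def by blast
  have plane: "area_vec (sx f) \<bullet> (y - x0) = 0" if "f \<in> star F" "y \<in> closed_simplex (sx f)" for f y
    using inner_area_vec_closed_simplex[OF dim that(2)] inner_area_vec_closed_simplex[OF dim x0_in[OF that(1)]]
    by (simp add: inner_diff_right)
  define U where "U = \<Omega> - (\<Union>f\<in>faces - star F. closed_simplex (sx f))"
  have "open U" unfolding U_def
    by (intro open_Diff open_domain closed_UN) (auto intro: compact_imp_closed compact_closed_simplex)
  moreover have "x0 \<in> U"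
  proof -
    have "x0 \<in> \<Omega>" using x0_in[OF f0] f0 Gamma_subset by (auto simp: \<Gamma>_def star_def)
    moreover have "x0 \<notin> closed_simplex (sx f)" if f: "f \<in> faces - star F" for f
    proof
      assume "x0 \<in> closed_simplex (sx f)"
      then have "F \<subseteq> verts (sx f)"
        using face_subset_verts[of f0 f F x0] f0 f x0 by (auto simp: star_def)
      then show False using f by (simp add: star_def)
    qed
    ultimately show ?thesis by (auto simp: U_def)
  qed
  ultimately obtain r where r: "r > 0" "ball x0 r \<subseteq> U" by (auto simp: open_contains_ball)
  then have r': "closed_simplex (sx f) \<inter> ball x0 r = {}" if "f \<in> faces" "f \<notin> star F" for f
    using that by (auto simp: U_def)
  have r'': "ball x0 r \<subseteq> \<Omega>" using r by (auto simp: U_def)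
  define c where "c = r / (2 * (norm e + 1))"
  have c: "c > 0" "c * norm e < r"
  proof -
    have "norm e + 1 > 0" using norm_ge_zero[of e] by linarith
    then show "c > 0" using r by (simp add: c_def)
    have "norm e < norm e + (norm e + 2)" by (simp add: add_nonneg_pos)
    then have "norm e < 2 * (norm e + 1)" by simp
    then have "r * norm e < r * (2 * (norm e + 1))" using r by (intro mult_strict_left_mono)
    then show "c * norm e < r" using \<open>norm e + 1 > 0\<close> by (simp add: c_def field_simps)
  qed
  have c_ball: "x0 + a *\<^sub>R e \<in> ball x0 r" if "\<bar>a\<bar> = c" for a
    using c that by (simp add: dist_norm)
  have ends: "\<forall>\<^sub>F \<eta> in at_right 0. phase (x0 + \<eta> *\<^sub>R n + a *\<^sub>R e) = phase (x0 - \<eta> *\<^sub>R n + a *\<^sub>R e)" if a: "\<bar>a\<bar> = c" for a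
  proof -
    \<comment> \<open>Within the ball only simplices of the star could be hit; their planes pass
      through \<open>x0\<close> and are transversal to \<open>e\<close>.\<close>
    have "x0 + a *\<^sub>R e \<notin> \<Gamma>"
    proof
      assume "x0 + a *\<^sub>R e \<in> \<Gamma>"
      then obtain f where f: "f \<in> faces" "x0 + a *\<^sub>R e \<in> closed_simplex (sx f)" by (auto simp: \<Gamma>_def)
      then have "f \<in> star F" using r' c_ball[OF a] by blast
      then have "area_vec (sx f) \<bullet> (a *\<^sub>R e) = 0" using plane[OF _ f(2)] by simp
      then show False using a c Ae[OF \<open>f \<in> star F\<close>] by auto
    qed
    moreover have "x0 + a *\<^sub>R e \<in> \<Omega>" using c_ball[OF a] r'' by blast
    ultimately have "\<forall>\<^sub>F \<eta> in at_right 0. phase (x0 + a *\<^sub>R e + \<eta> *\<^sub>R n) = phase (x0 + a *\<^sub>R e) \<and>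
        phase (x0 + a *\<^sub>R e - \<eta> *\<^sub>R n) = phase (x0 + a *\<^sub>R e)"
      by (intro eventually_line phase_locally_constant)
    then show ?thesis
      by eventually_elim (simp add: algebra_simps)
  qed
  let ?P = "\<lambda>m. (\<Sum>f\<in>star F. if m \<bullet> (p f - x0) > 0 then jump f * sgn (area_vec (sx f) \<bullet> e) else 0)"
  have "\<forall>\<^sub>F \<eta> in at_right 0. phase (x0 + \<eta> *\<^sub>R n + c *\<^sub>R e) - phase (x0 + \<eta> *\<^sub>R n - c *\<^sub>R e) = ?P n"
    by (rule phase_difference_beside_face[OF x0 V nF ne n0 np Ae r' r'' c])
  moreover have "\<forall>\<^sub>F \<eta> in at_right 0. phase (x0 + \<eta> *\<^sub>R (-n) + c *\<^sub>R e) - phase (x0 + \<eta> *\<^sub>R (-n) - c *\<^sub>R e) = ?P (-n)"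
    by (rule phase_difference_beside_face[OF x0 V _ _ _ _ Ae r' r'' c]) (use nF ne n0 np in auto)
  moreover have "\<forall>\<^sub>F \<eta> in at_right 0. phase (x0 + \<eta> *\<^sub>R n + c *\<^sub>R e) = phase (x0 - \<eta> *\<^sub>R n + c *\<^sub>R e)"
    using c by (intro ends) simp
  moreover have "\<forall>\<^sub>F \<eta> in at_right 0. phase (x0 + \<eta> *\<^sub>R n + (- c) *\<^sub>R e) = phase (x0 - \<eta> *\<^sub>R n + (- c) *\<^sub>R e)"
    using c by (intro ends) simp
  ultimately have "\<forall>\<^sub>F \<eta>::real in at_right 0. ?P n = ?P (-n)"
    by eventually_elim simp
  then have "?P n = ?P (-n)" by simp
  moreover have "jump f * os f =
      (if n \<bullet> (p f - x0) > 0 then jump f * sgn (area_vec (sx f) \<bullet> e) else 0) -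
      (if (- n) \<bullet> (p f - x0) > 0 then jump f * sgn (area_vec (sx f) \<bullet> e) else 0)" if "f \<in> star F" for f
    using o(1)[OF that] o(2)[OF that] Ae[OF that] by (auto simp: sgn_if)
  then have "(\<Sum>f\<in>star F. jump f * os f) = ?P n - ?P (-n)"
    by (simp add: sum_subtractf)
  ultimately show ?thesis by simp
qed simp

lemma transversal_direction_exists: "\<exists>e. \<forall>f\<in>faces. area_vec (sx f) \<bullet> e \<noteq> 0"
proof -
  have "negligible (\<Union>f\<in>faces. {x. area_vec (sx f) \<bullet> x = 0})"
    using area_vec_sx by (intro negligible_Union) (auto intro!: negligible_hyperplane)
  then have "(\<Union>f\<in>faces. {x. area_vec (sx f) \<bullet> x = 0}) \<noteq> UNIV"
    using non_negligible_UNIV by metis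
  then show ?thesis by blast
qed

end

section \<open>The volume swept by a moving simplex\<close>

text \<open>\<open>averaged_normal\<close> multiplied by the norm of the area vector of the old
  simplex; without that division it is polynomial in the old and new vertices.\<close>

definition swept_normal :: "real \<Rightarrow> real \<Rightarrow> (nat \<Rightarrow> 'd::{finite,comm_ring_1} point) \<Rightarrow> (nat \<Rightarrow> 'd point) \<Rightarrow> 'd point" where
  "swept_normal t0 t1 p p' = integral {t0..t1} (\<lambda>t. area_vec (interp_simplex t0 t1 p p' t)) /\<^sub>R (t1 - t0)"

text \<open>The interpolation weights \<open>x\<close> and \<open>y\<close> are linear in time with
  \<open>x + y = 1\<close>, and the time averages of \<open>x\<^sup>2\<close>, \<open>x * y\<close>,
  \<open>y\<^sup>2\<close> are 1/3, 1/6, 1/3. This is the shape of the area vector of a triangle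
  with moving vertices.\<close>

lemma integral_quadratic_interpolation:
  fixes a b c :: "'a::euclidean_space"
  assumes "t0 < t1"
  shows "integral {t0..t1} (\<lambda>t. ((t1 - t) / (t1 - t0))\<^sup>2 *\<^sub>R a + ((t1 - t) / (t1 - t0) * ((t - t0) / (t1 - t0))) *\<^sub>R b +
      ((t - t0) / (t1 - t0))\<^sup>2 *\<^sub>R c) /\<^sub>R (t1 - t0) = (1/3) *\<^sub>R a + (1/6) *\<^sub>R b + (1/3) *\<^sub>R c"
proof -
  define T where "T = t1 - t0"
  have T: "T > 0" using assms by (simp add: T_def)
  define G where "G t = (- ((t1 - t) ^ 3) / (3 * T ^ 2)) *\<^sub>R a + ((t - t0) ^ 2 / (2 * T) - (t - t0) ^ 3 / (3 * T ^ 2)) *\<^sub>R b +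
      ((t - t0) ^ 3 / (3 * T ^ 2)) *\<^sub>R c" for t
  have t1: "t1 = t0 + T" by (simp add: T_def)
  have "((\<lambda>t. ((t1 - t) / T)\<^sup>2 *\<^sub>R a + ((t1 - t) / T * ((t - t0) / T)) *\<^sub>R b +
      ((t - t0) / T)\<^sup>2 *\<^sub>R c) has_integral (G t1 - G t0)) {t0..t1}"
  proof (rule fundamental_theorem_of_calculus)
    fix t
    show "(G has_vector_derivative ((t1 - t) / T)\<^sup>2 *\<^sub>R a + ((t1 - t) / T * ((t - t0) / T)) *\<^sub>R b +
      ((t - t0) / T)\<^sup>2 *\<^sub>R c) (at t within {t0..t1})"
    proof -
      have scale: "((\<lambda>t. f t *\<^sub>R v) has_vector_derivative f' *\<^sub>R v) (at t within {t0..t1})"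
        if "(f has_real_derivative f') (at t within {t0..t1})" for f f' and v :: 'a
        using has_vector_derivative_scaleR[OF that has_vector_derivative_const[of v]] by simp
      show ?thesis
        unfolding G_def
      proof (intro has_vector_derivative_add scale)
        show "((\<lambda>t. - ((t1 - t) ^ 3) / (3 * T ^ 2)) has_real_derivative ((t1 - t) / T)\<^sup>2) (at t within {t0..t1})"
          using T by (auto intro!: derivative_eq_intros simp: field_simps power2_eq_square power3_eq_cube)
        show "((\<lambda>t. (t - t0) ^ 2 / (2 * T) - (t - t0) ^ 3 / (3 * T ^ 2)) has_real_derivative
            (t1 - t) / T * ((t - t0) / T)) (at t within {t0..t1})"
          using T by (auto intro!: derivative_eq_intros simp: t1 field_simps power2_eq_square power3_eq_cube)
        show "((\<lambda>t. (t - t0) ^ 3 / (3 * T ^ 2)) has_real_derivative ((t - t0) / T)\<^sup>2) (at t within {t0..t1})"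
          using T by (auto intro!: derivative_eq_intros simp: field_simps power2_eq_square power3_eq_cube)
      qed
    qed
  qed (use assms in simp)
  then have "integral {t0..t1} (\<lambda>t. ((t1 - t) / T)\<^sup>2 *\<^sub>R a + ((t1 - t) / T * ((t - t0) / T)) *\<^sub>R b +
      ((t - t0) / T)\<^sup>2 *\<^sub>R c) = G t1 - G t0"
    by (rule integral_unique)
  also have "\<dots> = (T/3) *\<^sub>R a + (T/6) *\<^sub>R b + (T/3) *\<^sub>R c"
    using T by (simp add: G_def t1 power2_eq_square power3_eq_cube field_simps)
  finally show ?thesis
    using T unfolding T_def[symmetric] by (simp add: scaleR_add_right)
qed

lemma swept_normal_dim2:
  assumes d: "CARD('d::{finite,comm_ring_1}) = 2" and "t0 < t1"
  shows "swept_normal t0 t1 p p' = (1/2) *\<^sub>R (area_vec p + area_vec (p' :: nat \<Rightarrow> 'd point))"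
proof -
  have "swept_normal t0 t1 p p' = (1/3) *\<^sub>R area_vec p + (1/6) *\<^sub>R (area_vec p + area_vec p') + (1/3) *\<^sub>R area_vec p'"
    unfolding swept_normal_def integral_quadratic_interpolation[OF assms(2), symmetric]
  proof (intro arg_cong[where f="\<lambda>x. x /\<^sub>R (t1 - t0)"] integral_cong)
    fix t
    define x y where "x = (t1 - t) / (t1 - t0)" and "y = (t - t0) / (t1 - t0)"
    have xy: "x + y = 1" using assms(2) by (simp add: x_def y_def add_divide_distrib[symmetric])
    have "area_vec (interp_simplex t0 t1 p p' t) = x *\<^sub>R area_vec p + y *\<^sub>R area_vec p'"
      unfolding area_vec_dim2[OF d] interp_simplex_def x_def[symmetric] y_def[symmetric]
      by (simp add: d dim2_simps) (simp add: algebra_simps)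
    \<comment> \<open>For a segment the area vector is linear in the weights; multiplying by
      \<open>x + y = 1\<close> makes it quadratic, so that the same averaging formula
      applies.\<close>
    also have "\<dots> = (x * (x + y)) *\<^sub>R area_vec p + (y * (x + y)) *\<^sub>R area_vec p'"
      by (simp add: xy)
    also have "\<dots> = x\<^sup>2 *\<^sub>R area_vec p + (x * y) *\<^sub>R (area_vec p + area_vec p') + y\<^sup>2 *\<^sub>R area_vec p'"
      by (simp add: algebra_simps power2_eq_square)
    finally show "area_vec (interp_simplex t0 t1 p p' t) =
       ((t1 - t) / (t1 - t0))\<^sup>2 *\<^sub>R area_vec p + ((t1 - t) / (t1 - t0) * ((t - t0) / (t1 - t0))) *\<^sub>R (area_vec p + area_vec p') +
       ((t - t0) / (t1 - t0))\<^sup>2 *\<^sub>R area_vec p'"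
      by (simp only: x_def y_def)
  qed
  then show ?thesis by (simp add: d dim2_simps) (simp add: field_simps)
qed

lemma swept_normal_dim3:
  assumes d: "CARD('d::{finite,comm_ring_1}) = 3" and "t0 < t1"
  shows "swept_normal t0 t1 p p' = (1/3) *\<^sub>R area_vec p +
    (1/6) *\<^sub>R (cross (p 2 - p 1) (p' 3 - p' 1) + cross (p' 2 - p' 1) (p 3 - p 1)) +
    (1/3) *\<^sub>R area_vec (p' :: nat \<Rightarrow> 'd point)"
  unfolding swept_normal_def integral_quadratic_interpolation[OF assms(2), symmetric]
proof (intro arg_cong[where f="\<lambda>x. x /\<^sub>R (t1 - t0)"] integral_cong)
  fix t
  define x y where "x = (t1 - t) / (t1 - t0)" and "y = (t - t0) / (t1 - t0)"
  show "area_vec (interp_simplex t0 t1 p p' t) =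
     ((t1 - t) / (t1 - t0))\<^sup>2 *\<^sub>R area_vec p +
     ((t1 - t) / (t1 - t0) * ((t - t0) / (t1 - t0))) *\<^sub>R (cross (p 2 - p 1) (p' 3 - p' 1) + cross (p' 2 - p' 1) (p 3 - p 1)) +
     ((t - t0) / (t1 - t0))\<^sup>2 *\<^sub>R area_vec p'"
    unfolding area_vec_dim3[OF d] interp_simplex_def x_def[symmetric] y_def[symmetric]
    by (simp add: d dim3_simps) (simp add: algebra_simps power2_eq_square)
qed

text \<open>
  The contributions of a vertex (\<open>d = 2\<close>) and of an oriented edge (\<open>d = 3\<close>) to the difference between
  the swept volume and the change of the volume of the cone with apex \<open>0\<close>.
\<close>

definition vertex_flux :: "'d::{finite,comm_ring_1} point \<Rightarrow> 'd point \<Rightarrow> real" where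
  "vertex_flux a a' = perp a \<bullet> (a' - a)"

definition edge_flux :: "'d::{finite,comm_ring_1} point \<Rightarrow> 'd point \<Rightarrow> 'd point \<Rightarrow> 'd point \<Rightarrow> real" where
  "edge_flux a b a' b' = - ((a' - a + (b' - b)) \<bullet>
     (2 *\<^sub>R cross a b + (cross a b' + cross a' b) + 2 *\<^sub>R cross a' b')) / 6"

lemma edge_flux_swap:
  assumes d: "CARD('d::{finite,comm_ring_1}) = 3"
  shows "edge_flux b a b' a' = - edge_flux a b a' (b' :: 'd point)"
proof -
  have "(b' - b + (a' - a)) \<bullet> (2 *\<^sub>R cross b a + (cross b a' + cross b' a) + 2 *\<^sub>R cross b' a') =
      - ((a' - a + (b' - b)) \<bullet> (2 *\<^sub>R cross a b + (cross a b' + cross a' b) + 2 *\<^sub>R cross a' b'))"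
    by (simp add: d dim3_simps) (simp add: algebra_simps)
  then show ?thesis by (simp add: edge_flux_def)
qed

lemma swept_volume_dim2:
  assumes d: "CARD('d::{finite,comm_ring_1}) = 2" and "t0 < t1"
  shows "area_vec p' \<bullet> p' 1 - area_vec p \<bullet> p 1 - swept_normal t0 t1 p p' \<bullet> (\<Sum>k=1..CARD('d). p' k - p k) =
    vertex_flux (p 1) (p' 1) - vertex_flux (p 2) (p' 2 :: 'd point)"
  unfolding swept_normal_dim2[OF assms] vertex_flux_def area_vec_dim2[OF d]
  by (simp add: d dim2_simps numeral_2_eq_2) (simp add: field_simps)

text \<open>All volumes carry the factor 3!. Six times the change of the cone term pairs each
  \<open>K i j\<close> with the displacement of the opposite vertex, whereas the swept term pairs
  each with all three displacements. What remains in the difference is each \<open>K i j\<close>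
  with the displacements of its own end points, which is the flux of that edge.\<close>

lemma swept_volume_dim3:
  assumes d: "CARD('d::{finite,comm_ring_1}) = 3" and "t0 < t1"
  shows "area_vec p' \<bullet> p' 1 - area_vec p \<bullet> p 1 - swept_normal t0 t1 p p' \<bullet> (\<Sum>k=1..CARD('d). p' k - p k) =
    edge_flux (p 1) (p 2) (p' 1) (p' 2) + edge_flux (p 2) (p 3) (p' 2) (p' 3) + edge_flux (p 3) (p 1) (p' 3) (p' 1 :: 'd point)"
proof -
  have s: "(\<Sum>k=1..CARD('d). p' k - p k) = (p' 1 - p 1) + (p' 2 - p 2) + (p' 3 - p 3)"
    by (simp add: d numeral_3_eq_3 numeral_2_eq_2 atLeastAtMostSuc_conv algebra_simps)
  \<comment> \<open>Six times the time average of the cross product of the moving vertices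
    \<open>i\<close> and \<open>j\<close>.\<close>
  define K where "K i j = 2 *\<^sub>R cross (p i) (p j) + (cross (p i) (p' j) + cross (p' i) (p j)) + 2 *\<^sub>R cross (p' i) (p' j)" for i j
  have "swept_normal t0 t1 p p' = (1/6) *\<^sub>R (2 *\<^sub>R area_vec p +
      (cross (p 2 - p 1) (p' 3 - p' 1) + cross (p' 2 - p' 1) (p 3 - p 1)) + 2 *\<^sub>R area_vec p')"
    unfolding swept_normal_dim3[OF assms] by (simp add: algebra_simps)
  also have "\<dots> = (1/6) *\<^sub>R (K 1 2 + K 2 3 + K 3 1)"
    unfolding K_def area_vec_dim3[OF d] by (simp add: d dim3_simps) (simp add: algebra_simps)
  finally have N: "swept_normal t0 t1 p p' = (1/6) *\<^sub>R (K 1 2 + K 2 3 + K 3 1)" .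
  have E: "edge_flux (p i) (p j) (p' i) (p' j) = - (K i j \<bullet> (p' i - p i + (p' j - p j))) / 6" for i j
    by (simp add: edge_flux_def K_def inner_commute)
  have V: "6 * (area_vec p' \<bullet> p' 1 - area_vec p \<bullet> p 1) =
      K 1 2 \<bullet> (p' 3 - p 3) + K 2 3 \<bullet> (p' 1 - p 1) + K 3 1 \<bullet> (p' 2 - p 2)"
    unfolding K_def area_vec_dim3[OF d] by (simp add: d dim3_simps) (simp add: algebra_simps)
  show ?thesis
    unfolding s N E inner_scaleR_left inner_add_left inner_add_right using V by (simp add: field_simps)
qed

section \<open>The swept volumes of the surfaces of a cluster\<close>

context phase_cluster
begin

lemma finite_star [simp]: "finite (star F)"
  by (simp add: star_def)

text \<open>\<open>junction_set\<close> retains only a union of hulls, so first some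
  \<open>F'\<close> of the junction with \<open>x0\<close> in its hull is found. It is a face of a
  simplex of the same surface. Conformity gives \<open>F\<close> as vertices of that simplex, the
  face property puts \<open>F\<close> into the hull of \<open>F'\<close>, and extremality and equal
  cardinality yield \<open>F = F'\<close>.\<close>

lemma boundary_face_junction:
  assumes f: "f \<in> faces" and F: "F \<subseteq> verts (sx f)" "card F = CARD('d) - 1"
    and x0: "x0 \<in> rel_interior (convex hull F)" "x0 \<in> junction_set (\<T> k)"
    and k: "k \<in> {1..IT}" "fst f \<in> s k ` {1..3}"
  shows "F \<in> \<T> k"
proof -
  obtain F' where F': "F' \<in> \<T> k" "x0 \<in> convex hull F'"
    using x0(2) by (auto simp: junction_set_def)
  define i where "i = fst f"
  have i: "i \<in> {1..IS}" using f by (auto simp: i_def faces_def)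
  have "F' \<in> boundary_faces (J i) (q i)"
    using boundary_patches[OF i] k F'(1) by (auto simp: i_def)
  then have card: "card F' = CARD('d) - 1" and one: "card {j \<in> {1..J i}. F' \<subseteq> verts (q i j)} = 1"
    by (auto simp: boundary_faces_def)
  have "{j \<in> {1..J i}. F' \<subseteq> verts (q i j)} \<noteq> {}"
    using one by (metis card.empty zero_neq_one)
  then obtain j where j: "j \<in> {1..J i}" "F' \<subseteq> verts (q i j)"
    by blast
  let ?g = "(i, j)"
  have g: "?g \<in> faces" using i j by (simp add: faces_def)
  have sub: "F' \<subseteq> verts (sx ?g)" using j by (simp add: sx_def)
  have conv_sub: "convex hull F' \<subseteq> closed_simplex (sx ?g)"
    unfolding closed_simplex_def using sub by (rule hull_mono)
  then have "x0 \<in> closed_simplex (sx ?g)"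
    using F'(2) by blast
  then have Fg: "F \<subseteq> verts (sx ?g)" by (rule face_subset_verts[OF f g F(1) x0(1)])
  note nd = sx_nondegenerate(2)[OF g]
  have "convex hull F' face_of closed_simplex (sx ?g)"
    using face_of_convex_hull_affine_independent[OF nd] sub by (auto simp: closed_simplex_def)
  then have "convex hull F \<subseteq> convex hull F'"
    by (rule subset_of_face_of)
      (use Fg hull_mono[of F "verts (sx ?g)" convex] x0(1) F'(2) in \<open>auto simp: closed_simplex_def\<close>)
  moreover have "F \<subseteq> convex hull F" by (rule hull_subset)
  ultimately have FF: "F \<subseteq> convex hull F'" by blast
  have "F \<subseteq> F'"
  proof
    fix y assume y: "y \<in> F"
    have "y extreme_point_of closed_simplex (sx ?g)"
      using Fg y nd by (auto simp: closed_simplex_def extreme_point_of_convex_hull_affine_independent)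
    then have "y extreme_point_of (convex hull F')"
      using FF y conv_sub unfolding extreme_point_of_def by blast
    then show "y \<in> F'" by (rule extreme_point_of_convex_hull)
  qed
  moreover have "finite F'" using sub finite_verts finite_subset by blast
  ultimately have "F = F'" using F(2) card by (intro card_subset_eq) simp_all
  then show ?thesis using F'(1) by simp
qed

definition matching :: "(nat \<Rightarrow> 'd point \<Rightarrow> 'b) \<Rightarrow> bool" where
  "matching X \<longleftrightarrow> (\<forall>k\<in>{1..IT}. \<forall>x\<in>junction_set (\<T> k).
     X (s k 1) x = X (s k 2) x \<and> X (s k 2) x = X (s k 3) x)"

text \<open>Two different surfaces containing \<open>F\<close> meet in its relative interior, so for
  each of them \<open>F\<close> belongs to one of its junctions. Junctions are disjoint, hence it is
  the same junction for both, and there \<open>matching\<close> applies.\<close>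

lemma matching_on_faces:
  fixes X :: "nat \<Rightarrow> 'd point \<Rightarrow> 'b"
  assumes X: "matching X"
    and f: "f \<in> star F" "f' \<in> star F" and F: "card F = CARD('d) - 1" and y: "y \<in> F"
  shows "X (fst f) y = X (fst f') y"
proof (cases "fst f = fst f'")
  case False
  have "rel_interior (convex hull F) \<noteq> {}"
    using y by (subst rel_interior_eq_empty) auto
  then obtain x0 where x0: "x0 \<in> rel_interior (convex hull F)" by blast
  have mem: "\<exists>k\<in>{1..IT}. fst g \<in> s k ` {1..3} \<and> F \<in> \<T> k"
    if g: "g \<in> star F" "g' \<in> star F" "fst g \<noteq> fst g'" for g g'
  proof -
    have "x0 \<in> surface (J (fst h)) (q (fst h))" if "h \<in> star F" for h
    proof -
      have "x0 \<in> closed_simplex (sx h)"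
        using x0 rel_interior_subset[of "convex hull F"] hull_mono[of F "verts (sx h)" convex] that
        unfolding closed_simplex_def star_def by blast
      then show ?thesis
        using that by (cases h) (auto simp: surface_def star_def faces_def sx_def)
    qed
    then have "x0 \<in> surface (J (fst g)) (q (fst g)) \<inter> surface (J (fst g')) (q (fst g'))"
      using g by blast
    moreover have "fst g \<in> {1..IS}" "fst g' \<in> {1..IS}"
      using g by (auto simp: star_def faces_def)
    ultimately obtain k where k: "k \<in> {1..IT}" "fst g \<in> s k ` {1..3}" "x0 \<in> junction_set (\<T> k)"
      using meet_at_junctions[of "fst g" "fst g'"] g(3) by blast
    then have "F \<in> \<T> k"
      using boundary_face_junction[of g F x0 k] g(1) F x0 by (auto simp: star_def)
    then show ?thesis using k by blast
  qed
  obtain k where k: "k \<in> {1..IT}" "fst f \<in> s k ` {1..3}" "F \<in> \<T> k"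
    using mem[OF f False] by blast
  obtain k' where k': "k' \<in> {1..IT}" "fst f' \<in> s k' ` {1..3}" "F \<in> \<T> k'"
    using mem[OF f(2,1)] False by auto
  have "k = k'" using junction_disjoint[of k k'] k k' by blast
  moreover have "y \<in> junction_set (\<T> k)"
    using y k(3) by (auto simp: junction_set_def intro: hull_inc)
  then have "X (s k 1) y = X (s k 2) y \<and> X (s k 2) y = X (s k 3) y"
    using X k(1) unfolding matching_def by blast
  moreover have "{1..3} = {1, 2, 3::nat}" by auto
  ultimately show ?thesis using k(2) k'(2) by auto
qed simp

lemma sx_distinct:
  assumes "f \<in> faces"
  shows "sx f 1 \<noteq> sx f 2" "CARD('d) = 3 \<Longrightarrow> sx f 1 \<noteq> sx f 3 \<and> sx f 2 \<noteq> sx f 3"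
  using inj_onD[OF sx_nondegenerate(1)[OF assms], of 1 2] inj_onD[OF sx_nondegenerate(1)[OF assms], of 1 3]
    inj_onD[OF sx_nondegenerate(1)[OF assms], of 2 3] dim by auto

lemma sum_jump_vertex:
  assumes d: "CARD('d) = 2"
  shows "(\<Sum>f\<in>star {a}. jump f * (if sx f 1 = a then 1 else -1)) = 0"
proof -
  obtain e where e: "\<And>f. f \<in> faces \<Longrightarrow> area_vec (sx f) \<bullet> e \<noteq> 0"
    using transversal_direction_exists by blast
  have rel: "a \<in> rel_interior (convex hull {a})" by simp
  define p where "p f = (if sx f 1 = a then sx f 2 else sx f 1)" for f
  show ?thesis
  \<comment> \<open>\<open>perp\<close> is skew, so \<open>- perp e\<close> paired with the edge
    leaving \<open>a\<close> is \<open>perp\<close> of this edge paired with \<open>e\<close>. That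
    is the area vector term, up to a sign that tells whether \<open>a\<close> is the first or the
    second vertex.\<close>
  proof (rule sum_jump_star[OF rel, where p=p and n="- perp e" and e=e])
    show "- perp e \<bullet> e = 0" by (simp add: d dim2_simps)
    fix f assume f: "f \<in> star {a}"
    then have ff: "f \<in> faces" and a: "a = sx f 1 \<or> a = sx f 2" by (auto simp: star_def verts_dim2 d)
    note ne = sx_distinct(1)[OF ff]
    show "verts (sx f) = insert (p f) {a} \<and> p f \<notin> {a}"
      using a ne by (auto simp: p_def verts_dim2 d)
    show "area_vec (sx f) \<bullet> e \<noteq> 0" by (rule e[OF ff])
    show "- perp e \<bullet> (p f - a) = (if sx f 1 = a then 1 else -1) * (area_vec (sx f) \<bullet> e)"
      using a ne by (elim disjE)
        (simp_all add: p_def area_vec_dim2 d inner_dim2 perp_nth, simp_all add: algebra_simps)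
  qed auto
qed

text \<open>Edges directed along the cyclic order of the vertices, the boundary orientation that
  belongs to \<open>area_vec\<close>.\<close>

definition edge :: "nat \<times> nat \<Rightarrow> 'd point \<Rightarrow> 'd point \<Rightarrow> bool" where
  "edge f a b \<longleftrightarrow> (a, b) \<in> {(sx f 1, sx f 2), (sx f 2, sx f 3), (sx f 3, sx f 1)}"

text \<open>\<open>cross e (b - a)\<close> is orthogonal to the edge and to \<open>e\<close>. Its
  product with \<open>p f - a\<close> is the triple product of \<open>e\<close>,
  \<open>b - a\<close> and \<open>p f - a\<close>, hence equal to
  \<open>area_vec (sx f) \<bullet> e\<close> up to the sign with which the triangle traverses the
  edge.\<close>

lemma sum_jump_edge:
  assumes d: "CARD('d) = 3" and ab: "a \<noteq> b"
  shows "(\<Sum>f\<in>star {a, b}. jump f * (if edge f a b then 1 else -1)) = 0"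
proof -
  obtain e where e: "\<And>f. f \<in> faces \<Longrightarrow> area_vec (sx f) \<bullet> e \<noteq> 0"
    using transversal_direction_exists by blast
  have "rel_interior (convex hull {a, b}) \<noteq> {}"
    by (subst rel_interior_eq_empty) auto
  then obtain x0 where x0: "x0 \<in> rel_interior (convex hull {a, b})" by blast
  then have "x0 \<in> convex hull {a, b}" using rel_interior_subset by blast
  then obtain u where u: "x0 = a + u *\<^sub>R (b - a)" unfolding convex_hull_2_alt by auto
  define p where "p f = (if sx f 1 \<notin> {a, b} then sx f 1 else if sx f 2 \<notin> {a, b} then sx f 2 else sx f 3)" for f
  define n where "n = cross e (b - a)"
  have n: "n \<bullet> (b - a) = 0" "n \<bullet> e = 0"
    by (simp_all add: n_def d dim3_simps) (simp_all add: algebra_simps)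
  have n': "n \<bullet> (y - x0) = n \<bullet> (y - a)" for y
    using n(1) by (simp add: u inner_diff_right inner_add_right algebra_simps)
  show ?thesis
  proof (rule sum_jump_star[OF x0, where p=p and n=n and e=e])
    fix f assume f: "f \<in> star {a, b}"
    then have ff: "f \<in> faces" and "a \<in> verts (sx f)" "b \<in> verts (sx f)" by (auto simp: star_def)
    then have a: "a = sx f 1 \<or> a = sx f 2 \<or> a = sx f 3" and b: "b = sx f 1 \<or> b = sx f 2 \<or> b = sx f 3"
      by (auto simp: verts_dim3 d)
    have ne: "sx f 1 \<noteq> sx f 2" "sx f 1 \<noteq> sx f 3" "sx f 2 \<noteq> sx f 3"
      using sx_distinct[OF ff] d by auto
    show "verts (sx f) = insert (p f) {a, b} \<and> p f \<notin> {a, b}"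
      using a b ab ne by (elim disjE) (auto simp: p_def verts_dim3 d)
    show "area_vec (sx f) \<bullet> e \<noteq> 0" by (rule e[OF ff])
    have cyc: "cross e (y - x) \<bullet> (z - x) = cross (y - x) (z - x) \<bullet> e"
      "cross e (y - x) \<bullet> (z - x) = - (cross (z - x) (y - x) \<bullet> e)"
      "cross (z - y) (x - y) = cross (y - x) (z - x)"
      for x y z :: "'d point"
      by (simp_all add: d dim3_simps) (simp_all add: algebra_simps)
    have "(edge f a b \<and> area_vec (sx f) = cross (b - a) (p f - a)) \<or>
        (\<not> edge f a b \<and> area_vec (sx f) = cross (p f - a) (b - a))"
      using a b ab ne cyc(3)[of "sx f 3" "sx f 2" "sx f 1"] cyc(3)[of "sx f 1" "sx f 3" "sx f 2"]
      by (elim disjE) (simp_all add: edge_def p_def area_vec_dim3 d)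
    then show "n \<bullet> (p f - x0) = (if edge f a b then 1 else -1) * (area_vec (sx f) \<bullet> e)"
      using cyc(1)[of b a "p f"] cyc(2)[of b a "p f"] n'[of "p f"] unfolding n_def by auto
  next
    fix y assume "y \<in> {a, b}"
    then show "n \<bullet> (y - x0) = 0" using n(1) by (auto simp: n')
  qed (use n in auto)
qed

end

section \<open>Cancellation of the fluxes over a cluster\<close>

context phase_cluster
begin

text \<open>Turns pairwise agreement into one position map per face. The flux through a face then no
  longer depends on the simplex and can be taken out of the sum over the star.\<close>

lemma matching_section:
  fixes X :: "nat \<Rightarrow> 'd point \<Rightarrow> 'b"
  assumes X: "matching X"
  shows "\<exists>Y. \<forall>f F y. f \<in> star F \<longrightarrow> card F = CARD('d) - 1 \<longrightarrow> y \<in> F \<longrightarrow> X (fst f) y = Y F y"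
proof (intro exI allI impI)
  fix f F y assume f: "f \<in> star F" and F: "card F = CARD('d) - 1" "y \<in> F"
  have "(SOME f. f \<in> star F) \<in> star F" using f by (rule someI)
  from matching_on_faces[where X=X, OF X f this F]
  show "X (fst f) y = X (fst (SOME f. f \<in> star F)) y" .
qed

text \<open>Regrouped by vertices, each flux \<open>w a\<close> is multiplied by the oriented jumps
  around \<open>a\<close>, which add up to 0.\<close>

lemma sum_flux_dim2:
  assumes d: "CARD('d) = 2"
    and X: "matching X"
  shows "(\<Sum>f\<in>faces. jump f * (vertex_flux (sx f 1) (X (fst f) (sx f 1)) - vertex_flux (sx f 2) (X (fst f) (sx f 2)))) = 0"
proof -
  obtain Y where "\<forall>f F y. f \<in> star F \<longrightarrow> card F = CARD('d) - 1 \<longrightarrow> y \<in> F \<longrightarrow> X (fst f) y = Y F y"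
    using matching_section[of X, OF X] by (elim exE)
  then have Y: "X (fst f) y = Y F y" if "f \<in> star F" "card F = CARD('d) - 1" "y \<in> F" for f F y
    using that by blast
  define w where "w a = vertex_flux a (Y {a} a)" for a
  define V where "V = (\<Union>f\<in>faces. verts (sx f))"
  have V: "finite V" by (simp add: V_def)
  have "(\<Sum>f\<in>faces. jump f * (vertex_flux (sx f 1) (X (fst f) (sx f 1)) - vertex_flux (sx f 2) (X (fst f) (sx f 2)))) =
    (\<Sum>f\<in>faces. \<Sum>a\<in>V. if f \<in> star {a} then w a * (jump f * (if sx f 1 = a then 1 else -1)) else 0)"
  proof (intro sum.cong refl)
    fix f assume f: "f \<in> faces"
    have st: "f \<in> star {a} \<longleftrightarrow> a = sx f 1 \<or> a = sx f 2" for a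
      using f by (auto simp: star_def verts_dim2 d)
    have w: "vertex_flux (sx f k) (X (fst f) (sx f k)) = w (sx f k)" if "k = 1 \<or> k = 2" for k
      using Y[of f "{sx f k}" "sx f k"] st that by (auto simp: w_def d)
    have "(\<Sum>a\<in>V. if f \<in> star {a} then w a * (jump f * (if sx f 1 = a then 1 else -1)) else 0) =
      (\<Sum>a\<in>{sx f 1, sx f 2}. w a * (jump f * (if sx f 1 = a then 1 else -1)))"
      using f by (intro sum.mono_neutral_cong_right V) (auto simp: st V_def verts_dim2 d)
    also have "\<dots> = jump f * (w (sx f 1) - w (sx f 2))"
      using sx_distinct(1)[OF f] by (simp add: algebra_simps)
    finally show "jump f * (vertex_flux (sx f 1) (X (fst f) (sx f 1)) - vertex_flux (sx f 2) (X (fst f) (sx f 2))) =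
      (\<Sum>a\<in>V. if f \<in> star {a} then w a * (jump f * (if sx f 1 = a then 1 else -1)) else 0)"
      using w[of 1] w[of 2] by simp
  qed
  also have "\<dots> = (\<Sum>a\<in>V. \<Sum>f\<in>faces. if f \<in> star {a} then w a * (jump f * (if sx f 1 = a then 1 else -1)) else 0)"
    by (rule sum.swap)
  also have "\<dots> = (\<Sum>a\<in>V. w a * (\<Sum>f\<in>star {a}. jump f * (if sx f 1 = a then 1 else -1)))"
    unfolding sum_distrib_left
    by (intro sum.cong refl sum.mono_neutral_cong_right) (auto simp: star_def)
  also have "\<dots> = 0"
    by (intro sum.neutral ballI) (simp only: sum_jump_vertex[OF d] mult_zero_right)
  finally show ?thesis .
qed

text \<open>Summing over ordered pairs of vertices avoids choosing an orientation for each edge. The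
  weight \<open>w\<close> is antisymmetric, and the cancellation of jumps around an edge says
  precisely that \<open>N\<close> is symmetric off the diagonal; such a sum equals its own
  negative.\<close>

lemma sum_flux_dim3:
  assumes d: "CARD('d) = 3"
    and X: "matching X"
  defines "flux \<equiv> \<lambda>f a b. edge_flux a b (X (fst f) a) (X (fst f) b)"
  shows "(\<Sum>f\<in>faces. jump f * (flux f (sx f 1) (sx f 2) + flux f (sx f 2) (sx f 3) + flux f (sx f 3) (sx f 1))) = 0"
proof -
  obtain Y where "\<forall>f F y. f \<in> star F \<longrightarrow> card F = CARD('d) - 1 \<longrightarrow> y \<in> F \<longrightarrow> X (fst f) y = Y F y"
    using matching_section[of X, OF X] by (elim exE)
  then have Y: "X (fst f) y = Y F y" if "f \<in> star F" "card F = CARD('d) - 1" "y \<in> F" for f F y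
    using that by blast
  define w where "w a b = edge_flux a b (Y {a, b} a) (Y {a, b} b)" for a b
  have w_swap: "w b a = - w a b" for a b
    unfolding w_def insert_commute[of b a] by (rule edge_flux_swap[OF d])
  define V where "V = (\<Union>f\<in>faces. verts (sx f))"
  have V: "finite V" by (simp add: V_def)
  define N where "N a b = (\<Sum>f\<in>faces. if edge f a b then jump f else 0)" for a b
  have distinct: "sx f 1 \<noteq> sx f 2" "sx f 1 \<noteq> sx f 3" "sx f 2 \<noteq> sx f 3" if "f \<in> faces" for f
    using sx_distinct[OF that] d by auto
  have verts: "verts (sx f) = {sx f 1, sx f 2, sx f 3}" for f
    by (simp add: verts_dim3 d)
  have w_flux: "flux f a b = w a b" if "f \<in> faces" "edge f a b" for f a b
  proof -
    have "f \<in> star {a, b}" "a \<noteq> b" using that distinct[OF that(1)] by (auto simp: edge_def star_def verts)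
    then show ?thesis using Y[of f "{a, b}"] by (simp add: flux_def w_def d)
  qed
  have edge_star: "f \<in> star {a, b}" if "f \<in> faces" "edge f a b" for f a b
    using that unfolding edge_def star_def verts by blast
  have N_swap: "N a b = N b a" if ab: "a \<noteq> b" for a b
  proof -
    have "0 = (\<Sum>f\<in>star {a, b}. jump f * (if edge f a b then 1 else -1))"
      using sum_jump_edge[OF d ab] by simp
    also have "\<dots> = (\<Sum>f\<in>faces. (if edge f a b then jump f else 0) - (if edge f b a then jump f else 0))"
    proof (rule sum.mono_neutral_cong_left)
      show "\<forall>f\<in>faces - star {a, b}. (if edge f a b then jump f else 0) - (if edge f b a then jump f else 0) = 0"
        using edge_star[of _ a b] edge_star[of _ b a] by (auto simp: insert_commute)
      fix f assume "f \<in> star {a, b}"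
      then have f: "f \<in> faces" and mem: "a \<in> {sx f 1, sx f 2, sx f 3}" "b \<in> {sx f 1, sx f 2, sx f 3}"
        by (auto simp: star_def verts)
      have "edge f b a \<longleftrightarrow> \<not> edge f a b"
        using mem ab distinct[OF f] by (auto simp: edge_def)
      then show "jump f * (if edge f a b then 1 else -1) =
          (if edge f a b then jump f else 0) - (if edge f b a then jump f else 0)"
        by simp
    qed (auto simp: star_def)
    also have "\<dots> = N a b - N b a" by (simp add: N_def sum_subtractf)
    finally show ?thesis by simp
  qed
  have "(\<Sum>f\<in>faces. jump f * (flux f (sx f 1) (sx f 2) + flux f (sx f 2) (sx f 3) + flux f (sx f 3) (sx f 1))) =
    (\<Sum>f\<in>faces. \<Sum>(a, b)\<in>V \<times> V. if edge f a b then jump f * w a b else 0)"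
  proof (intro sum.cong refl)
    fix f assume f: "f \<in> faces"
    let ?E = "{(sx f 1, sx f 2), (sx f 2, sx f 3), (sx f 3, sx f 1)}"
    have "(\<Sum>(a, b)\<in>V \<times> V. if edge f a b then jump f * w a b else 0) = (\<Sum>(a, b)\<in>?E. jump f * w a b)"
    proof (rule sum.mono_neutral_cong_right)
      show "?E \<subseteq> V \<times> V" using f verts unfolding V_def by blast
      show "\<forall>c\<in>V \<times> V - ?E. (case c of (a, b) \<Rightarrow> if edge f a b then jump f * w a b else 0) = 0"
        unfolding edge_def by (simp split: prod.split)
      fix c assume "c \<in> ?E"
      then show "(case c of (a, b) \<Rightarrow> if edge f a b then jump f * w a b else 0) = (case c of (a, b) \<Rightarrow> jump f * w a b)"
        unfolding edge_def by (elim insertE emptyE) simp_all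
    qed (simp add: V)
    also have "\<dots> = jump f * (w (sx f 1) (sx f 2) + w (sx f 2) (sx f 3) + w (sx f 3) (sx f 1))"
      using distinct[OF f] by (simp add: algebra_simps)
    finally show "jump f * (flux f (sx f 1) (sx f 2) + flux f (sx f 2) (sx f 3) + flux f (sx f 3) (sx f 1)) =
      (\<Sum>(a, b)\<in>V \<times> V. if edge f a b then jump f * w a b else 0)"
      using w_flux[OF f] by (simp add: edge_def)
  qed
  also have "\<dots> = (\<Sum>(a, b)\<in>V \<times> V. N a b * w a b)"
    unfolding N_def sum_distrib_right
    by (subst sum.swap) (auto intro!: sum.cong)
  finally have S: "(\<Sum>f\<in>faces. jump f * (flux f (sx f 1) (sx f 2) + flux f (sx f 2) (sx f 3) + flux f (sx f 3) (sx f 1))) =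
    (\<Sum>(a, b)\<in>V \<times> V. N a b * w a b)" .
  have "(\<Sum>(a, b)\<in>V \<times> V. N a b * w a b) = (\<Sum>(a, b)\<in>V \<times> V. N b a * w b a)"
    by (rule sum.reindex_bij_witness[where i=prod.swap and j=prod.swap]) auto
  also have "\<dots> = (\<Sum>(a, b)\<in>V \<times> V. - (N a b * w a b))"
  proof (intro sum.cong refl)
    fix c assume "c \<in> V \<times> V"
    obtain a b where c: "c = (a, b)" by (cases c)
    show "(case c of (a, b) \<Rightarrow> N b a * w b a) = (case c of (a, b) \<Rightarrow> - (N a b * w a b))"
      using N_swap[of a b] w_swap[of b a] by (cases "a = b") (auto simp: c)
  qed
  also have "\<dots> = - (\<Sum>(a, b)\<in>V \<times> V. N a b * w a b)"
    by (simp add: sum_negf case_prod_unfold)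
  finally show ?thesis using S by simp
qed

lemma sum_swept_volume:
  assumes X: "matching X"
    and q': "\<And>i j k. q' i j k = X i (q i j k)" and "t0 < t1"
  shows "(\<Sum>i=1..IS. (\<beta> (bp i) - \<beta> (bm i)) *
      (\<Sum>j=1..J i. area_vec (q' i j) \<bullet> q' i j 1 - area_vec (q i j) \<bullet> q i j 1)) =
    (\<Sum>i=1..IS. (\<beta> (bp i) - \<beta> (bm i)) *
      (\<Sum>j=1..J i. swept_normal t0 t1 (q i j) (q' i j) \<bullet> (\<Sum>k=1..CARD('d). q' i j k - q i j k)))"
proof -
  have conv: "(\<Sum>i=1..IS. (\<beta> (bp i) - \<beta> (bm i)) * (\<Sum>j=1..J i. g i j)) = (\<Sum>f\<in>faces. jump f * g (fst f) (snd f))"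
    for g :: "nat \<Rightarrow> nat \<Rightarrow> real"
    unfolding faces_def sum_distrib_left
    by (subst sum.Sigma) (auto simp: jump_def intro!: sum.cong)
  define p' where "p' f = q' (fst f) (snd f)" for f
  have p': "p' f k = X (fst f) (sx f k)" for f k
    by (simp add: p'_def q' sx_def case_prod_unfold)
  have sx: "q (fst f) (snd f) = sx f" for f
    by (simp add: sx_def case_prod_unfold)
  have "(\<Sum>f\<in>faces. jump f * (area_vec (p' f) \<bullet> p' f 1 - area_vec (sx f) \<bullet> sx f 1)) -
    (\<Sum>f\<in>faces. jump f * (swept_normal t0 t1 (sx f) (p' f) \<bullet> (\<Sum>k=1..CARD('d). p' f k - sx f k))) =
    (\<Sum>f\<in>faces. jump f * (area_vec (p' f) \<bullet> p' f 1 - area_vec (sx f) \<bullet> sx f 1 -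
      swept_normal t0 t1 (sx f) (p' f) \<bullet> (\<Sum>k=1..CARD('d). p' f k - sx f k)))"
    unfolding sum_subtractf[symmetric] right_diff_distrib[symmetric] ..
  also have "\<dots> = 0"
    using dim
  proof
    assume d: "CARD('d) = 2"
    show ?thesis
      unfolding swept_volume_dim2[OF d \<open>t0 < t1\<close>] unfolding p' by (rule sum_flux_dim2[OF d X])
  next
    assume d: "CARD('d) = 3"
    show ?thesis
      unfolding swept_volume_dim3[OF d \<open>t0 < t1\<close>] unfolding p' by (rule sum_flux_dim3[OF d X])
  qed
  finally show ?thesis
    unfolding conv p'_def[symmetric] sx by simp
qed

end

section \<open>Integration of affine functions over a simplex\<close>

context
  notes One_nat_def [simp del]
begin

lemma std_simplex_eq:
  "std_simplex n = {x. (\<forall>i\<in>{1..<n}. 0 \<le> x i) \<and> sum x {1..<n} \<le> 1} \<inter> space (\<Pi>\<^sub>M k\<in>{1..<n}. (lborel :: real measure))"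
  by (auto simp: std_simplex_def space_PiM)

lemma emeasure_std_simplex_PiM:
  "emeasure (\<Pi>\<^sub>M k\<in>{1..<n}. lborel) (std_simplex n) = ennreal (1 / fact (n - 1))"
  unfolding std_simplex_eq using emeasure_std_simplex_aux[of "{1..<n}" 1] by simp

lemma sets_std_simplex [measurable]: "std_simplex n \<in> sets (\<Pi>\<^sub>M k\<in>{1..<n}. lborel)"
  unfolding std_simplex_eq by measurable

lemma measure_std_simplex_PiM: "measure (\<Pi>\<^sub>M k\<in>{1..<n}. lborel) (std_simplex n) = 1 / fact (n - 1)"
  by (simp add: measure_def emeasure_std_simplex_PiM)

lemma set_integrable_std_simplex_const: "set_integrable (\<Pi>\<^sub>M k\<in>{1..<n}. lborel) (std_simplex n) (\<lambda>_. c :: real)"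
  unfolding set_integrable_def
  by (intro integrable_scaleR_left integrable_real_indicator) (simp_all add: emeasure_std_simplex_PiM sets_std_simplex)

lemma set_integrable_std_simplex_coord:
  assumes "k \<in> {1..<n}"
  shows "set_integrable (\<Pi>\<^sub>M k\<in>{1..<n}. lborel) (std_simplex n) (\<lambda>s. s k)"
  unfolding set_integrable_def
proof (rule Bochner_Integration.integrable_bound)
  show "integrable (\<Pi>\<^sub>M k\<in>{1..<n}. lborel) (\<lambda>s. indicator (std_simplex n) s *\<^sub>R (1::real))"
    using set_integrable_std_simplex_const[of n 1] unfolding set_integrable_def .
  show "(\<lambda>s. indicator (std_simplex n) s *\<^sub>R s k) \<in> borel_measurable (\<Pi>\<^sub>M k\<in>{1..<n}. lborel)"
    using assms by measurable
  have "s k \<le> 1 \<and> 0 \<le> s k" if "s \<in> std_simplex n" for s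
    using that assms member_le_sum[of k "{1..<n}" s] by (auto simp: std_simplex_def)
  then show "AE s in \<Pi>\<^sub>M k\<in>{1..<n}. lborel. norm (indicator (std_simplex n) s *\<^sub>R s k) \<le> norm (indicator (std_simplex n) s *\<^sub>R (1::real))"
    by (intro AE_I2) (auto simp: indicator_def)
qed

lemma set_integral_std_simplex_coord:
  assumes n: "n = 2 \<or> n = 3" and k: "k \<in> {1..<n}"
  shows "(LINT s:std_simplex n|(\<Pi>\<^sub>M k\<in>{1..<n}. lborel). s k) = 1 / fact n"
  using n
proof
  assume n: "n = 2"
  interpret product_sigma_finite "\<lambda>_. lborel :: real measure" ..
  have k1: "k = 1" using k n by auto
  have I: "{1..<n} = {1}" using n by auto
  have "(LINT s:std_simplex n|(\<Pi>\<^sub>M k\<in>{1..<n}. lborel). s k) = (LINT s|(\<Pi>\<^sub>M k\<in>{1::nat}. lborel). (s 1) ^ 1 * indicator {0..1} (s 1))"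
    unfolding set_lebesgue_integral_def I k1
    by (intro Bochner_Integration.integral_cong refl) (auto simp: std_simplex_def I indicator_def space_PiM)
  also have "\<dots> = (LBINT y. y ^ 1 * indicator {0..1} y)"
    by (rule product_integral_singleton) simp
  also have "\<dots> = 1 / 2" by (subst integral_power) simp_all
  finally show ?thesis using n by (simp add: fact_numeral)
next
  assume n: "n = 3"
  interpret product_sigma_finite "\<lambda>_. lborel :: real measure" ..
  \<comment> \<open>\<open>l\<close> is the other index in \<open>{1, 2}\<close>. Integrating over
    the coordinate \<open>k\<close> first gives \<open>(1 - x l)\<^sup>2 / 2\<close>, so both
    coordinates are treated at once.\<close>
  define l where "l = 3 - k"
  have "k = 1 \<or> k = 2" using k n by auto
  then have kl: "{1..<n} = {k, l}" "k \<noteq> l" using n by (auto simp: l_def)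
  have "(LINT s:std_simplex n|(\<Pi>\<^sub>M k\<in>{1..<n}. lborel). s k) =
      (LINT s|(\<Pi>\<^sub>M k\<in>insert k {l}. lborel). indicator (std_simplex n) s *\<^sub>R s k)"
    by (simp add: set_lebesgue_integral_def kl)
  also have "\<dots> = (LINT x|(\<Pi>\<^sub>M k\<in>{l}. lborel). (LBINT y. indicator (std_simplex n) (x(k := y)) *\<^sub>R (x(k := y)) k))"
    using set_integrable_std_simplex_coord[OF k] kl
    by (intro product_integral_insert) (auto simp: set_integrable_def)
  also have "\<dots> = (LINT x|(\<Pi>\<^sub>M k\<in>{l}. lborel). (1 - x l)\<^sup>2 / 2 * indicator {0..1} (x l))"
  proof (intro Bochner_Integration.integral_cong refl)
    fix x assume x: "x \<in> space (\<Pi>\<^sub>M k\<in>{l}. (lborel :: real measure))"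
    have mem: "x(k := y) \<in> std_simplex n \<longleftrightarrow> 0 \<le> x l \<and> 0 \<le> y \<and> y \<le> 1 - x l" for y
      using x kl(2) unfolding std_simplex_def kl by (auto simp: space_PiM PiE_def extensional_def)
    have "(LBINT y. indicator (std_simplex n) (x(k := y)) *\<^sub>R (x(k := y)) k) =
        (LBINT y. (if 0 \<le> x l then 1 else 0) * (y ^ 1 * indicator {0..1 - x l} y))"
      by (intro Bochner_Integration.integral_cong) (auto simp: mem indicator_def)
    also have "\<dots> = (1 - x l)\<^sup>2 / 2 * indicator {0..1} (x l)"
    proof (cases "x l \<le> 1")
      case True
      then show ?thesis by (subst integral_mult_right_zero, subst integral_power) (auto simp: indicator_def power2_eq_square)
    qed simp
    finally show "(LBINT y. indicator (std_simplex n) (x(k := y)) *\<^sub>R (x(k := y)) k) = (1 - x l)\<^sup>2 / 2 * indicator {0..1} (x l)" .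
  qed
  also have "\<dots> = (LBINT y. (1 - y)\<^sup>2 / 2 * indicator {0..1} y)"
    by (rule product_integral_singleton[where f="\<lambda>y. (1 - y)\<^sup>2 / 2 * indicator {0..1} y"]) simp
  also have "\<dots> = (LBINT y. y ^ 0 * indicator {0..1} y / 2 - y ^ 1 * indicator {0..1} y + y ^ 2 * indicator {0..1} y / 2)"
    by (intro Bochner_Integration.integral_cong) (auto simp: power2_eq_square field_simps)
  also have "\<dots> = 1 / 2 - 1 / 2 + 1 / 6"
  proof -
    have int: "integrable lborel (\<lambda>y::real. y ^ m * indicator {0..1} y)" for m
    proof -
      have "integrable lborel (\<lambda>y::real. indicator {0..1} y *\<^sub>R y ^ m)"
        by (rule borel_integrable_compact) (auto intro!: continuous_intros)
      then show ?thesis by (simp add: mult.commute)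
    qed
    have val: "(LBINT y. y ^ m * indicator {0..1} y) = 1 / real (Suc m)" for m
      by (subst integral_power) simp_all
    show ?thesis
      using int[of 0] int[of 1] int[of 2] val[of 0] val[of 1] val[of 2]
      by (simp del: power_0 power_one_right)
  qed
  finally show ?thesis using n by (simp add: fact_numeral)
qed

lemma simplex_point_in:
  fixes q :: "nat \<Rightarrow> 'd::finite point"
  assumes s: "s \<in> std_simplex CARD('d)"
  shows "q 1 + (\<Sum>k\<in>{1..<CARD('d)}. s k *\<^sub>R (q (Suc k) - q 1)) \<in> closed_simplex q"
proof -
  let ?I = "{1..<CARD('d)}"
  have s0: "\<And>k. k \<in> ?I \<Longrightarrow> 0 \<le> s k" "sum s ?I \<le> 1" using s by (auto simp: std_simplex_def)
  \<comment> \<open>Barycentric coordinates. The parameter \<open>s k\<close> belongs to the vertex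
    \<open>q (Suc k)\<close>, hence the shift by one, and \<open>q 1\<close> receives the remaining
    weight.\<close>
  define c where "c k = (if k = 1 then 1 - sum s ?I else s (k - 1))" for k
  have split: "sum g {1..CARD('d)} = g 1 + (\<Sum>k\<in>?I. g (Suc k))" for g :: "nat \<Rightarrow> 'b::comm_monoid_add"
    using zero_less_card_finite[where 'a='d] sum.atLeast_Suc_lessThan_Suc_shift[of g 1 "CARD('d)"]
    by (subst sum.atLeast_Suc_atMost) (simp_all add: atLeastLessThanSuc_atLeastAtMost comp_def One_nat_def Suc_le_eq)
  have "(\<Sum>k=1..CARD('d). c k *\<^sub>R q k) = c 1 *\<^sub>R q 1 + (\<Sum>k\<in>?I. c (Suc k) *\<^sub>R q (Suc k))"
    by (rule split)
  also have "\<dots> = (1 - sum s ?I) *\<^sub>R q 1 + (\<Sum>k\<in>?I. s k *\<^sub>R q (Suc k))"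
    by (auto simp: c_def intro!: sum.cong)
  also have "\<dots> = q 1 + (\<Sum>k\<in>?I. s k *\<^sub>R (q (Suc k) - q 1))"
    by (simp add: scaleR_right_diff_distrib sum_subtractf scaleR_left.sum algebra_simps)
  finally have eq: "(\<Sum>k=1..CARD('d). c k *\<^sub>R q k) = q 1 + (\<Sum>k\<in>?I. s k *\<^sub>R (q (Suc k) - q 1))" .
  have "(\<Sum>k=1..CARD('d). c k *\<^sub>R q k) \<in> closed_simplex q"
  proof (rule convex_sum)
    show "convex (closed_simplex q)" by (simp add: closed_simplex_def)
    have "sum c {1..CARD('d)} = c 1 + (\<Sum>k\<in>?I. c (Suc k))"
      by (rule split)
    then show "sum c {1..CARD('d)} = 1" by (simp add: c_def)
    fix k assume k: "k \<in> {1..CARD('d)}"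
    have "k - 1 \<in> ?I" if "k \<noteq> 1"
      using that k unfolding atLeastLessThan_iff atLeastAtMost_iff by arith
    then show "0 \<le> c k" using s0(2) s0(1)[of "k - 1"] by (auto simp: c_def)
    show "q k \<in> closed_simplex q"
      using k verts_subset_closed_simplex[of q] by (auto simp: verts_def)
  qed simp
  then show ?thesis by (simp only: eq)
qed

lemma simplex_integral_const:
  assumes "\<And>x. x \<in> closed_simplex q \<Longrightarrow> f x = c"
  shows "simplex_integral q f = simplex_area (q :: nat \<Rightarrow> 'd::{finite,comm_ring_1} point) * c"
proof -
  have "simplex_integral q f = simplex_integral q (\<lambda>_. c)"
    unfolding simplex_integral_def
    by (intro arg_cong[where f="\<lambda>x. norm (area_vec q) * x"] set_lebesgue_integral_cong)
      (auto simp: sets_std_simplex intro!: assms simplex_point_in)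
  also have "\<dots> = simplex_area q * c"
    using emeasure_std_simplex_PiM[of "CARD('d)"] unfolding simplex_integral_def simplex_area_def
    by (simp add: set_lebesgue_integral_def sets_std_simplex)
  finally show ?thesis .
qed

text \<open>All barycentric coordinates have the same mean \<open>1 / CARD('d)\<close> over the
  simplex. Exactness of the vertex rule for affine functions is what makes both variants of the
  scheme agree when tested with constants.\<close>

lemma simplex_integral_affine:
  fixes q :: "nat \<Rightarrow> 'd::{finite,comm_ring_1} point" and f :: "'d point \<Rightarrow> real"
  assumes dim: "CARD('d) = 2 \<or> CARD('d) = 3" and f: "affine_on (closed_simplex q) f"
  shows "simplex_integral q f = simplex_area q * (\<Sum>k=1..CARD('d). f (q k)) / CARD('d)"
proof -
  let ?I = "{1..<CARD('d)}" and ?M = "\<Pi>\<^sub>M k\<in>{1..<CARD('d)}. (lborel :: real measure)"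
  let ?S = "std_simplex CARD('d)"
  obtain L c where L: "linear L" and fL: "\<And>x. x \<in> closed_simplex q \<Longrightarrow> f x = L x + c"
    using f by (auto simp: affine_on_def)
  have q_in: "q k \<in> closed_simplex q" if "k \<in> {1..CARD('d)}" for k
    using that verts_subset_closed_simplex[of q] by (auto simp: verts_def)
  have 1: "1 \<in> {1..CARD('d)}" using dim by auto
  have val: "f (q 1 + (\<Sum>k\<in>?I. s k *\<^sub>R (q (Suc k) - q 1))) = f (q 1) + (\<Sum>k\<in>?I. s k * (f (q (Suc k)) - f (q 1)))"
    if "s \<in> ?S" for s
  proof -
    have "f (q (Suc k)) - f (q 1) = L (q (Suc k) - q 1)" if "k \<in> ?I" for k
      using that fL[OF q_in[of "Suc k"]] fL[OF q_in[OF 1]] by (simp add: linear_diff[OF L])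
    then show ?thesis
      using fL[OF simplex_point_in[OF that]] fL[OF q_in[OF 1]]
      by (simp add: linear_add[OF L] linear_sum[OF L] linear_scale[OF L])
  qed
  have "simplex_integral q f = norm (area_vec q) *
     (LINT s:?S|?M. f (q 1) + (\<Sum>k\<in>?I. s k * (f (q (Suc k)) - f (q 1))))"
    unfolding simplex_integral_def
    by (intro arg_cong[where f="\<lambda>x. norm (area_vec q) * x"] set_lebesgue_integral_cong)
      (auto simp: sets_std_simplex val)
  also have "(LINT s:?S|?M. f (q 1) + (\<Sum>k\<in>?I. s k * (f (q (Suc k)) - f (q 1)))) =
     (LINT s|?M. indicator ?S s *\<^sub>R f (q 1) + (\<Sum>k\<in>?I. (indicator ?S s *\<^sub>R s k) * (f (q (Suc k)) - f (q 1))))"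
    unfolding set_lebesgue_integral_def
    by (intro Bochner_Integration.integral_cong refl) (simp add: distrib_left sum_distrib_left mult.assoc)
  also have "\<dots> = (LINT s:?S|?M. f (q 1)) + (\<Sum>k\<in>?I. (LINT s:?S|?M. s k) * (f (q (Suc k)) - f (q 1)))"
    using set_integrable_std_simplex_const[of "CARD('d)" "f (q 1)"] set_integrable_std_simplex_coord[of _ "CARD('d)"]
    unfolding set_integrable_def set_lebesgue_integral_def
    by (subst Bochner_Integration.integral_add)
      (auto intro!: Bochner_Integration.integrable_sum integrable_mult_left
        simp: Bochner_Integration.integral_sum)
  also have "\<dots> = (LINT s:?S|?M. f (q 1)) + (\<Sum>k\<in>?I. (1 / fact CARD('d)) * (f (q (Suc k)) - f (q 1)))"
    by (simp add: set_integral_std_simplex_coord[OF dim])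
  also have "(LINT s:?S|?M. f (q 1)) = f (q 1) / fact (CARD('d) - 1)"
    using emeasure_std_simplex_PiM[of "CARD('d)"] measure_std_simplex_PiM[of "CARD('d)"]
    by (simp add: set_lebesgue_integral_def sets_std_simplex)
  finally have "simplex_integral q f = norm (area_vec q) *
      (f (q 1) / fact (CARD('d) - 1) + (\<Sum>k\<in>?I. (1 / fact CARD('d)) * (f (q (Suc k)) - f (q 1))))" .
  also have "\<dots> = simplex_area q * (\<Sum>k=1..CARD('d). f (q k)) / CARD('d)"
    using dim
  proof
    assume d: "CARD('d) = 2"
    show ?thesis by (simp add: simplex_area_eq d numeral_2_eq_2 One_nat_def) (simp add: field_simps)
  next
    assume d: "CARD('d) = 3"
    have "{1..<3::nat} = {1, 2}" "{1..3::nat} = {1, 2, 3}" by auto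
    then show ?thesis by (simp add: simplex_area_eq d fact_numeral) (simp add: field_simps)
  qed
  finally show ?thesis .
qed

end

section \<open>Nodal interpolation and mass lumping\<close>

lemma affine_interpolation_exists:
  fixes f :: "'a::euclidean_space \<Rightarrow> 'b::real_vector"
  assumes "\<not> affine_dependent S"
  shows "\<exists>L c. linear L \<and> (\<forall>p\<in>S. L p + c = f p)"
proof (cases "S = {}")
  case True
  then show ?thesis using linear_zero by auto
next
  case False
  then obtain a where a: "a \<in> S" by blast
  have "independent ((\<lambda>x. - a + x) ` (S - {a}))"
    using assms affine_dependent_iff_dependent2[OF a] by simp
  then obtain L where L: "linear L" "\<forall>x\<in>(\<lambda>x. - a + x) ` (S - {a}). L x = f (x + a) - f a"
    using linear_independent_extend[of _ "\<lambda>x. f (x + a) - f a"] by blast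
  have "L p + (f a - L a) = f p" if "p \<in> S" for p
  proof (cases "p = a")
    case False
    then have "- a + p \<in> (\<lambda>x. - a + x) ` (S - {a})" using that by blast
    then have "L (- a + p) = f p - f a" using L(2) by (metis add.commute add_uminus_conv_diff diff_add_cancel)
    then have "L p - L a = f p - f a" by (simp flip: linear_diff[OF L(1)])
    then show ?thesis by (simp add: algebra_simps)
  qed simp
  then show ?thesis using L(1) by blast
qed

lemma affine_maps_agree_on_hull:
  assumes L: "linear L" "linear L'" and eq: "\<And>p. p \<in> C \<Longrightarrow> L p + c = L' p + c'" and x: "x \<in> convex hull C"
  shows "L x + c = L' x + c'"
proof -
  have "convex {x. L x + c = L' x + c'}"
  proof (rule convexI)
    fix x y and u v :: real
    assume xy: "x \<in> {x. L x + c = L' x + c'}" "y \<in> {x. L x + c = L' x + c'}" and uv: "0 \<le> u" "0 \<le> v" "u + v = 1"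
    have "M (u *\<^sub>R x + v *\<^sub>R y) + d = u *\<^sub>R (M x + d) + v *\<^sub>R (M y + d)" if "linear M" for M d
    proof -
      have "d = (u + v) *\<^sub>R d" using uv by simp
      then show ?thesis
        by (simp add: linear_add[OF that] linear_scale[OF that] algebra_simps flip: scaleR_left_distrib)
    qed
    from this[OF L(1), of c] this[OF L(2), of c'] show "u *\<^sub>R x + v *\<^sub>R y \<in> {x. L x + c = L' x + c'}"
      using xy by simp
  qed
  then have "convex hull C \<subseteq> {x. L x + c = L' x + c'}"
    by (intro hull_minimal) (auto simp: eq)
  then show ?thesis using x by blast
qed

text \<open>\<open>Lim\<close> has the expected value only along a nontrivial filter: the vertex is
  not in the open simplex, being an extreme point of a set with more than one point, but it lies in
  its closure.\<close>

lemma Lim_vertex: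
  fixes q :: "nat \<Rightarrow> 'd::finite point" and g :: "'d point \<Rightarrow> 'b::t2_space"
  assumes nd: "inj_on q {1..CARD('d)}" "\<not> affine_dependent (verts q)" and card: "CARD('d) \<ge> 2"
    and g: "continuous_on (closed_simplex q) g" and k: "k \<in> {1..CARD('d)}"
  shows "Lim (at (q k) within open_simplex q) g = g (q k)"
proof (rule tendsto_Lim)
  have qk: "q k \<in> verts q" using k by (simp add: verts_def)
  then have in_closed: "q k \<in> closed_simplex q" using verts_subset_closed_simplex by blast
  then have "(g \<longlongrightarrow> g (q k)) (at (q k) within closed_simplex q)"
    using g by (simp add: continuous_on_def)
  then show "(g \<longlongrightarrow> g (q k)) (at (q k) within open_simplex q)"
    by (rule tendsto_within_subset[OF _ open_simplex_subset])
  have "q k extreme_point_of closed_simplex q"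
    using qk nd(2) by (simp add: closed_simplex_def extreme_point_of_convex_hull_affine_independent)
  moreover have "closed_simplex q \<noteq> {q k}"
  proof
    assume "closed_simplex q = {q k}"
    then have "verts q \<subseteq> {q k}" using verts_subset_closed_simplex by blast
    then have "card (verts q) \<le> 1" using card_mono[of "{q k}"] by fastforce
    then show False using card_verts[OF nd(1)] card by simp
  qed
  ultimately have "q k \<notin> open_simplex q"
    unfolding open_simplex_def by (rule extreme_point_not_in_REL_INTERIOR)
  moreover have "q k \<in> closure (open_simplex q)"
    using in_closed convex_closure_rel_interior[of "closed_simplex q"] closure_subset[of "closed_simplex q"]
    by (auto simp: open_simplex_def closed_simplex_def)
  ultimately show "\<not> trivial_limit (at (q k) within open_simplex q)"
    by (simp add: trivial_limit_within closure_def)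
qed

lemma lumped_ip_eq:
  fixes q :: "nat \<Rightarrow> nat \<Rightarrow> 'd::{finite,comm_ring_1} point"
  assumes nd: "\<And>j. j \<in> {1..N} \<Longrightarrow> inj_on (q j) {1..CARD('d)} \<and> \<not> affine_dependent (verts (q j))"
    and card: "CARD('d) \<ge> 2"
    and u: "\<And>j. j \<in> {1..N} \<Longrightarrow> continuous_on (closed_simplex (q j)) u"
    and v: "\<And>j. j \<in> {1..N} \<Longrightarrow> continuous_on (closed_simplex (q j)) v"
  shows "lumped_ip N q u v =
    1 / CARD('d) * (\<Sum>j=1..N. simplex_area (q j) * (\<Sum>k=1..CARD('d). u (q j k) \<bullet> v (q j k)))"
proof -
  have "Lim (at (q j k) within open_simplex (q j)) (\<lambda>x. u x \<bullet> v x) = u (q j k) \<bullet> v (q j k)"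
    if "j \<in> {1..N}" "k \<in> {1..CARD('d)}" for j k
    using Lim_vertex[of "q j" "\<lambda>x. u x \<bullet> v x" k] nd[OF that(1)] card u[OF that(1)] v[OF that(1)] that(2)
    by (auto intro: continuous_on_inner)
  then show ?thesis unfolding lumped_ip_def by simp
qed

lemma surf_space_continuous:
  "v \<in> surf_space N q \<Longrightarrow> j \<in> {1..N} \<Longrightarrow> continuous_on (closed_simplex (q j)) v"
  unfolding surf_space_def surface_def
  by (rule continuous_on_subset[where s="\<Union>j\<in>{1..N}. closed_simplex (q j)"]) blast+

lemma surf_space_affine: "v \<in> surf_space N q \<Longrightarrow> j \<in> {1..N} \<Longrightarrow> affine_on (closed_simplex (q j)) v"
  unfolding surf_space_def by auto

context phase_cluster
begin

text \<open>On each simplex affine independence provides an affine map with the given vertex values.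
  Two such maps agree where simplices overlap, because the overlap is the hull of common vertices,
  so the pieces glue to a continuous function on a finite closed cover.\<close>

lemma interpolation_exists:
  fixes f :: "'d point \<Rightarrow> 'b::euclidean_space"
  assumes i: "i \<in> {1..IS}"
  shows "\<exists>v\<in>surf_space (J i) (q i). \<forall>j\<in>{1..J i}. \<forall>p\<in>verts (q i j). v p = f p"
proof -
  have "\<exists>w. linear (fst w) \<and> (\<forall>p\<in>verts (q i j). fst w p + snd w = f p)" if "j \<in> {1..J i}" for j
    using affine_interpolation_exists[of "verts (q i j)" f] nondegenerate[OF i that] by auto
  then have "\<forall>j\<in>{1..J i}. \<exists>w. linear (fst w) \<and> (\<forall>p\<in>verts (q i j). fst w p + snd w = f p)" by blast
  from bchoice[OF this] obtain w where
    w: "\<forall>j\<in>{1..J i}. linear (fst (w j)) \<and> (\<forall>p\<in>verts (q i j). fst (w j) p + snd (w j) = f p)" ..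
  define A where "A j x = fst (w j) x + snd (w j)" for j x
  have agree: "A j x = A j' x"
    if j: "j \<in> {1..J i}" "j' \<in> {1..J i}" and x: "x \<in> closed_simplex (q i j)" "x \<in> closed_simplex (q i j')" for j j' x
  proof -
    let ?T = "closed_simplex (q i j)" and ?T' = "closed_simplex (q i j')"
    have f: "(i, j) \<in> faces" "(i, j') \<in> faces" using i j by (auto simp: faces_def)
    have "?T \<inter> ?T' face_of ?T" "?T' \<inter> ?T face_of ?T'"
      using sx_inter_face_of[OF f] sx_inter_face_of[OF f(2,1)] by (simp_all add: sx_def)
    then have "\<exists>C\<subseteq>verts (q i j). ?T \<inter> ?T' = convex hull C" "\<exists>C\<subseteq>verts (q i j'). ?T' \<inter> ?T = convex hull C"
      using face_of_convex_hull_affine_independent[of "verts (q i j)"] nondegenerate[OF i j(1)]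
        face_of_convex_hull_affine_independent[of "verts (q i j')"] nondegenerate[OF i j(2)]
      unfolding closed_simplex_def by simp_all
    then obtain C C' where C: "C \<subseteq> verts (q i j)" "?T \<inter> ?T' = convex hull C"
      and C': "C' \<subseteq> verts (q i j')" "?T' \<inter> ?T = convex hull C'"
      by (elim exE conjE)
    have "C \<subseteq> verts (q i j')"
    proof
      fix p assume p: "p \<in> C"
      have "\<not> affine_dependent C" using C(1) nondegenerate[OF i j(1)] affine_dependent_subset by blast
      then have "p extreme_point_of (?T' \<inter> ?T)"
        using p C(2) extreme_point_of_convex_hull_affine_independent[of C p] by (simp add: Int_commute)
      then have "p \<in> C'" unfolding C'(2) by (rule extreme_point_of_convex_hull)
      then show "p \<in> verts (q i j')" using C'(1) by blast
    qed
    then have eq: "fst (w j) p + snd (w j) = fst (w j') p + snd (w j')" if "p \<in> C" for p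
    proof -
      have "p \<in> verts (q i j)" "p \<in> verts (q i j')" using C(1) \<open>C \<subseteq> verts (q i j')\<close> that by blast+
      then show ?thesis using bspec[OF w j(1)] bspec[OF w j(2)] by simp
    qed
    have "x \<in> convex hull C" using x C(2) by blast
    show ?thesis
      unfolding A_def
    proof (rule affine_maps_agree_on_hull[where L="fst (w j)" and L'="fst (w j')" and C=C])
      show "linear (fst (w j))" "linear (fst (w j'))" using w j by auto
      show "x \<in> convex hull C" by fact
    qed (rule eq)
  qed
  define v where "v x = A (SOME j. j \<in> {1..J i} \<and> x \<in> closed_simplex (q i j)) x" for x
  have vA: "v x = A j x" if "j \<in> {1..J i}" "x \<in> closed_simplex (q i j)" for j x
  proof -
    have "(SOME j. j \<in> {1..J i} \<and> x \<in> closed_simplex (q i j)) \<in> {1..J i} \<and>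
        x \<in> closed_simplex (q i (SOME j. j \<in> {1..J i} \<and> x \<in> closed_simplex (q i j)))"
      by (rule someI[of _ j]) (use that in blast)
    then show ?thesis unfolding v_def by (intro agree) (use that in blast)+
  qed
  show ?thesis
  proof (intro bexI ballI)
    fix j p assume j: "j \<in> {1..J i}" and p: "p \<in> verts (q i j)"
    have "v p = A j p" using p verts_subset_closed_simplex by (intro vA[OF j]) blast
    also have "\<dots> = f p" unfolding A_def using w j p by blast
    finally show "v p = f p" .
  next
    have "continuous_on (surface (J i) (q i)) v"
      unfolding surface_def
    proof (rule continuous_on_closed_Union)
      fix j assume j: "j \<in> {1..J i}"
      have "bounded_linear (fst (w j))" using w j by (simp add: linear_conv_bounded_linear)
      then have "continuous_on (closed_simplex (q i j)) (A j)"
        unfolding A_def by (intro continuous_intros linear_continuous_on)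
      then show "continuous_on (closed_simplex (q i j)) v"
        by (rule continuous_on_cong[THEN iffD1, rotated -1]) (simp_all add: vA[OF j])
    qed (auto intro: compact_imp_closed compact_closed_simplex)
    moreover have "affine_on (closed_simplex (q i j)) v" if "j \<in> {1..J i}" for j
      unfolding affine_on_def
    proof (intro exI conjI ballI)
      show "linear (fst (w j))" using w that by blast
      show "v x = fst (w j) x + snd (w j)" if "x \<in> closed_simplex (q i j)" for x
        using vA[OF \<open>j \<in> {1..J i}\<close> that] by (simp add: A_def)
    qed
    ultimately show "v \<in> surf_space (J i) (q i)" by (simp add: surf_space_def)
  qed
qed

lemma nodal_interpolation:
  assumes "i \<in> {1..IS}"
  shows "nodal_interpolation (J i) (q i) f \<in> surf_space (J i) (q i)"
    "\<And>j p. j \<in> {1..J i} \<Longrightarrow> p \<in> verts (q i j) \<Longrightarrow> nodal_interpolation (J i) (q i) f p = f p"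
proof -
  have "\<exists>v. v \<in> surf_space (J i) (q i) \<and> (\<forall>j\<in>{1..J i}. \<forall>p\<in>verts (q i j). v p = f p)"
    using interpolation_exists[OF assms, of f] by blast
  from someI_ex[OF this] show "nodal_interpolation (J i) (q i) f \<in> surf_space (J i) (q i)"
    "\<And>j p. j \<in> {1..J i} \<Longrightarrow> p \<in> verts (q i j) \<Longrightarrow> nodal_interpolation (J i) (q i) f p = f p"
    unfolding nodal_interpolation_def by blast+
qed

end

section \<open>Surface gradients and the decrease of area\<close>

text \<open>The definite description needs uniqueness. Derivatives along segments from
  \<open>x\<close> to points of \<open>S\<close> show that two candidates differ by a vector
  orthogonal to all differences of points of \<open>S\<close>; being itself in their span, it is
  0.\<close>

lemma surf_grad_eq:
  fixes S :: "'d::finite point set"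
  assumes S: "convex S" "x \<in> S" and g: "g \<in> span {y - z | y z. y \<in> S \<and> z \<in> S}"
    and f: "\<And>y. y \<in> S \<Longrightarrow> f y = f x + g \<bullet> (y - x)"
  shows "surf_grad S f x = g"
  unfolding surf_grad_def
proof (rule the_equality)
  have "((\<lambda>y. f x + g \<bullet> (y - x)) has_derivative (\<lambda>h. g \<bullet> h)) (at x within S)"
    by (auto intro!: derivative_eq_intros)
  moreover have "f y = (\<lambda>y. f x + g \<bullet> (y - x)) y" if "y \<in> S" for y
    using f[OF that] by simp
  ultimately have "(f has_derivative (\<lambda>h. g \<bullet> h)) (at x within S)"
    using has_derivative_transform[OF S(2), of f "\<lambda>y. f x + g \<bullet> (y - x)"] by blast
  then show "g \<in> span {y - z | y z. y \<in> S \<and> z \<in> S} \<and> (f has_derivative (\<lambda>h. g \<bullet> h)) (at x within S)"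
    using g by simp
next
  fix g'
  assume g': "g' \<in> span {y - z | y z. y \<in> S \<and> z \<in> S} \<and> (f has_derivative (\<lambda>h. g' \<bullet> h)) (at x within S)"
  have eq: "(g' - g) \<bullet> (y - x) = 0" if y: "y \<in> S" for y
  proof -
    define l where "l t = x + t *\<^sub>R (y - x)" for t :: real
    have lS: "l t \<in> S" if "t \<in> {0..1}" for t
    proof -
      have "l t = (1 - t) *\<^sub>R x + t *\<^sub>R y" by (simp add: l_def algebra_simps)
      then show ?thesis using S y that by (simp add: convexD)
    qed
    have l0: "l 0 = x" by (simp add: l_def)
    have dl: "(l has_derivative (\<lambda>t. t *\<^sub>R (y - x))) (at 0 within {0..1})"
      unfolding l_def by (auto intro!: derivative_eq_intros)
    have "((\<lambda>t. f (l t)) has_derivative (\<lambda>t. g' \<bullet> (t *\<^sub>R (y - x)))) (at 0 within {0..1})"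
    proof (rule has_derivative_in_compose[OF dl])
      show "(f has_derivative (\<lambda>h. g' \<bullet> h)) (at (l 0) within l ` {0..1})"
        unfolding l0 by (rule has_derivative_subset[OF conjunct2[OF g']]) (use lS in blast)
    qed
    then have 1: "((\<lambda>t. f (l t)) has_vector_derivative g' \<bullet> (y - x)) (at 0 within {0..1})"
      by (simp add: has_vector_derivative_def)
    have "((\<lambda>t. f x + t * (g \<bullet> (y - x))) has_vector_derivative g \<bullet> (y - x)) (at 0 within {0..1})"
      by (auto intro!: derivative_eq_intros simp: has_vector_derivative_def)
    then have 2: "((\<lambda>t. f (l t)) has_vector_derivative g \<bullet> (y - x)) (at 0 within {0..1})"
      by (rule has_vector_derivative_transform[rotated -1]) (use f[OF lS] in \<open>auto simp: l_def\<close>)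
    have "at (0::real) within {0..1} \<noteq> bot"
      by (simp add: trivial_limit_within islimpt_Icc)
    then have "g' \<bullet> (y - x) = g \<bullet> (y - x)"
      using 1 2 by (rule vector_derivative_unique_within)
    then show ?thesis by (simp add: inner_diff_left)
  qed
  have orth: "orthogonal (g' - g) w" if "w \<in> {y - z | y z. y \<in> S \<and> z \<in> S}" for w
  proof -
    obtain y z where w: "w = y - z" "y \<in> S" "z \<in> S" using \<open>w \<in> _\<close> by blast
    have "(g' - g) \<bullet> (y - z) = (g' - g) \<bullet> (y - x) - (g' - g) \<bullet> (z - x)"
      by (simp add: inner_diff_right)
    then show ?thesis using eq w by (simp add: orthogonal_def)
  qed
  have "g' - g \<in> span {y - z | y z. y \<in> S \<and> z \<in> S}"
    using g g' by (simp add: span_diff)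
  then have "orthogonal (g' - g) (g' - g)"
    using orth by (rule orthogonal_to_span)
  then show "g' = g" by (simp add: orthogonal_def)
qed

text \<open>
  An orthogonal basis of the tangent space of a simplex; in the case \<open>d = 2\<close> of a segment the
  second vector is \<open>0\<close>.
\<close>

lemma orthogonal_tangents_exist:
  fixes q :: "nat \<Rightarrow> 'd::{finite,comm_ring_1} point"
  assumes dim: "CARD('d) = 2 \<or> CARD('d) = 3"
    and nd: "inj_on q {1..CARD('d)}" "\<not> affine_dependent (verts q)"
  obtains a b c where "a = q 2 - q 1" "a \<noteq> 0" "a \<bullet> b = 0"
    "CARD('d) = 2 \<longrightarrow> b = 0" "CARD('d) = 3 \<longrightarrow> b \<noteq> 0 \<and> b = q 3 - q 1 - c *\<^sub>R a"
    "\<forall>y\<in>closed_simplex q. y - q 1 \<in> span {a, b}"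
    "a \<in> span {y - z | y z. y \<in> closed_simplex q \<and> z \<in> closed_simplex q}"
    "b \<in> span {y - z | y z. y \<in> closed_simplex q \<and> z \<in> closed_simplex q}"
proof -
  define a where "a = q 2 - q 1"
  \<comment> \<open>The Gram-Schmidt coefficient that makes the second tangent orthogonal to the
    first.\<close>
  define c where "c = (if CARD('d) = 2 then 0 else (a \<bullet> (q 3 - q 1)) / (a \<bullet> a))"
  define b where "b = (if CARD('d) = 2 then 0 else q 3 - q 1 - c *\<^sub>R a)"
  have q_in: "q k \<in> closed_simplex q" if "k \<in> {1..CARD('d)}" for k
    using that verts_subset_closed_simplex[of q] by (auto simp: verts_def)
  have "q 2 \<noteq> q 1" using inj_onD[OF nd(1), of 2 1] dim by auto
  then have a0: "a \<noteq> 0" by (simp add: a_def)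
  have ab: "a \<bullet> b = 0" using a0 by (simp add: b_def c_def inner_diff_right)
  have b0: "b \<noteq> 0 \<and> b = q 3 - q 1 - c *\<^sub>R a" if d: "CARD('d) = 3"
  proof -
    have "b = q 3 - q 1 - c *\<^sub>R a" using d by (simp add: b_def)
    moreover have "b \<noteq> 0"
    proof
      assume "b = 0"
      then have "q 3 - q 1 = c *\<^sub>R a" using d by (simp add: b_def)
      then have "area_vec q = cross a (c *\<^sub>R a)"
        by (simp only: area_vec_dim3[OF d] a_def)
      then have "area_vec q = 0"
        by (simp add: d dim3_simps)
      then show False using area_vec_nonzero[OF dim nd] by simp
    qed
    ultimately show ?thesis by simp
  qed
  have vert_span: "p - q 1 \<in> span {a, b}" if "p \<in> verts q" for p
    using dim
  proof
    assume d: "CARD('d) = 2"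
    then have "p = q 1 \<or> p = q 2" using that by (auto simp: verts_dim2)
    moreover have "q 2 - q 1 \<in> span {a, b}" unfolding a_def[symmetric] by (simp add: span_base)
    ultimately show ?thesis by (elim disjE) (simp_all add: span_zero)
  next
    assume d: "CARD('d) = 3"
    then have "p = q 1 \<or> p = q 2 \<or> p = q 3" using that by (auto simp: verts_dim3)
    moreover have "b + c *\<^sub>R a \<in> span {a, b}" by (intro span_add span_scale span_base) auto
    then have "q 3 - q 1 \<in> span {a, b}" using b0[OF d] by simp
    moreover have "q 2 - q 1 \<in> span {a, b}" unfolding a_def[symmetric] by (simp add: span_base)
    ultimately show ?thesis by (elim disjE) (simp_all add: span_zero)
  qed
  have y_span: "y - q 1 \<in> span {a, b}" if "y \<in> closed_simplex q" for y
  proof -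
    have "convex {y. y - q 1 \<in> span {a, b}}"
    proof (rule convexI)
      fix x y and u v :: real
      assume xy: "x \<in> {y. y - q 1 \<in> span {a, b}}" "y \<in> {y. y - q 1 \<in> span {a, b}}" and uv: "u + v = 1"
      have "u *\<^sub>R x + v *\<^sub>R y - q 1 = u *\<^sub>R x + v *\<^sub>R y - (u + v) *\<^sub>R q 1" using uv by simp
      also have "\<dots> = u *\<^sub>R (x - q 1) + v *\<^sub>R (y - q 1)" by (simp add: algebra_simps)
      finally show "u *\<^sub>R x + v *\<^sub>R y \<in> {y. y - q 1 \<in> span {a, b}}"
        using xy by (simp add: span_add span_scale)
    qed
    then have "closed_simplex q \<subseteq> {y. y - q 1 \<in> span {a, b}}"
      unfolding closed_simplex_def using vert_span by (intro hull_minimal) auto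
    then show ?thesis using that by blast
  qed
  let ?V = "{y - z | y z. y \<in> closed_simplex q \<and> z \<in> closed_simplex q}"
  have mem: "y - z \<in> span ?V" if "y \<in> closed_simplex q" "z \<in> closed_simplex q" for y z
    by (rule span_base) (use that in blast)
  have aV: "a \<in> span ?V"
    unfolding a_def using dim by (intro mem q_in) auto
  have bV: "b \<in> span ?V"
    using dim
  proof
    assume d: "CARD('d) = 3"
    have "q 3 - q 1 \<in> span ?V" using d by (intro mem q_in) auto
    then show ?thesis using aV b0[OF d] by (simp add: span_diff span_scale)
  qed (simp add: b_def span_zero)
  show thesis
    by (rule that[of a b c]) (use a0 ab b0 y_span aV bV in \<open>auto simp: a_def b_def\<close>)
qed

text \<open>Lagrange's identity.\<close>

lemma norm_cross_orthogonal:
  assumes d: "CARD('d::{finite,comm_ring_1}) = 3"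
  shows "(norm (cross a b))\<^sup>2 + (a \<bullet> b)\<^sup>2 = (norm a)\<^sup>2 * (norm (b :: 'd point))\<^sup>2"
  unfolding power2_norm_eq_inner by (simp add: d dim3_simps power2_eq_square) (simp add: algebra_simps)

text \<open>Let \<open>r\<close> and \<open>s\<close> be the factors by which the linear part of
  \<open>X\<close> stretches two orthogonal tangents. The area grows at most by the factor
  \<open>r * s\<close> (just \<open>r\<close> for segments), and twice the difference of
  \<open>1 + (r\<^sup>2 - r) + (s\<^sup>2 - s)\<close> and \<open>r * s\<close> is a sum of three
  squares. By Cauchy-Schwarz \<open>r\<^sup>2 - r\<close> and \<open>s\<^sup>2 - s\<close> are
  bounded by the contributions of the two tangents to the gradient term.\<close>

lemma area_decrease:
  fixes q :: "nat \<Rightarrow> 'd::{finite,comm_ring_1} point"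
  assumes dim: "CARD('d) = 2 \<or> CARD('d) = 3"
    and nd: "inj_on q {1..CARD('d)}" "\<not> affine_dependent (verts q)"
    and X: "affine_on (closed_simplex q) X" and \<tau>: "\<tau> > 0"
  shows "simplex_area (\<lambda>k. X (q k)) - simplex_area q \<le>
    \<tau> * simplex_integral q (\<lambda>x. \<Sum>k\<in>UNIV. surf_grad (closed_simplex q) (\<lambda>y. X y $ k) x \<bullet>
      surf_grad (closed_simplex q) (\<lambda>y. ((X y - y) /\<^sub>R \<tau>) $ k) x)"
proof -
  let ?S = "closed_simplex q"
  obtain a b c where ab: "a = q 2 - q 1" "a \<noteq> 0" "a \<bullet> b = 0"
    and b: "CARD('d) = 2 \<longrightarrow> b = 0" "CARD('d) = 3 \<longrightarrow> b \<noteq> 0 \<and> b = q 3 - q 1 - c *\<^sub>R a"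
    and sp: "\<forall>y\<in>?S. y - q 1 \<in> span {a, b}"
    and in_span: "a \<in> span {y - z | y z. y \<in> ?S \<and> z \<in> ?S}" "b \<in> span {y - z | y z. y \<in> ?S \<and> z \<in> ?S}"
    by (rule orthogonal_tangents_exist[OF dim nd])
  have ba: "b \<bullet> a = 0" using ab(3) by (simp add: inner_commute)
  obtain L e where L: "linear L" and XL: "\<And>x. x \<in> ?S \<Longrightarrow> X x = L x + e"
    using X by (auto simp: affine_on_def)
  \<comment> \<open>The gradient of the \<open>k\<close>-th component expanded in the orthogonal
    tangents. For a segment \<open>b = 0\<close> and the second term vanishes.\<close>
  define G where "G M k = ((M a $ k) / (a \<bullet> a)) *\<^sub>R a + ((M b $ k) / (b \<bullet> b)) *\<^sub>R b" for M :: "'d point \<Rightarrow> 'd point" and k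
  have grad: "surf_grad ?S (\<lambda>y. Y y $ k) x = G M k"
    if M: "linear M" and Y: "\<And>y. y \<in> ?S \<Longrightarrow> Y y = M y + v" and x: "x \<in> ?S" for M Y v k x
  proof (rule surf_grad_eq[OF _ x])
    show "convex ?S" by (simp add: closed_simplex_def)
    show "G M k \<in> span {y - z | y z. y \<in> ?S \<and> z \<in> ?S}"
      unfolding G_def by (intro span_add span_scale in_span)
    fix y assume y: "y \<in> ?S"
    have "(y - q 1) - (x - q 1) \<in> span {a, b}" using bspec[OF sp y] bspec[OF sp x] by (rule span_diff)
    then have "y - x \<in> span {a, b}" by simp
    then obtain r s where h: "y - x = r *\<^sub>R a + s *\<^sub>R b"
      by (auto simp: span_insert span_singleton algebra_simps)
    have "G M k \<bullet> (y - x) = r * (M a $ k) + s * (M b $ k)"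
    proof (cases "b = 0")
      case True
      then show ?thesis using ab(2,3) by (simp add: G_def h inner_add_left inner_add_right linear_0[OF M])
    next
      case False
      then show ?thesis using ab(2,3) ba
        by (simp add: G_def h inner_add_left inner_add_right)
    qed
    also have "\<dots> = M (y - x) $ k"
      by (simp add: h linear_add[OF M] linear_scale[OF M])
    also have "\<dots> = Y y $ k - Y x $ k"
      by (simp add: Y[OF y] Y[OF x] linear_diff[OF M])
    finally show "Y y $ k = Y x $ k + G M k \<bullet> (y - x)" by simp
  qed
  define M where "M x = (L x - x) /\<^sub>R \<tau>" for x
  have M: "linear M"
    unfolding M_def by (rule linearI) (simp_all add: linear_add[OF L] linear_scale[OF L] algebra_simps)
  have gX: "surf_grad ?S (\<lambda>y. X y $ k) x = G L k" if "x \<in> ?S" for k x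
    by (rule grad[OF L XL that])
  have gM: "surf_grad ?S (\<lambda>y. ((X y - y) /\<^sub>R \<tau>) $ k) x = G M k" if "x \<in> ?S" for k x
    by (rule grad[OF M, where v="e /\<^sub>R \<tau>"]) (use that XL in \<open>auto simp: M_def algebra_simps\<close>)
  have GG: "(\<Sum>k\<in>UNIV. G L k \<bullet> G M k) = (L a \<bullet> M a) / (a \<bullet> a) + (L b \<bullet> M b) / (b \<bullet> b)"
  proof -
    have "G L k \<bullet> G M k = (L a $ k * M a $ k) / (a \<bullet> a) + (L b $ k * M b $ k) / (b \<bullet> b)" for k
      using ab(2,3) ba by (cases "b = 0") (simp_all add: G_def inner_add_left inner_add_right divide_simps)
    then show ?thesis
      by (simp add: sum.distrib inner_vec_def[of "L a"] inner_vec_def[of "L b"] flip: sum_divide_distrib)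
  qed
  define r where "r = norm (L a) / norm a"
  \<comment> \<open>For a segment this is a division by 0, so \<open>s = 0\<close> and
    \<open>s\<^sup>2 - s\<close> contributes nothing.\<close>
  define s where "s = norm (L b) / norm b"
  have quot: "(u\<^sup>2 - u) \<le> \<tau> * ((L w \<bullet> M w) / (w \<bullet> w))" if "u = norm (L w) / norm w" for u w
  proof (cases "w = 0")
    case False
    have "L w \<bullet> w \<le> norm (L w) * norm w" by (rule norm_cauchy_schwarz)
    moreover have "\<tau> * (L w \<bullet> M w) = (norm (L w))\<^sup>2 - L w \<bullet> w"
      using \<tau> by (simp add: M_def inner_diff_right power2_norm_eq_inner flip: mult.assoc)
    ultimately have "(norm (L w))\<^sup>2 - norm (L w) * norm w \<le> \<tau> * (L w \<bullet> M w)"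
      by simp
    then have "((norm (L w))\<^sup>2 - norm (L w) * norm w) / (norm w)\<^sup>2 \<le> \<tau> * (L w \<bullet> M w) / (norm w)\<^sup>2"
      by (rule divide_right_mono) simp
    moreover have "u\<^sup>2 - u = ((norm (L w))\<^sup>2 - norm (L w) * norm w) / (norm w)\<^sup>2"
      using False by (simp add: that power2_eq_square field_simps)
    ultimately show ?thesis by (simp add: power2_norm_eq_inner)
  qed (simp add: that)
  have area: "norm (area_vec (\<lambda>k. X (q k))) \<le> norm (area_vec q) * (1 + (r\<^sup>2 - r) + (s\<^sup>2 - s))"
  proof -
    have q_in: "q k \<in> ?S" if "k \<in> {1..CARD('d)}" for k
      using that verts_subset_closed_simplex[of q] by (auto simp: verts_def)
    have La: "X (q 2) - X (q 1) = L a"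
      using q_in[of 1] q_in[of 2] dim by (auto simp: XL ab(1) linear_diff[OF L])
    have rs0: "r \<ge> 0" "s \<ge> 0" by (simp_all add: r_def s_def)
    from dim show ?thesis
    proof
      assume d: "CARD('d) = 2"
      have np: "norm (perp v) = norm v" for v :: "'d point"
        by (simp add: norm_eq_sqrt_inner d dim2_simps add.commute)
      have "norm (L a) = norm a * r" using ab(2) by (simp add: r_def)
      moreover have "s = 0" using mp[OF b(1) d] by (simp add: s_def)
      moreover have "r \<le> 1 + (r\<^sup>2 - r)"
        using sum_squares_ge_zero[of "r - 1" 0] by (simp add: power2_eq_square algebra_simps)
      then have "norm a * r \<le> norm a * (1 + (r\<^sup>2 - r))" by (intro mult_left_mono) auto
      ultimately show ?thesis
        unfolding area_vec_dim2[OF d] np La ab(1)[symmetric] by simp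
    next
      assume d: "CARD('d) = 3"
      note b = mp[OF b(2) d]
      have Lb: "X (q 3) - X (q 1) = L b + c *\<^sub>R L a"
        using q_in[of 1] q_in[of 3] d b
        by (simp add: XL linear_diff[OF L] linear_scale[OF L])
      have bb: "q 3 - q 1 = b + c *\<^sub>R a" using b by simp
      \<comment> \<open>Passing from the edges to the orthogonal tangents is a shear, which leaves
        area vectors unchanged. By linearity the image triangle undergoes the same shear.\<close>
      have shear: "cross v (w + c *\<^sub>R v) = cross v w" for v w :: "'d point"
        by (simp add: d dim3_simps) (simp add: algebra_simps)
      have "(norm (cross a b))\<^sup>2 = (norm a * norm b)\<^sup>2"
        using norm_cross_orthogonal[OF d, of a b] ab(3) by (simp add: power_mult_distrib)
      then have 1: "norm (cross a b) = norm a * norm b"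
        by (simp add: power2_eq_iff_nonneg)
      have "(norm (cross (L a) (L b)))\<^sup>2 \<le> (norm (L a) * norm (L b))\<^sup>2"
        using norm_cross_orthogonal[OF d, of "L a" "L b"] zero_le_power2[of "L a \<bullet> L b"]
        unfolding power_mult_distrib by linarith
      then have "norm (cross (L a) (L b)) \<le> norm (L a) * norm (L b)"
        by (rule power2_le_imp_le) simp
      also have "\<dots> = norm a * norm b * (r * s)"
        using ab(2) conjunct1[OF b] by (simp add: r_def s_def)
      also have "\<dots> \<le> norm a * norm b * (1 + (r\<^sup>2 - r) + (s\<^sup>2 - s))"
      proof (rule mult_left_mono)
        have "0 \<le> (r - s)\<^sup>2 + (r - 1)\<^sup>2 + (s - 1)\<^sup>2" by simp
        then show "r * s \<le> 1 + (r\<^sup>2 - r) + (s\<^sup>2 - s)" by (simp add: power2_eq_square algebra_simps)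
      qed simp
      finally show ?thesis
        unfolding area_vec_dim3[OF d] La Lb bb ab(1)[symmetric] shear 1 by simp
    qed
  qed
  have "simplex_integral q (\<lambda>x. \<Sum>k\<in>UNIV. surf_grad ?S (\<lambda>y. X y $ k) x \<bullet>
      surf_grad ?S (\<lambda>y. ((X y - y) /\<^sub>R \<tau>) $ k) x) = simplex_area q * (\<Sum>k\<in>UNIV. G L k \<bullet> G M k)"
    by (rule simplex_integral_const) (simp only: gX gM)
  also have "\<tau> * \<dots> = simplex_area q * (\<tau> * ((L a \<bullet> M a) / (a \<bullet> a)) + \<tau> * ((L b \<bullet> M b) / (b \<bullet> b)))"
    unfolding GG by (simp add: algebra_simps)
  also have "\<dots> \<ge> simplex_area q * ((r\<^sup>2 - r) + (s\<^sup>2 - s))"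
    using quot[OF r_def] quot[OF s_def] by (intro mult_left_mono add_mono) (auto simp: simplex_area_eq)
  finally have "simplex_area q * ((r\<^sup>2 - r) + (s\<^sup>2 - s)) \<le> \<tau> * simplex_integral q (\<lambda>x. \<Sum>k\<in>UNIV.
      surf_grad ?S (\<lambda>y. X y $ k) x \<bullet> surf_grad ?S (\<lambda>y. ((X y - y) /\<^sub>R \<tau>) $ k) x)" .
  moreover have "simplex_area (\<lambda>k. X (q k)) \<le> simplex_area q * (1 + (r\<^sup>2 - r) + (s\<^sup>2 - s))"
    using divide_right_mono[OF area, of "fact (CARD('d) - 1)"] by (simp add: simplex_area_eq)
  ultimately show ?thesis by (simp add: algebra_simps)
qed

section \<open>The scheme\<close>

context phase_cluster
begin

lemma two_le_dim: "2 \<le> CARD('d)"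
  using dim by auto

lemma lumped_ip_surface:
  assumes i: "i \<in> {1..IS}"
    and u: "\<And>j. j \<in> {1..J i} \<Longrightarrow> continuous_on (closed_simplex (q i j)) u"
    and v: "\<And>j. j \<in> {1..J i} \<Longrightarrow> continuous_on (closed_simplex (q i j)) v"
  shows "lumped_ip (J i) (q i) u v =
    1 / CARD('d) * (\<Sum>j=1..J i. simplex_area (q i j) * (\<Sum>k=1..CARD('d). u (q i j k) \<bullet> v (q i j k)))"
  using nondegenerate[OF i] two_le_dim u v by (rule lumped_ip_eq)

lemma vertex_in: "k \<in> {1..CARD('d)} \<Longrightarrow> q i j k \<in> verts (q i j)"
  by (simp add: verts_def)

text \<open>Mass lumping sees only vertex values, and there the interpolant equals the product. This
  identifies the curvature term of (b), tested with the interpolated normal velocity, with that of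
  (c), tested with the velocity.\<close>

lemma lumped_ip_nodal_interpolation:
  assumes i: "i \<in> {1..IS}" and u: "u \<in> surf_space (J i) (q i)" and \<kappa>: "\<kappa> \<in> surf_space (J i) (q i)"
    and \<omega>: "\<omega> \<in> surf_space (J i) (q i)"
  shows "lumped_ip (J i) (q i) \<kappa> (nodal_interpolation (J i) (q i) (\<lambda>x. u x \<bullet> \<omega> x)) =
    lumped_ip (J i) (q i) (\<lambda>x. \<kappa> x *\<^sub>R \<omega> x) u"
proof -
  let ?\<pi> = "nodal_interpolation (J i) (q i) (\<lambda>x. u x \<bullet> \<omega> x)"
  have "lumped_ip (J i) (q i) \<kappa> ?\<pi> =
    1 / CARD('d) * (\<Sum>j=1..J i. simplex_area (q i j) * (\<Sum>k=1..CARD('d). \<kappa> (q i j k) \<bullet> ?\<pi> (q i j k)))"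
    by (intro lumped_ip_surface i surf_space_continuous[OF \<kappa>] surf_space_continuous[OF nodal_interpolation(1)[OF i]])
  also have "\<dots> = 1 / CARD('d) * (\<Sum>j=1..J i. simplex_area (q i j) *
      (\<Sum>k=1..CARD('d). (\<kappa> (q i j k) *\<^sub>R \<omega> (q i j k)) \<bullet> u (q i j k)))"
    using nodal_interpolation(2)[OF i _ vertex_in]
    by (intro arg_cong2[where f="(*)"] sum.cong refl) (simp add: inner_commute)
  also have "\<dots> = lumped_ip (J i) (q i) (\<lambda>x. \<kappa> x *\<^sub>R \<omega> x) u"
    by (intro lumped_ip_surface[symmetric] i continuous_on_scaleR surf_space_continuous[OF \<kappa>]
        surf_space_continuous[OF \<omega>] surf_space_continuous[OF u])
  finally show ?thesis .
qed

text \<open>The interpolant is affine on each simplex, so against the constant 1 exact integration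
  reduces to the vertex rule too. Either variant thus leads to the product that defines
  \<open>\<omega>\<close>.\<close>

lemma variant_ip_nodal_interpolation_one:
  assumes i: "i \<in> {1..IS}" and u: "u \<in> surf_space (J i) (q i)" and \<omega>: "\<omega> \<in> surf_space (J i) (q i)"
  shows "variant_ip lumped (J i) (q i) (nodal_interpolation (J i) (q i) (\<lambda>x. u x \<bullet> \<omega> x)) (\<lambda>_. 1) =
    lumped_ip (J i) (q i) \<omega> u"
proof -
  let ?\<pi> = "nodal_interpolation (J i) (q i) (\<lambda>x. u x \<bullet> \<omega> x)"
  note \<pi> = nodal_interpolation(1)[OF i, where f="\<lambda>x. u x \<bullet> \<omega> x"]
  note \<pi>_vertex = nodal_interpolation(2)[OF i _ vertex_in, where f="\<lambda>x. u x \<bullet> \<omega> x"]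
  have "exact_ip (J i) (q i) ?\<pi> (\<lambda>_. 1) =
    (\<Sum>j=1..J i. simplex_area (q i j) * (\<Sum>k=1..CARD('d). ?\<pi> (q i j k) \<bullet> 1) / CARD('d))"
    unfolding exact_ip_def by (intro sum.cong refl) (simp add: simplex_integral_affine[OF dim surf_space_affine[OF \<pi>]])
  then have "exact_ip (J i) (q i) ?\<pi> (\<lambda>_. 1) =
    1 / CARD('d) * (\<Sum>j=1..J i. simplex_area (q i j) * (\<Sum>k=1..CARD('d). ?\<pi> (q i j k) \<bullet> 1))"
    by (simp add: sum_divide_distrib)
  moreover have "lumped_ip (J i) (q i) ?\<pi> (\<lambda>_. 1) =
    1 / CARD('d) * (\<Sum>j=1..J i. simplex_area (q i j) * (\<Sum>k=1..CARD('d). ?\<pi> (q i j k) \<bullet> 1))"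
    by (intro lumped_ip_surface i surf_space_continuous[OF \<pi>] continuous_on_const)
  ultimately have "variant_ip lumped (J i) (q i) ?\<pi> (\<lambda>_. 1) =
    1 / CARD('d) * (\<Sum>j=1..J i. simplex_area (q i j) * (\<Sum>k=1..CARD('d). ?\<pi> (q i j k) \<bullet> 1))"
    by (simp add: variant_ip_def)
  also have "\<dots> = 1 / CARD('d) * (\<Sum>j=1..J i. simplex_area (q i j) *
      (\<Sum>k=1..CARD('d). \<omega> (q i j k) \<bullet> u (q i j k)))"
    using \<pi>_vertex
    by (intro arg_cong2[where f="(*)"] sum.cong refl) (simp add: inner_commute)
  also have "\<dots> = lumped_ip (J i) (q i) \<omega> u"
    by (intro lumped_ip_surface[symmetric] i surf_space_continuous[OF \<omega>] surf_space_continuous[OF u])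
  finally show ?thesis .
qed

lemma averaged_normal_eq:
  "t0 \<noteq> t1 \<Longrightarrow> averaged_normal t0 t1 p p' = (1 / norm (area_vec p)) *\<^sub>R swept_normal t0 t1 p p'"
  by (simp add: averaged_normal_def swept_normal_def field_simps)

lemma displacement_in_surf_space:
  assumes X: "X \<in> surf_space N p"
  shows "(\<lambda>x. (X x - x) /\<^sub>R \<tau>) \<in> surf_space N p"
  unfolding surf_space_def
proof (intro CollectI conjI ballI)
  show "continuous_on (surface N p) (\<lambda>x. (X x - x) /\<^sub>R \<tau>)"
    using X by (auto simp: surf_space_def intro!: continuous_intros)
  fix j assume "j \<in> {1..N}"
  then have "affine_on (closed_simplex (p j)) X" by (rule surf_space_affine[OF X])
  then obtain L c where L: "linear L" "\<And>x. x \<in> closed_simplex (p j) \<Longrightarrow> X x = L x + c"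
    by (auto simp: affine_on_def)
  have "linear (\<lambda>x. (L x - x) /\<^sub>R \<tau>)"
    by (rule linearI) (simp_all add: linear_add[OF L(1)] linear_scale[OF L(1)] algebra_simps)
  then show "affine_on (closed_simplex (p j)) (\<lambda>x. (X x - x) /\<^sub>R \<tau>)"
    unfolding affine_on_def
    by (intro exI[of _ "\<lambda>x. (L x - x) /\<^sub>R \<tau>"] exI[of _ "c /\<^sub>R \<tau>"]) (simp add: L(2) algebra_simps)
qed

text \<open>The defining property of \<open>\<omega>\<close> replaces the lumped product by an exact
  integral of an affine function. The vertex rule brings the factor \<open>simplex_area / d\<close>;
  its \<open>norm (area_vec (q i j))\<close> cancels against the averaged normal and the factorial
  becomes \<open>fact CARD('d)\<close>.\<close>

lemma averaged_vertex_normal_displacement: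
  assumes i: "i \<in> {1..IS}" and X: "X \<in> surf_space (J i) (q i)" and "t0 < t1"
    and \<omega>: "averaged_vertex_normal t0 t1 (J i) (q i) q' \<omega>" and q': "\<And>j k. q' j k = X (q i j k)"
  shows "lumped_ip (J i) (q i) \<omega> (\<lambda>x. (X x - x) /\<^sub>R \<tau>) =
    (\<Sum>j=1..J i. swept_normal t0 t1 (q i j) (q' j) \<bullet> (\<Sum>k=1..CARD('d). q' j k - q i j k)) / (\<tau> * fact CARD('d))"
proof -
  let ?u = "\<lambda>x. (X x - x) /\<^sub>R \<tau>"
  have u: "?u \<in> surf_space (J i) (q i)" by (rule displacement_in_surf_space[OF X])
  have "lumped_ip (J i) (q i) \<omega> ?u =
      (\<Sum>j=1..J i. simplex_integral (q i j) (\<lambda>x. averaged_normal t0 t1 (q i j) (q' j) \<bullet> ?u x))"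
    using \<omega> u unfolding averaged_vertex_normal_def by blast
  also have "\<dots> = (\<Sum>j=1..J i. swept_normal t0 t1 (q i j) (q' j) \<bullet> (\<Sum>k=1..CARD('d). q' j k - q i j k) / (\<tau> * fact CARD('d)))"
  proof (intro sum.cong refl)
    fix j assume j: "j \<in> {1..J i}"
    let ?n = "averaged_normal t0 t1 (q i j) (q' j)" and ?A = "norm (area_vec (q i j))"
    have A: "?A \<noteq> 0" using area_vec_sx[OF facesI[OF i j]] by (simp add: sx_def)
    have aff: "affine_on (closed_simplex (q i j)) (\<lambda>x. ?n \<bullet> ?u x)"
    proof -
      obtain L c where L: "linear L" "\<And>x. x \<in> closed_simplex (q i j) \<Longrightarrow> ?u x = L x + c"
        using surf_space_affine[OF u j] by (auto simp: affine_on_def)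
      have "linear (\<lambda>x. ?n \<bullet> L x)"
        by (rule linearI) (simp_all add: linear_add[OF L(1)] linear_scale[OF L(1)] inner_add_right)
      then show ?thesis
        unfolding affine_on_def
        by (intro exI[of _ "\<lambda>x. ?n \<bullet> L x"] exI[of _ "?n \<bullet> c"]) (simp add: L(2) inner_add_right)
    qed
    have fact: "fact CARD('d) = real CARD('d) * fact (CARD('d) - 1)"
      using two_le_dim by (subst fact_reduce) auto
    have "(\<Sum>k=1..CARD('d). ?n \<bullet> ?u (q i j k)) = ?n \<bullet> (\<Sum>k=1..CARD('d). q' j k - q i j k) / \<tau>"
      by (simp add: q' inner_sum_right sum_distrib_left divide_inverse_commute)
    then have "simplex_integral (q i j) (\<lambda>x. ?n \<bullet> ?u x) =
        simplex_area (q i j) * (?n \<bullet> (\<Sum>k=1..CARD('d). q' j k - q i j k) / \<tau>) / CARD('d)"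
      using simplex_integral_affine[OF dim aff] by simp
    also have "\<dots> = swept_normal t0 t1 (q i j) (q' j) \<bullet> (\<Sum>k=1..CARD('d). q' j k - q i j k) / (\<tau> * fact CARD('d))"
      using A \<open>t0 < t1\<close> unfolding simplex_area_eq fact by (simp add: averaged_normal_eq)
    finally show "simplex_integral (q i j) (\<lambda>x. ?n \<bullet> ?u x) =
        swept_normal t0 t1 (q i j) (q' j) \<bullet> (\<Sum>k=1..CARD('d). q' j k - q i j k) / (\<tau> * fact CARD('d))" .
  qed
  finally show ?thesis by (simp add: sum_divide_distrib)
qed

end

lemma variant_ip_commute: "variant_ip lumped N q u v = variant_ip lumped N q v u"
  by (simp add: variant_ip_def lumped_ip_def exact_ip_def inner_commute)

theorem theorem6p1:
  fixes \<Omega> :: "'d::{finite,comm_ring_1} point set"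
    and Th :: "'d point set set"
    and IR IS IT M m :: nat
    and \<sigma> \<beta> t :: "nat \<Rightarrow> real"
    and bp bm J :: "nat \<Rightarrow> nat"
    and s :: "nat \<Rightarrow> nat \<Rightarrow> nat"
    and q q' :: "nat \<Rightarrow> nat \<Rightarrow> nat \<Rightarrow> 'd point"
    and \<T> :: "nat \<Rightarrow> 'd point set set"
    and R R' :: "nat \<Rightarrow> 'd point set"
    and lumped :: bool
    and W :: "'d point \<Rightarrow> real"
    and X \<omega> :: "nat \<Rightarrow> 'd point \<Rightarrow> 'd point"
    and \<kappa> :: "nat \<Rightarrow> 'd point \<Rightarrow> real"
  defines "\<tau> \<equiv> t (Suc m) - t m"
  assumes dim: "CARD('d) = 2 \<or> CARD('d) = 3"
    and domain: "open \<Omega>" "connected \<Omega>" "bounded \<Omega>" "\<Omega> \<noteq> {}"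
    and mesh: "bulk_mesh Th \<Omega>"
    and numbers: "2 \<le> IR" "1 \<le> IS"
    and tensions: "\<forall>i\<in>{1..IS}. 0 < \<sigma> i"
    and beta: "inj_on \<beta> {1..IR}" "(\<Sum>l=1..IR. \<beta> l) = 0"
    and phases: "\<forall>i\<in>{1..IS}. bp i \<in> {1..IR} \<and> bm i \<in> {1..IR} \<and> bp i \<noteq> bm i"
      "\<forall>i\<in>{1..IS}. \<forall>j\<in>{1..IS}. {bp i, bm i} = {bp j, bm j} \<longrightarrow> (bp i, bm i) = (bp j, bm j)"
    and times: "t 0 = 0" "\<forall>n<M. t n < t (Suc n)" "m < M"
    \<comment> \<open>the cluster at time \<open>t m\<close>\<close>
    and cluster: "polyhedral_cluster \<Omega> IS IT J s q \<T>"
    and regions: "cluster_regions \<Omega> IR IS J q bp bm R"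
    \<comment> \<open>the unknowns\<close>
    and W: "W \<in> bulk_space Th \<Omega>"
    and X: "X \<in> vec_cluster_space IS IT J s q \<T>"
    and \<kappa>: "\<kappa> \<in> cluster_space IS J q"
    \<comment> \<open>the cluster at time \<open>t (Suc m)\<close>\<close>
    and q': "\<forall>i j k. q' i j k = X i (q i j k)"
    and cluster': "polyhedral_cluster \<Omega> IS IT J s q' (\<lambda>k. (\<lambda>F. X (s k 1) ` F) ` \<T> k)"
    and regions': "cluster_regions \<Omega> IR IS J q' bp bm R'"
    and boundary_phases: "\<forall>x\<in>frontier \<Omega>. \<forall>\<^sub>F y in at x within \<Omega>. \<forall>l\<in>{1..IR}. y \<in> R l \<longleftrightarrow> y \<in> R' l"
    and \<omega>: "\<forall>i\<in>{1..IS}. averaged_vertex_normal (t m) (t (Suc m)) (J i) (q i) (q' i) (\<omega> i)"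
    \<comment> \<open>the nonlinear system\<close>
    and a: "\<forall>\<phi>\<in>bulk_space Th \<Omega>.
      (LINT x:\<Omega>|lebesgue. grad W x \<bullet> grad \<phi> x)
      + (\<Sum>i=1..IS. (\<beta> (bp i) - \<beta> (bm i)) *
          variant_ip lumped (J i) (q i)
            (nodal_interpolation (J i) (q i) (\<lambda>x. ((X i x - x) /\<^sub>R \<tau>) \<bullet> \<omega> i x)) \<phi>) = 0"
    and b: "\<forall>\<xi>\<in>cluster_space IS J q.
      (\<Sum>i=1..IS. lumped_ip (J i) (q i) (\<kappa> i) (\<xi> i))
      + (\<Sum>i=1..IS. (\<beta> (bp i) - \<beta> (bm i)) * variant_ip lumped (J i) (q i) W (\<xi> i)) = 0"
    and c: "\<forall>\<eta>\<in>vec_cluster_space IS IT J s q \<T>.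
      (\<Sum>i=1..IS. lumped_ip (J i) (q i) (\<lambda>x. \<kappa> i x *\<^sub>R \<omega> i x) (\<eta> i))
      + (\<Sum>i=1..IS. \<sigma> i * surf_stiffness (J i) (q i) (X i) (\<eta> i)) = 0"
  shows "energy \<sigma> IS J q' + \<tau> * (LINT x:\<Omega>|lebesgue. (norm (grad W x))\<^sup>2) \<le> energy \<sigma> IS J q
    \<and> energy_content \<beta> IR R' = energy_content \<beta> IR R"
proof -
  interpret A: phase_cluster \<Omega> IS IT J s q \<T> IR bp bm R \<beta>
    using phases(1) by (intro phase_cluster.intro phase_cluster_axioms.intro cluster dim domain(1) regions) blast
  interpret B: phase_cluster \<Omega> IS IT J s q' "\<lambda>k. (\<lambda>F. X (s k 1) ` F) ` \<T> k" IR bp bm R' \<beta>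
    using phases(1) by (intro phase_cluster.intro phase_cluster_axioms.intro cluster' dim domain(1) regions') blast
  have tm: "t m < t (Suc m)" using times by blast
  then have \<tau>: "\<tau> > 0" by (simp add: \<tau>_def)
  define u where "u i x = (X i x - x) /\<^sub>R \<tau>" for i x
  define \<pi> where "\<pi> i = nodal_interpolation (J i) (q i) (\<lambda>x. u i x \<bullet> \<omega> i x)" for i
  define c where "c i = \<beta> (bp i) - \<beta> (bm i)" for i
  have Xi: "X i \<in> surf_space (J i) (q i)" if "i \<in> {1..IS}" for i
    using X that by (auto simp: vec_cluster_space_def)
  have ui: "u i \<in> surf_space (J i) (q i)" if "i \<in> {1..IS}" for i
    unfolding u_def by (rule A.displacement_in_surf_space[OF Xi[OF that]])
  have \<kappa>i: "\<kappa> i \<in> surf_space (J i) (q i)" if "i \<in> {1..IS}" for i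
    using \<kappa> that by (auto simp: cluster_space_def)
  have \<omega>i: "\<omega> i \<in> surf_space (J i) (q i)" if "i \<in> {1..IS}" for i
    using \<omega> that by (auto simp: averaged_vertex_normal_def)
  have \<pi>_mem: "\<pi> \<in> cluster_space IS J q"
    unfolding cluster_space_def \<pi>_def using A.nodal_interpolation(1) by blast
  \<comment> \<open>The new positions of the three surfaces agree at a junction and so do the old
    ones, hence the velocity satisfies the junction condition and is admissible in (c).\<close>
  have u_mem: "u \<in> vec_cluster_space IS IT J s q \<T>"
    using X ui unfolding vec_cluster_space_def by (simp add: u_def)
  have a': "(LINT x:\<Omega>|lebesgue. grad W x \<bullet> grad \<phi> x) + (\<Sum>i=1..IS. c i * variant_ip lumped (J i) (q i) (\<pi> i) \<phi>) = 0"
    if "\<phi> \<in> bulk_space Th \<Omega>" for \<phi>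
    using a that unfolding \<pi>_def u_def c_def by blast
  have "(LINT x:\<Omega>|lebesgue. (norm (grad W x))\<^sup>2) = - (\<Sum>i=1..IS. c i * variant_ip lumped (J i) (q i) (\<pi> i) W)"
    using a'[OF W] by (simp add: power2_norm_eq_inner)
  \<comment> \<open>(a) and (b) use the same variant of the product, so by symmetry the coupling
    term of (a) at \<open>W\<close> is the coupling term of (b) at \<open>\<pi>\<close>.\<close>
  also have "\<dots> = (\<Sum>i=1..IS. lumped_ip (J i) (q i) (\<kappa> i) (\<pi> i))"
    using bspec[OF b \<pi>_mem] by (simp add: c_def variant_ip_commute[of lumped _ _ W])
  also have "\<dots> = (\<Sum>i=1..IS. lumped_ip (J i) (q i) (\<lambda>x. \<kappa> i x *\<^sub>R \<omega> i x) (u i))"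
    unfolding \<pi>_def by (intro sum.cong refl A.lumped_ip_nodal_interpolation ui \<kappa>i \<omega>i)
  also have "\<dots> = - (\<Sum>i=1..IS. \<sigma> i * surf_stiffness (J i) (q i) (X i) (u i))"
    using bspec[OF c u_mem] by simp
  finally have grad_W: "\<tau> * (LINT x:\<Omega>|lebesgue. (norm (grad W x))\<^sup>2) =
      - (\<Sum>i=1..IS. \<sigma> i * (\<tau> * surf_stiffness (J i) (q i) (X i) (u i)))"
    by (simp add: sum_distrib_left mult.left_commute)
  have "energy \<sigma> IS J q' - energy \<sigma> IS J q =
      (\<Sum>i=1..IS. \<sigma> i * (\<Sum>j=1..J i. simplex_area (q' i j) - simplex_area (q i j)))"
    by (simp add: energy_def sum_subtractf right_diff_distrib)
  also have "\<dots> \<le> (\<Sum>i=1..IS. \<sigma> i * (\<tau> * surf_stiffness (J i) (q i) (X i) (u i)))"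
  proof (intro sum_mono mult_left_mono)
    fix i assume i: "i \<in> {1..IS}"
    show "0 \<le> \<sigma> i" using tensions i by (simp add: less_imp_le)
    show "(\<Sum>j=1..J i. simplex_area (q' i j) - simplex_area (q i j)) \<le> \<tau> * surf_stiffness (J i) (q i) (X i) (u i)"
      unfolding surf_stiffness_def sum_distrib_left
    proof (intro sum_mono)
      fix j assume j: "j \<in> {1..J i}"
      have "q' i j = (\<lambda>k. X i (q i j k))" using q' by auto
      then show "simplex_area (q' i j) - simplex_area (q i j) \<le> \<tau> * simplex_integral (q i j)
          (\<lambda>x. \<Sum>k\<in>UNIV. surf_grad (closed_simplex (q i j)) (\<lambda>y. X i y $ k) x \<bullet>
            surf_grad (closed_simplex (q i j)) (\<lambda>y. u i y $ k) x)"
        unfolding u_def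
        using area_decrease[OF dim _ _ surf_space_affine[OF Xi[OF i] j] \<tau>] A.nondegenerate[OF i j] by simp
    qed
  qed
  finally have energy: "energy \<sigma> IS J q' + \<tau> * (LINT x:\<Omega>|lebesgue. (norm (grad W x))\<^sup>2) \<le> energy \<sigma> IS J q"
    using grad_W by simp

  have one: "(\<lambda>_. 1) \<in> bulk_space Th \<Omega>"
    unfolding bulk_space_def affine_on_def
    by (auto intro!: exI[of _ "\<lambda>_. 0"] linear_zero)
  have "grad (\<lambda>_. 1) x = 0" for x :: "'d point"
    by (simp add: grad_def vec_eq_iff)
  then have "0 = (\<Sum>i=1..IS. c i * variant_ip lumped (J i) (q i) (\<pi> i) (\<lambda>_. 1))"
    using a'[OF one] by (simp add: set_lebesgue_integral_def)
  also have "\<dots> = (\<Sum>i=1..IS. c i * lumped_ip (J i) (q i) (\<omega> i) (u i))"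
    unfolding \<pi>_def
    by (intro sum.cong refl arg_cong2[where f="(*)"] A.variant_ip_nodal_interpolation_one ui \<omega>i)
  also have "\<dots> = (\<Sum>i=1..IS. c i * ((\<Sum>j=1..J i. swept_normal (t m) (t (Suc m)) (q i j) (q' i j) \<bullet>
      (\<Sum>k=1..CARD('d). q' i j k - q i j k)) / (\<tau> * fact CARD('d))))"
    unfolding u_def using \<omega> q'
    by (intro sum.cong refl arg_cong2[where f="(*)"] A.averaged_vertex_normal_displacement Xi tm) auto
  also have "\<dots> = (\<Sum>i=1..IS. c i * (\<Sum>j=1..J i. swept_normal (t m) (t (Suc m)) (q i j) (q' i j) \<bullet>
      (\<Sum>k=1..CARD('d). q' i j k - q i j k))) / (\<tau> * fact CARD('d))"
    unfolding times_divide_eq_right sum_divide_distrib[symmetric] ..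
  \<comment> \<open>The junction condition on \<open>X\<close> lets the fluxes cancel. From here on
    only the two embedded end positions occur, no longer the simplices moving between them.\<close>
  also have "(\<Sum>i=1..IS. c i * (\<Sum>j=1..J i. swept_normal (t m) (t (Suc m)) (q i j) (q' i j) \<bullet>
      (\<Sum>k=1..CARD('d). q' i j k - q i j k))) =
    (\<Sum>i=1..IS. c i * (\<Sum>j=1..J i. area_vec (q' i j) \<bullet> q' i j 1 - area_vec (q i j) \<bullet> q i j 1))"
    unfolding c_def using q' X
    by (intro A.sum_swept_volume[symmetric, where X=X] tm) (auto simp: A.matching_def vec_cluster_space_def)
  also have "\<dots> = fact CARD('d) * (energy_content \<beta> IR R - energy_content \<beta> IR R')"
    unfolding c_def
    by (rule energy_content_diff[OF A.phase_cluster_axioms B.phase_cluster_axioms domain(3) boundary_phases, symmetric])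
  finally have "energy_content \<beta> IR R' = energy_content \<beta> IR R"
    using \<tau> by simp
  with energy show ?thesis ..
qed

end
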